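(* Let $\ell$ be bounded by a polynomial in $n$ and let $\epsilon$ be inverse-polynomial in $n$. Then $(n,\ell,\epsilon)$-Con-$1/k$-Division is polynomial-time reducible to $(n,\ell,k)$-NeckSplit.
   Context: $(n,\ell,\epsilon)$-Con-$1/k$-Division: the input consists of value measures $\mu_i$ on an interval $O$ for $n$ agents $i=1,\dots,n$, and an integer $k\le n$; the measures are given by piecewise constant densities, where the number of pieces is at most $p_{\mathcal M}(n)$ and the volume of each piece at most $p_{\mathcal V}(n)$ for fixed polynomials $p_{\mathcal M},p_{\mathcal V}$. The output is a partition of $O$ into $k$ parts $O_1,\dots,O_k$ (each a union of subintervals) defined by $(k-1)\ell$ cuts, such that $|\mu_i(O_t)-\mu_i(O_j)|\le\epsilon$ for all $t,j$ and all agents $i$. $(n,\ell,k)$-NeckSplit: the input is $k\cdot m$ beads placed on an interval $O$, with $\alpha_i k$ beads of colour $i$ for $i=1,\dots,n$, $\alpha_i$ positive integers, $k\le n$. The output is a partition of $O$ into $k$ parts $O_1,\dots,O_k$ using $(k-1)\ell$ cuts such that for each colour $i$ and each $j\in\{1,\dots,k\}$, the number $b_i(O_j)$ of beads of colour $i$ in $O_j$ equals $\alpha_i$. *)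

theory Defs
  imports "HOL-Analysis.Analysis" "HOL-Computational_Algebra.Polynomial"
begin

section \<open>Deterministic multitape Turing machines\<close>

text \<open>
  Tape cells are indexed by the integers and hold symbols, which are natural numbers; symbol 0 is
  the blank. The machine stops on entering its halting state, and the step function is the
  identity on halted configurations.
\<close>

datatype move = MoveLeft | Stay | MoveRight

type_synonym tape = "(int \<Rightarrow> nat) \<times> int"

type_synonym config = "nat \<times> tape list"

record turing_machine =
  num_tapes :: nat
  num_states :: nat
  num_symbols :: nat
  start_state :: nat
  halt_state :: nat
  transition :: "nat \<Rightarrow> nat list \<Rightarrow> nat \<times> (nat \<times> move) list"

fun read_tape :: "tape \<Rightarrow> nat" where
  "read_tape (c, h) = c h"

fun move_head :: "move \<Rightarrow> int \<Rightarrow> int" where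
  "move_head MoveLeft h = h - 1"
| "move_head Stay h = h"
| "move_head MoveRight h = h + 1"

fun act_tape :: "nat \<times> move \<Rightarrow> tape \<Rightarrow> tape" where
  "act_tape (s, d) (c, h) = (c(h := s), move_head d h)"

fun tm_step :: "turing_machine \<Rightarrow> config \<Rightarrow> config" where
  "tm_step M (q, ts) =
     (if q = halt_state M then (q, ts)
      else (case transition M q (map read_tape ts) of
              (q', acts) \<Rightarrow> (q', map2 act_tape acts ts)))"

text \<open>
  Tape 0 is the input tape and tape 1 the output tape. The bound on the
  number of symbols leaves room for the blank and the six letters of strings.
\<close>

definition valid_tm :: "turing_machine \<Rightarrow> bool" where
  "valid_tm M \<longleftrightarrow>
     2 \<le> num_tapes M \<and> 7 \<le> num_symbols M \<and>
     start_state M < num_states M \<and> halt_state M < num_states M \<and>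
     (\<forall>q < num_states M. \<forall>ss. length ss = num_tapes M \<and> set ss \<subseteq> {..<num_symbols M} \<longrightarrow>
        (case transition M q ss of (q', acts) \<Rightarrow>
           q' < num_states M \<and> length acts = num_tapes M \<and>
           fst ` set acts \<subseteq> {..<num_symbols M}))"

datatype letter = Digit0 | Digit1 | Minus | Stop | Open | Close

fun symbol_of :: "letter \<Rightarrow> nat" where
  "symbol_of Digit0 = 1"
| "symbol_of Digit1 = 2"
| "symbol_of Minus = 3"
| "symbol_of Stop = 4"
| "symbol_of Open = 5"
| "symbol_of Close = 6"

definition contents_of :: "letter list \<Rightarrow> int \<Rightarrow> nat" where
  "contents_of w i = (if 0 \<le> i \<and> i < int (length w) then symbol_of (w ! nat i) else 0)"

definition initial_config :: "turing_machine \<Rightarrow> letter list \<Rightarrow> config" where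
  "initial_config M w =
     (start_state M, (contents_of w, 0) # replicate (num_tapes M - 1) (contents_of [], 0))"

definition computes_within :: "turing_machine \<Rightarrow> letter list \<Rightarrow> letter list \<Rightarrow> nat \<Rightarrow> bool" where
  "computes_within M w out t \<longleftrightarrow>
     (case (tm_step M ^^ t) (initial_config M w) of (q, ts) \<Rightarrow>
        q = halt_state M \<and> fst (ts ! 1) = contents_of out)"


section \<open>Encodings of finite objects as strings\<close>

text \<open>
  Binary digits are written least significant digit first. Every encoding below is
  self-delimiting, as proved for the basic combinators, so that concatenation is a sound encoding
  of tuples.
\<close>

type_synonym 'a encoding = "'a \<Rightarrow> letter list"

fun binary :: "nat \<Rightarrow> letter list" where
  "binary n = (if n = 0 then [] else (if odd n then Digit1 else Digit0) # binary (n div 2))"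

declare binary.simps [simp del]

definition enc_nat :: "nat encoding" where
  "enc_nat n = binary n @ [Stop]"

definition enc_int :: "int encoding" where
  "enc_int z = (if z < 0 then Minus # enc_nat (nat (- z)) else enc_nat (nat z))"

definition enc_prod :: "'a encoding \<Rightarrow> 'b encoding \<Rightarrow> ('a \<times> 'b) encoding" where
  "enc_prod e1 e2 = (\<lambda>(x, y). e1 x @ e2 y)"

definition enc_list :: "'a encoding \<Rightarrow> 'a list encoding" where
  "enc_list e xs = Open # concat (map e xs) @ [Close]"

definition self_delimiting :: "'a encoding \<Rightarrow> bool" where
  "self_delimiting e \<longleftrightarrow> (\<forall>x y u v. e x @ u = e y @ v \<longrightarrow> x = y \<and> u = v)"

lemma binary_Stop_eq:
  "binary m @ Stop # u = binary n @ Stop # v \<Longrightarrow> m = n \<and> u = v"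
proof (induction m arbitrary: n rule: less_induct)
  case (less m)
  show ?case
  proof (cases "m = 0 \<or> n = 0")
    case True
    then show ?thesis
      using less.prems binary.simps[of m] binary.simps[of n] by (auto split: if_splits)
  next
    case False
    then have "odd m = odd n \<and> binary (m div 2) @ Stop # u = binary (n div 2) @ Stop # v"
      using less.prems by (subst (asm) binary.simps[of m], subst (asm) binary.simps[of n]) (simp split: if_splits)
    moreover from this have "m div 2 = n div 2 \<and> u = v"
      using less.IH[of "m div 2" "n div 2"] False by simp
    ultimately show ?thesis
      by (metis odd_two_times_div_two_succ even_two_times_div_two)
  qed
qed

lemma self_delimiting_enc_nat: "self_delimiting enc_nat"
proof -
  have "x = y \<and> u = v" if "enc_nat x @ u = enc_nat y @ v" for x y u v
  proof (rule binary_Stop_eq)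
    show "binary x @ Stop # u = binary y @ Stop # v"
      using that unfolding enc_nat_def append_assoc append.simps .
  qed
  then show ?thesis unfolding self_delimiting_def by blast
qed

lemma enc_nat_hd: "enc_nat n \<noteq> []" "hd (enc_nat n) \<in> {Digit0, Digit1, Stop}"
  unfolding enc_nat_def by (simp, subst binary.simps, simp)

lemma self_delimiting_enc_int: "self_delimiting enc_int"
proof -
  have nat_neq_Minus: "enc_nat m @ u \<noteq> Minus # w" for m u w
  proof
    assume "enc_nat m @ u = Minus # w"
    then have "hd (enc_nat m) = Minus"
      using enc_nat_hd(1) by (metis hd_append2 list.sel(1))
    then show False using enc_nat_hd(2)[of m] by simp
  qed
  have dest: "m = n \<and> u = v" if "enc_nat m @ u = enc_nat n @ v" for m n u v
    using that self_delimiting_enc_nat unfolding self_delimiting_def by blast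
  have "x = y \<and> u = v" if eq: "enc_int x @ u = enc_int y @ v" for x y u v
  proof -
    have sgn: "x < 0 \<longleftrightarrow> y < 0"
      using eq nat_neq_Minus[of "nat x" u "enc_nat (nat (- y)) @ v"]
        nat_neq_Minus[of "nat y" v "enc_nat (nat (- x)) @ u"]
      by (cases "x < 0"; cases "y < 0") (simp_all add: enc_int_def)
    show ?thesis
    proof (cases "x < 0")
      case True
      then have "nat (- x) = nat (- y) \<and> u = v"
        using eq sgn by (intro dest) (simp add: enc_int_def)
      then show ?thesis using True sgn by linarith
    next
      case False
      then have "nat x = nat y \<and> u = v"
        using eq sgn by (intro dest) (simp add: enc_int_def)
      then show ?thesis using False sgn by linarith
    qed
  qed
  then show ?thesis unfolding self_delimiting_def by blast
qed

lemma self_delimiting_enc_prod: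
  "self_delimiting e1 \<Longrightarrow> self_delimiting e2 \<Longrightarrow> self_delimiting (enc_prod e1 e2)"
  unfolding self_delimiting_def enc_prod_def split_paired_All prod.case append_assoc prod.inject
  by blast

lemma self_delimiting_enc_list:
  assumes e: "self_delimiting e" and hd: "\<And>x. e x \<noteq> [] \<and> hd (e x) \<noteq> Close"
  shows "self_delimiting (enc_list e)"
proof -
  have ne: "e x @ u \<noteq> Close # w" for x u w
    using hd[of x] by (cases "e x") auto
  have key: "xs = ys \<and> u = v"
    if "concat (map e xs) @ Close # u = concat (map e ys) @ Close # v" for xs ys u v
    using that
  proof (induction xs arbitrary: ys)
    case Nil
    then show ?case using ne by (cases ys) (simp_all, metis)
  next
    case (Cons x xs)
    show ?case
    proof (cases ys)
      case Nil
      then show ?thesis using Cons.prems ne by simp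
    next
      case [simp]: (Cons y ys')
      have "x = y \<and> concat (map e xs) @ Close # u = concat (map e ys') @ Close # v"
        using Cons.prems e unfolding self_delimiting_def list.map concat.simps append_assoc Cons by blast
      then show ?thesis using Cons.IH by auto
    qed
  qed
  have "xs = ys \<and> u = v" if "enc_list e xs @ u = enc_list e ys @ v" for xs ys u v
    by (rule key) (use that in \<open>simp add: enc_list_def\<close>)
  then show ?thesis unfolding self_delimiting_def by blast
qed

text \<open>
  Rational numbers are presented as fractions, which need not be in lowest terms. The
  well-formedness predicates below ask for positive denominators.
\<close>

type_synonym frac = "int \<times> nat"

definition frac_val :: "frac \<Rightarrow> real" where
  "frac_val r = of_int (fst r) / of_nat (snd r)"

definition proper_frac :: "frac \<Rightarrow> bool" where
  "proper_frac r \<longleftrightarrow> 0 < snd r"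

definition enc_frac :: "frac encoding" where
  "enc_frac = enc_prod enc_int enc_nat"


section \<open>Search problems and polynomial-time reductions\<close>

text \<open>
  Running times are only constrained on encodings of elements of the given domain \<open>A\<close>; on other
  inputs a machine can always be stopped by a polynomial clock.
\<close>

definition poly_time_computable_on ::
    "'a set \<Rightarrow> 'a encoding \<Rightarrow> 'b encoding \<Rightarrow> ('a \<Rightarrow> 'b) \<Rightarrow> bool" where
  "poly_time_computable_on A e e' f \<longleftrightarrow>
     (\<exists>M (p :: nat poly). valid_tm M \<and>
        (\<forall>x\<in>A. computes_within M (e x) (e' (f x)) (poly p (length (e x)))))"

record ('a, 'b) search_problem =
  instances :: "'a set"
  solutions :: "'a \<Rightarrow> 'b set"
  enc_instance :: "'a encoding"
  enc_solution :: "'b encoding"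

definition poly_time_reduction ::
    "('a, 'b) search_problem \<Rightarrow> ('c, 'd) search_problem \<Rightarrow> ('a \<Rightarrow> 'c) \<Rightarrow> ('a \<times> 'd \<Rightarrow> 'b) \<Rightarrow> bool" where
  "poly_time_reduction P Q f g \<longleftrightarrow>
     f ` instances P \<subseteq> instances Q \<and>
     (\<forall>x\<in>instances P. \<forall>y\<in>solutions Q (f x). g (x, y) \<in> solutions P x) \<and>
     poly_time_computable_on (instances P) (enc_instance P) (enc_instance Q) f \<and>
     poly_time_computable_on {(x, y). x \<in> instances P \<and> y \<in> solutions Q (f x)}
       (enc_prod (enc_instance P) (enc_solution Q)) (enc_solution P) g"


section \<open>Dividing an interval by cuts\<close>

text \<open>
  The cuts are listed in weakly increasing order, so that redundant cuts are allowed; the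
  \<open>i\<close>-th label is the part to which the \<open>i\<close>-th subinterval belongs. Agents, colours and parts are
  numbered from 0. Every subinterval except the first is open on the left and closed on the right,
  so that the parts are pairwise disjoint and cover the whole interval.
\<close>

record division =
  cuts :: "frac list"
  labels :: "nat list"

definition enc_division :: "division encoding" where
  "enc_division D = enc_list enc_frac (cuts D) @ enc_list enc_nat (labels D)"

definition interval_of :: "frac \<times> frac \<Rightarrow> real set" where
  "interval_of ab = {frac_val (fst ab)..frac_val (snd ab)}"

definition proper_interval :: "frac \<times> frac \<Rightarrow> bool" where
  "proper_interval ab \<longleftrightarrow>
     proper_frac (fst ab) \<and> proper_frac (snd ab) \<and> frac_val (fst ab) < frac_val (snd ab)"

definition is_division :: "frac \<times> frac \<Rightarrow> nat \<Rightarrow> nat \<Rightarrow> division \<Rightarrow> bool" where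
  "is_division ab k c D \<longleftrightarrow>
     length (cuts D) = c \<and> list_all proper_frac (cuts D) \<and>
     sorted (map frac_val (cuts D)) \<and> frac_val ` set (cuts D) \<subseteq> interval_of ab \<and>
     length (labels D) = Suc c \<and> set (labels D) \<subseteq> {..<k}"

definition subinterval :: "frac \<times> frac \<Rightarrow> division \<Rightarrow> nat \<Rightarrow> real set" where
  "subinterval ab D i =
     {x \<in> interval_of ab.
        (0 < i \<longrightarrow> frac_val (cuts D ! (i - 1)) < x) \<and>
        (i < length (cuts D) \<longrightarrow> x \<le> frac_val (cuts D ! i))}"

definition part :: "frac \<times> frac \<Rightarrow> division \<Rightarrow> nat \<Rightarrow> real set" where
  "part ab D t = (\<Union>i\<in>{i. i < length (labels D) \<and> labels D ! i = t}. subinterval ab D i)"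


section \<open>Approximate consensus division into equal shares\<close>

text \<open>
  A piece is a triple of its left endpoint, its right endpoint and the height of the density on
  it; the density vanishes outside the listed pieces.
\<close>

type_synonym piece = "frac \<times> frac \<times> frac"

definition piece_left :: "piece \<Rightarrow> real" where
  "piece_left = (\<lambda>(l, r, h). frac_val l)"

definition piece_right :: "piece \<Rightarrow> real" where
  "piece_right = (\<lambda>(l, r, h). frac_val r)"

definition piece_height :: "piece \<Rightarrow> real" where
  "piece_height = (\<lambda>(l, r, h). frac_val h)"

definition piece_volume :: "piece \<Rightarrow> real" where
  "piece_volume P = (piece_right P - piece_left P) * piece_height P"

definition proper_piece :: "frac \<times> frac \<Rightarrow> piece \<Rightarrow> bool" where
  "proper_piece ab P \<longleftrightarrow>
     (case P of (l, r, h) \<Rightarrow> proper_frac l \<and> proper_frac r \<and> proper_frac h) \<and>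
     piece_left P < piece_right P \<and> {piece_left P..piece_right P} \<subseteq> interval_of ab \<and>
     0 \<le> piece_height P"

definition step_density :: "piece list \<Rightarrow> real \<Rightarrow> real" where
  "step_density Ps x =
     (\<Sum>P\<leftarrow>Ps. piece_height P * indicator {piece_left P<..piece_right P} x)"

definition value_measure :: "piece list \<Rightarrow> real measure" where
  "value_measure Ps = density lborel (\<lambda>x. ennreal (step_density Ps x))"

record con_instance =
  con_parts :: nat
  con_interval :: "frac \<times> frac"
  con_agents :: "piece list list"

definition num_agents :: "con_instance \<Rightarrow> nat" where
  "num_agents X = length (con_agents X)"

definition enc_con_instance :: "con_instance encoding" where
  "enc_con_instance X =
     enc_nat (num_agents X) @ enc_nat (con_parts X) @ enc_prod enc_frac enc_frac (con_interval X) @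
     enc_list (enc_list (enc_prod enc_frac (enc_prod enc_frac enc_frac))) (con_agents X)"

definition is_con_instance :: "real poly \<Rightarrow> real poly \<Rightarrow> con_instance \<Rightarrow> bool" where
  "is_con_instance pM pV X \<longleftrightarrow>
     1 \<le> con_parts X \<and> con_parts X \<le> num_agents X \<and> proper_interval (con_interval X) \<and>
     (\<forall>Ps\<in>set (con_agents X).
        real (length Ps) \<le> poly pM (real (num_agents X)) \<and>
        list_all (proper_piece (con_interval X)) Ps \<and>
        sorted_wrt (\<lambda>P P'. piece_right P \<le> piece_left P') Ps \<and>
        (\<forall>P\<in>set Ps. piece_volume P \<le> poly pV (real (num_agents X))))"

definition is_con_solution ::
    "(nat \<Rightarrow> nat) \<Rightarrow> (nat \<Rightarrow> real) \<Rightarrow> con_instance \<Rightarrow> division \<Rightarrow> bool" where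
  "is_con_solution ell \<epsilon> X D \<longleftrightarrow>
     is_division (con_interval X) (con_parts X) ((con_parts X - 1) * ell (num_agents X)) D \<and>
     (\<forall>Ps\<in>set (con_agents X). \<forall>t<con_parts X. \<forall>j<con_parts X.
        \<bar>measure (value_measure Ps) (part (con_interval X) D t) -
          measure (value_measure Ps) (part (con_interval X) D j)\<bar> \<le> \<epsilon> (num_agents X))"

definition con_division ::
    "real poly \<Rightarrow> real poly \<Rightarrow> (nat \<Rightarrow> nat) \<Rightarrow> (nat \<Rightarrow> real) \<Rightarrow> (con_instance, division) search_problem"
  where
  "con_division pM pV ell \<epsilon> =
     \<lparr>instances = Collect (is_con_instance pM pV),
      solutions = (\<lambda>X. Collect (is_con_solution ell \<epsilon> X)),
      enc_instance = enc_con_instance,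
      enc_solution = enc_division\<rparr>"


section \<open>Necklace splitting\<close>

text \<open>
  A bead is given by its position and its colour. Beads occupy pairwise distinct positions, so
  that a cut can separate any two of them; a cut at the position of a bead passes just to the
  right of that bead, because subintervals are closed on the right.
\<close>

record neck_instance =
  neck_colours :: nat
  neck_parts :: nat
  neck_interval :: "frac \<times> frac"
  neck_beads :: "(frac \<times> nat) list"

definition enc_neck_instance :: "neck_instance encoding" where
  "enc_neck_instance Y =
     enc_nat (neck_colours Y) @ enc_nat (neck_parts Y) @
     enc_prod enc_frac enc_frac (neck_interval Y) @
     enc_list (enc_prod enc_frac enc_nat) (neck_beads Y)"

definition beads_in :: "neck_instance \<Rightarrow> nat \<Rightarrow> real set \<Rightarrow> nat" where
  "beads_in Y i S = length (filter (\<lambda>(x, c). c = i \<and> frac_val x \<in> S) (neck_beads Y))"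

definition is_neck_instance :: "neck_instance \<Rightarrow> bool" where
  "is_neck_instance Y \<longleftrightarrow>
     1 \<le> neck_parts Y \<and> neck_parts Y \<le> neck_colours Y \<and> proper_interval (neck_interval Y) \<and>
     (\<forall>(x, c)\<in>set (neck_beads Y).
        proper_frac x \<and> frac_val x \<in> interval_of (neck_interval Y) \<and> c < neck_colours Y) \<and>
     distinct (map (frac_val \<circ> fst) (neck_beads Y)) \<and>
     (\<forall>i<neck_colours Y. \<exists>\<alpha>>0. beads_in Y i (interval_of (neck_interval Y)) = \<alpha> * neck_parts Y)"

text \<open>The number of beads of colour \<open>i\<close> divided by the number of parts:\<close>

definition bead_share :: "neck_instance \<Rightarrow> nat \<Rightarrow> nat" where
  "bead_share Y i = beads_in Y i (interval_of (neck_interval Y)) div neck_parts Y"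

definition is_neck_solution :: "(nat \<Rightarrow> nat) \<Rightarrow> neck_instance \<Rightarrow> division \<Rightarrow> bool" where
  "is_neck_solution ell Y D \<longleftrightarrow>
     is_division (neck_interval Y) (neck_parts Y) ((neck_parts Y - 1) * ell (neck_colours Y)) D \<and>
     (\<forall>i<neck_colours Y. \<forall>j<neck_parts Y.
        beads_in Y i (part (neck_interval Y) D j) = bead_share Y i)"

definition neck_split :: "(nat \<Rightarrow> nat) \<Rightarrow> (neck_instance, division) search_problem" where
  "neck_split ell =
     \<lparr>instances = Collect is_neck_instance,
      solutions = (\<lambda>Y. Collect (is_neck_solution ell Y)),
      enc_instance = enc_neck_instance,
      enc_solution = enc_division\<rparr>"


section \<open>Growth conditions\<close>

definition poly_bounded :: "(nat \<Rightarrow> real) \<Rightarrow> bool" where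
  "poly_bounded a \<longleftrightarrow> (\<exists>p :: real poly. \<forall>n\<ge>1. a n \<le> poly p (real n))"

definition inverse_poly :: "(nat \<Rightarrow> real) \<Rightarrow> bool" where
  "inverse_poly \<epsilon> \<longleftrightarrow> (\<forall>n\<ge>1. 0 < \<epsilon> n) \<and> poly_bounded (\<lambda>n. 1 / \<epsilon> n)"

end

theory Submission
  imports Defs
begin

text \<open>
  An instance of consensus division becomes a necklace by putting \<open>k\<close> beads of colour \<open>i\<close> close to
  each point where the mass accumulated in a piece of the density of agent \<open>i\<close> is a positive multiple
  of \<open>1 / N\<close>. One more group of \<open>k\<close> beads at the left end of the interval makes the number of
  beads positive. Shifting the \<open>s\<close>-th bead by \<open>(s + 1) / D\<close>, where \<open>D\<close> is at least the number of
  beads times the square of a common bound on the denominators, makes the positions distinct without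
  changing the order of different points. On every initial segment the number of beads of one
  colour differs from \<open>k N\<close> times the mass by at most \<open>k (2 M + 1)\<close> if the density has \<open>M\<close> pieces.
  Hence a splitting of the necklace with \<open>c\<close> cuts is, as it stands, a consensus division with error at
  most \<open>4 (c + 1) (2 M + 1) / N\<close>, and \<open>N\<close> can be chosen as a polynomial in the input length.
  Polynomial running times are established compositionally: the functions computable in
  polynomial time are closed under iteration along a list, provided that the intermediate results have
  polynomial size.
\<close>

section \<open>A stack language and its compilation to Turing machines\<close>

text \<open>The map back to divisions can be a projection because the necklace keeps the interval
  and the number of parts, so all rounding is paid for by the choice of \<open>N\<close>. Groups of
  \<open>k\<close> beads make every colour count divisible by \<open>k\<close> by construction. In
  the error \<open>k (2 M + 1)\<close>, a piece loses at most one point to rounding and at most one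
  to the shift, and the group at the left end gives the remaining 1. Both ends of each of at most
  \<open>c + 1\<close> subintervals contribute such an error, and two parts are compared, whence the
  factor 4. The polynomial bound on the volumes keeps the number of beads polynomial although
  lengths and heights are written in binary. The obstacle that shapes the larger half of the proof
  is that reducibility is stated for concrete Turing machines: both maps must be realised on
  encoding strings. A language of stack programs, whose control is finite and whose branching
  depends on single letters, is close enough to machines to be compiled with a factor of 2 in
  time.\<close>

datatype com =
    Skip
  | Push nat letter
  | Pop nat
  | Emit letter
  | Seq com com (infixr ";;" 60)
  | Sw nat "letter option \<Rightarrow> com"
  | While nat "letter option \<Rightarrow> bool" com

type_synonym mem = "nat \<Rightarrow> letter list"

fun peek :: "letter list \<Rightarrow> letter option" where
  "peek [] = None"
| "peek (a # _) = Some a"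

fun step :: "com list \<times> mem \<times> letter list \<Rightarrow> com list \<times> mem \<times> letter list" where
  "step ([], \<sigma>, out) = ([], \<sigma>, out)"
| "step (Skip # K, \<sigma>, out) = (K, \<sigma>, out)"
| "step (Push i a # K, \<sigma>, out) = (K, \<sigma>(i := a # \<sigma> i), out)"
| "step (Pop i # K, \<sigma>, out) = (K, \<sigma>(i := tl (\<sigma> i)), out)"
| "step (Emit a # K, \<sigma>, out) = (K, \<sigma>, out @ [a])"
| "step (Seq c d # K, \<sigma>, out) = (c # d # K, \<sigma>, out)"
| "step (Sw i f # K, \<sigma>, out) = (f (peek (\<sigma> i)) # K, \<sigma>, out)"
| "step (While i P c # K, \<sigma>, out) =
     (if P (peek (\<sigma> i)) then c # While i P c # K else K, \<sigma>, out)"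

primrec uses :: "nat \<Rightarrow> com \<Rightarrow> bool" where
  "uses m Skip \<longleftrightarrow> True"
| "uses m (Push i a) \<longleftrightarrow> i < m"
| "uses m (Pop i) \<longleftrightarrow> i < m"
| "uses m (Emit a) \<longleftrightarrow> True"
| "uses m (Seq c d) \<longleftrightarrow> uses m c \<and> uses m d"
| "uses m (Sw i f) \<longleftrightarrow> i < m \<and> (\<forall>x. uses m (f x))"
| "uses m (While i P c) \<longleftrightarrow> i < m \<and> uses m c"

text \<open>
  The lists of commands that are still to be executed at some point during a run of \<open>c\<close> followed
  by \<open>K\<close>. There are finitely many of them, so that they can serve as states of a Turing machine.
\<close>

primrec conts :: "com \<Rightarrow> com list \<Rightarrow> com list set" where
  "conts Skip K = {Skip # K}"
| "conts (Push i a) K = {Push i a # K}"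
| "conts (Pop i) K = {Pop i # K}"
| "conts (Emit a) K = {Emit a # K}"
| "conts (Seq c d) K = insert (Seq c d # K) (conts c (d # K) \<union> conts d K)"
| "conts (Sw i f) K = insert (Sw i f # K) (\<Union>x. conts (f x) K)"
| "conts (While i P c) K = insert (While i P c # K) (conts c (While i P c # K))"

lemma UNIV_letter: "UNIV = {Digit0, Digit1, Minus, Stop, Open, Close}"
  using letter.exhaust by auto

text \<open>\<open>Sw\<close> branches over letters; only because there are finitely many of them
  does \<open>conts\<close> yield finite sets, and hence finitely many machine states.\<close>

instance letter :: finite
  by standard (simp add: UNIV_letter)

lemma finite_conts: "finite (conts c K)"
  by (induction c arbitrary: K) auto

lemma conts_self: "c # K \<in> conts c K"
  by (cases c) auto

lemma conts_uses: "uses m c \<Longrightarrow> list_all (uses m) K \<Longrightarrow> K' \<in> conts c K \<Longrightarrow> list_all (uses m) K'"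
proof (induction c arbitrary: K)
  case (Seq c d)
  then show ?case using Seq.IH(1)[of "d # K"] Seq.IH(2)[of K] by auto
next
  case (While i P c)
  then show ?case using While.IH[of "While i P c # K"] by auto
qed auto

text \<open>Holds for every memory, so the control states can be fixed before the input is known.
  Arriving at \<open>K\<close> itself means that \<open>c\<close> has been completed.\<close>

lemma conts_step: "K' \<in> conts c K \<Longrightarrow> fst (step (K', s)) \<in> insert K (conts c K)"
proof (induction c arbitrary: K)
  case (Seq c d)
  then consider "K' = Seq c d # K" | "K' \<in> conts c (d # K)" | "K' \<in> conts d K" by auto
  then show ?case
    by cases (use Seq.IH conts_self in \<open>cases s; fastforce\<close>)+
next
  case (Sw i f)
  then consider "K' = Sw i f # K" | x where "K' \<in> conts (f x) K" by auto
  then show ?case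
    by cases (use Sw.IH conts_self in \<open>cases s; fastforce\<close>)+
next
  case (While i P c)
  then consider "K' = While i P c # K" | "K' \<in> conts c (While i P c # K)" by auto
  then show ?case
    by cases (use While.IH conts_self in \<open>cases s; fastforce\<close>)+
qed (cases s; simp)+

section \<open>Control states and tape actions of the compiled machine\<close>

fun sym :: "letter option \<Rightarrow> nat" where
  "sym None = 0"
| "sym (Some a) = symbol_of a"

lemma symbol_of_bounds: "0 < symbol_of a" "symbol_of a < 7"
  by (cases a; simp)+

lemma inj_sym: "inj sym"
proof (rule injI)
  fix x y assume "sym x = sym y"
  moreover have "symbol_of a = symbol_of b \<Longrightarrow> a = b" for a b
    by (cases a; cases b; simp)
  ultimately show "x = y"
    using symbol_of_bounds(1) by (cases x; cases y) (auto, metis neq0_conv, metis neq0_conv)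
qed

text \<open>Tape 1 is reserved for the output, and stack 0 must lie on the input tape; the other
  stacks move up by one.\<close>

definition tape_of :: "nat \<Rightarrow> nat" where
  "tape_of i = (if i = 0 then 0 else Suc i)"

text \<open>
  The head of a stack tape rests on the topmost letter, so that pushing takes two steps of the
  machine. The second step is marked by the Boolean component of the control state.
\<close>

fun control :: "com list \<times> bool \<Rightarrow> nat list \<Rightarrow> com list \<times> bool" where
  "control ([], b) ss = ([], b)"
| "control (Skip # K, b) ss = (K, False)"
| "control (Push i a # K, b) ss = (if b then (K, False) else (Push i a # K, True))"
| "control (Pop i # K, b) ss = (K, False)"
| "control (Emit a # K, b) ss = (K, False)"
| "control (Seq c d # K, b) ss = (c # d # K, False)"
| "control (Sw i f # K, b) ss = (f (inv sym (ss ! tape_of i)) # K, False)"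
| "control (While i P c # K, b) ss =
     (if P (inv sym (ss ! tape_of i)) then c # While i P c # K else K, False)"

text \<open>Stacks grow to the left. The input tape, with its head on the first letter of the input,
  is thus a stack from the outset. A pop erases the cell it leaves, so that everything to the left
  of the head stays blank.\<close>

fun actions :: "com list \<times> bool \<Rightarrow> nat list \<Rightarrow> (nat \<times> move) list" where
  "actions (Push i a # K, b) ss = (map (\<lambda>s. (s, Stay)) ss)
     [tape_of i := if b then (symbol_of a, Stay) else (ss ! tape_of i, MoveLeft)]"
| "actions (Pop i # K, b) ss = (map (\<lambda>s. (s, Stay)) ss)[tape_of i := (0, MoveRight)]"
| "actions (Emit a # K, b) ss = (map (\<lambda>s. (s, Stay)) ss)[1 := (symbol_of a, MoveRight)]"
| "actions (_, b) ss = map (\<lambda>s. (s, Stay)) ss"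

definition control_states :: "com \<Rightarrow> (com list \<times> bool) set" where
  "control_states c = insert [] (conts c []) \<times> UNIV"

definition compile :: "nat \<Rightarrow> com \<Rightarrow> turing_machine" where
  "compile m c = (let S = control_states c; ix = to_nat_on S in
     \<lparr>num_tapes = Suc m, num_states = card S, num_symbols = 7,
      start_state = ix ([c], False), halt_state = ix ([], False),
      transition = (\<lambda>q ss. (ix (control (from_nat_into S q) ss), actions (from_nat_into S q) ss))\<rparr>)"

lemma finite_control_states: "finite (control_states c)"
  by (simp add: control_states_def finite_conts)

lemma control_in_states: "s \<in> control_states c \<Longrightarrow> control s ss \<in> control_states c"
proof -
  assume s: "s \<in> control_states c"
  obtain K b where sK: "s = (K, b)" by fastforce
  show ?thesis
  proof (cases K)
    case Nil
    then show ?thesis using s sK by simp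
  next
    case (Cons d K')
    then have K: "K \<in> conts c []" using s sK by (auto simp: control_states_def)
    have *: "fst (step (K, \<sigma>, [])) \<in> insert [] (conts c [])" for \<sigma>
      using conts_step[OF K] by blast
    \<comment> \<open>In a memory where every stack shows the scanned letter, \<open>step\<close>
      takes the same branch as \<open>control\<close>, so closure under \<open>step\<close> carries
      over.\<close>
    let ?\<sigma> = "\<lambda>x (i::nat). case x of None \<Rightarrow> [] | Some a \<Rightarrow> [a]"
    have pk: "peek (?\<sigma> x i) = x" for x i by (cases x) auto
    show ?thesis
      using *[of "?\<sigma> None"] *[of "?\<sigma> (inv sym (ss ! tape_of i))" for i] K pk Cons sK s
      by (cases d) (auto simp: control_states_def split: if_splits)
  qed
qed

lemma valid_compile:
  assumes "1 \<le> m"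
  shows "valid_tm (compile m c)"
proof -
  let ?S = "control_states c"
  have bij: "bij_betw (to_nat_on ?S) ?S {..<card ?S}"
    using to_nat_on_finite[OF finite_control_states] .
  have ix: "s \<in> ?S \<Longrightarrow> to_nat_on ?S s < card ?S" for s
    using bij by (auto simp: bij_betw_def)
  have act: "fst ` set (actions s ss) \<subseteq> {..<7} \<and> length (actions s ss) = length ss"
    if "set ss \<subseteq> {..<7}" for s ss
  proof -
    have 1: "fst ` set ((map (\<lambda>s. (s, Stay)) ss)[i := x]) \<subseteq> {..<7}" if "fst x < 7 \<or> length ss \<le> i" for i x
      using that \<open>set ss \<subseteq> {..<7}\<close> set_update_subset_insert[of "map (\<lambda>s. (s, Stay)) ss" i x]
      by (fastforce simp: list_update_beyond)
    have 2: "ss ! i < 7 \<or> length ss \<le> i" for i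
      using that by (meson lessThan_iff not_le nth_mem subsetD)
    have 3: "fst ` set (map (\<lambda>s. (s, Stay)) ss) \<subseteq> {..<7}"
      using that by auto
    show ?thesis
      using symbol_of_bounds 1 2 3
      by (cases "(s, ss)" rule: actions.cases) (simp_all del: set_map)
  qed
  have S: "([c], False) \<in> ?S" "([], False) \<in> ?S"
    by (auto simp: control_states_def conts_self)
  moreover from this have "?S \<noteq> {}" by blast
  ultimately show ?thesis
    using assms act ix control_in_states from_nat_into[of ?S]
    unfolding valid_tm_def compile_def Let_def by simp
qed

section \<open>Simulation of stack programs by the compiled machine\<close>

definition stack_tape :: "letter list \<Rightarrow> tape \<Rightarrow> bool" where
  "stack_tape xs T \<longleftrightarrow> (\<forall>j. fst T (snd T + j) = contents_of xs j)"

text \<open>Stack tapes are described relative to their heads, which drift during the run. The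
  output tape is fixed absolutely, because \<open>computes_within\<close> compares its cells with
  \<open>contents_of\<close> the output.\<close>

definition sim :: "nat \<Rightarrow> mem \<times> letter list \<Rightarrow> tape list \<Rightarrow> bool" where
  "sim m = (\<lambda>(\<sigma>, out) ts. length ts = Suc m \<and> (\<forall>i<m. stack_tape (\<sigma> i) (ts ! tape_of i)) \<and>
     ts ! 1 = (contents_of out, int (length out)))"

lemma contents_of_Cons: "contents_of (a # xs) j = (if j = 0 then symbol_of a else contents_of xs (j - 1))"
  by (auto simp: contents_of_def nth_Cons' nat_diff_distrib)

lemma contents_of_Nil: "contents_of [] j = 0"
  by (simp add: contents_of_def)

lemma contents_of_neg: "j < 0 \<Longrightarrow> contents_of xs j = 0"
  by (simp add: contents_of_def)

lemma read_stack_tape: "stack_tape xs T \<Longrightarrow> read_tape T = sym (peek xs)"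
  unfolding stack_tape_def by (cases T; cases xs; drule spec[of _ 0]) (auto simp: contents_of_Cons contents_of_Nil)

lemma act_stay: "act_tape (read_tape T, Stay) T = T"
  by (cases T) simp

lemma stack_tape_push:
  "stack_tape xs T \<Longrightarrow>
    stack_tape (a # xs) (act_tape (symbol_of a, Stay) (act_tape (read_tape T, MoveLeft) T))"
  unfolding stack_tape_def
  by (cases T) (auto simp: contents_of_Cons algebra_simps, metis add_diff_eq)

lemma stack_tape_pop: "stack_tape xs T \<Longrightarrow> stack_tape (tl xs) (act_tape (0, MoveRight) T)"
proof -
  assume a: "stack_tape xs T"
  obtain f h where T: "T = (f, h)" by fastforce
  have f: "f (h + j) = contents_of xs j" for j using a T by (auto simp: stack_tape_def)
  have "(f(h := 0)) (h + 1 + j) = contents_of (tl xs) j" for j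
    using f[of "1 + j"] by (cases xs) (auto simp: contents_of_Cons contents_of_Nil contents_of_neg algebra_simps)
  then show ?thesis
    by (simp add: stack_tape_def T)
qed

lemma emit_tape:
  "act_tape (symbol_of a, MoveRight) (contents_of out, int (length out)) =
    (contents_of (out @ [a]), int (length (out @ [a])))"
  by (auto simp: fun_eq_iff contents_of_def nth_append)

lemma map2_act_stay: "map2 act_tape (map (\<lambda>s. (s, Stay)) (map read_tape ts)) ts = ts"
  by (induction ts) (auto simp: act_stay simp del: act_tape.simps)

lemma map2_act_update:
  "i < length ts \<Longrightarrow>
    map2 act_tape ((map (\<lambda>s. (s, Stay)) (map read_tape ts))[i := x]) ts = ts[i := act_tape x (ts ! i)]"
  by (rule nth_equalityI) (auto simp: nth_list_update act_stay simp del: act_tape.simps)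

lemma tape_of_simps: "tape_of i \<noteq> 1" "tape_of i \<noteq> Suc 0" "Suc 0 \<noteq> tape_of i" "tape_of i = tape_of j \<longleftrightarrow> i = j"
  by (auto simp: tape_of_def)

lemma tape_of_less: "i < m \<Longrightarrow> tape_of i < Suc m"
  by (auto simp: tape_of_def)

lemma tm_step_compile:
  assumes "(K, b) \<in> control_states c" "K \<noteq> []"
  shows "tm_step (compile m c) (to_nat_on (control_states c) (K, b), ts) =
    (to_nat_on (control_states c) (control (K, b) (map read_tape ts)),
     map2 act_tape (actions (K, b) (map read_tape ts)) ts)"
proof -
  have "([], False) \<in> control_states c" by (simp add: control_states_def)
  then have "to_nat_on (control_states c) (K, b) \<noteq> to_nat_on (control_states c) ([], False)"
    using assms countable_finite[OF finite_control_states[of c]] by simp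
  then show ?thesis
    using assms countable_finite[OF finite_control_states[of c]]
    by (simp add: compile_def Let_def)
qed

text \<open>Two machine steps are needed for \<open>Push\<close> only; zero steps serve the empty
  command list, where the machine has already halted.\<close>

lemma compile_step:
  assumes K: "K \<in> insert [] (conts c [])" and u: "list_all (uses m) K" and m: "1 \<le> m"
    and s: "sim m (\<sigma>, out) ts"
    and st: "step (K, \<sigma>, out) = (K', \<sigma>', out')"
  shows "\<exists>j ts'. j \<le> 2 \<and> sim m (\<sigma>', out') ts' \<and>
     (tm_step (compile m c) ^^ j) (to_nat_on (control_states c) (K, False), ts) =
     (to_nat_on (control_states c) (K', False), ts')"
proof (cases K)
  case Nil
  then show ?thesis using st s by (intro exI[of _ 0]) auto
next
  case (Cons d L)
  let ?ix = "to_nat_on (control_states c)"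
  let ?M = "compile m c"
  have in_st: "(K, b) \<in> control_states c" for b using K by (auto simp: control_states_def)
  note stp = tm_step_compile[OF in_st, of m]
  have len: "length ts = Suc m" and tp: "\<And>i. i < m \<Longrightarrow> stack_tape (\<sigma> i) (ts ! tape_of i)"
    and ot: "ts ! 1 = (contents_of out, int (length out))"
    using s by (auto simp: sim_def)
  have rd: "inv sym (map read_tape ts ! tape_of i) = peek (\<sigma> i)" if "i < m" for i
    using read_stack_tape[OF tp[OF that]] inj_sym tape_of_less[OF that] len by simp
  have upd: "sim m (\<sigma>(i := xs), out) (ts[tape_of i := T])" if "stack_tape xs T" "i < m" for i xs T
    using len tp ot that tape_of_less by (auto simp: sim_def nth_list_update tape_of_simps)
  have one: ?thesis if "control (K, False) (map read_tape ts) = (K', False)"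
    "sim m (\<sigma>', out') (map2 act_tape (actions (K, False) (map read_tape ts)) ts)"
    by (rule exI[of _ 1], rule exI[of _ "map2 act_tape (actions (K, False) (map read_tape ts)) ts"])
      (use that stp[of False ts] Cons in \<open>simp del: tm_step.simps\<close>)
  show ?thesis
  proof (cases d)
    case (Push i a)
    have i: "i < m" using u Cons Push by simp
    then have it: "tape_of i < length ts" using len tape_of_less by simp
    let ?T1 = "act_tape (read_tape (ts ! tape_of i), MoveLeft) (ts ! tape_of i)"
    let ?T2 = "act_tape (symbol_of a, Stay) ?T1"
    have e1: "tm_step ?M (?ix (K, False), ts) = (?ix (K, True), ts[tape_of i := ?T1])"
      using stp[of False ts] Cons Push it map2_act_update[of "tape_of i" ts]
      by (simp del: tm_step.simps act_tape.simps)
    have e2: "tm_step ?M (?ix (K, True), ts[tape_of i := ?T1]) = (?ix (K', False), ts[tape_of i := ?T2])"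
      using stp[of True "ts[tape_of i := ?T1]"] Cons Push it st
        map2_act_update[of "tape_of i" "ts[tape_of i := ?T1]"]
      by (simp del: tm_step.simps act_tape.simps)
    have "sim m (\<sigma>', out') (ts[tape_of i := ?T2])"
      using upd[OF stack_tape_push[OF tp[OF i]] i] st Cons Push by auto
    then show ?thesis using e1 e2
      by (intro exI[of _ 2] exI[of _ "ts[tape_of i := ?T2]"])
        (simp add: numeral_2_eq_2 del: tm_step.simps act_tape.simps)
  next
    case (Pop i)
    have i: "i < m" using u Cons Pop by simp
    then have it: "tape_of i < length ts" using len tape_of_less by simp
    show ?thesis
      by (rule one) (use upd[OF stack_tape_pop[OF tp[OF i]] i] map2_act_update[OF it] st Cons Pop in auto)
  next
    case (Emit a)
    have it: "1 < length ts" using len m by simp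
    have "sim m (\<sigma>, out @ [a]) (ts[1 := act_tape (symbol_of a, MoveRight) (ts ! 1)])"
      using len tp it ot unfolding emit_tape ot
      by (simp add: sim_def nth_list_update tape_of_simps del: act_tape.simps) 
    then show ?thesis
      by (intro one) (use map2_act_update[OF it] st Cons Emit in auto)
  next
    case Skip
    show ?thesis by (rule one) (use s st Cons Skip map2_act_stay in auto)
  next
    case (Seq c d)
    show ?thesis by (rule one) (use s st Cons Seq map2_act_stay in auto)
  next
    case (Sw i f)
    show ?thesis by (rule one) (use s st Cons Sw map2_act_stay rd u in auto)
  next
    case (While i P c)
    show ?thesis by (rule one) (use s st Cons While map2_act_stay rd u in auto)
  qed
qed

lemma compile_steps:
  assumes "K \<in> insert [] (conts c [])" "uses m c" "1 \<le> m" "sim m (\<sigma>, out) ts"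
    "(step ^^ t) (K, \<sigma>, out) = (K', \<sigma>', out')"
  shows "\<exists>j ts'. j \<le> 2 * t \<and> sim m (\<sigma>', out') ts' \<and>
     (tm_step (compile m c) ^^ j) (to_nat_on (control_states c) (K, False), ts) =
     (to_nat_on (control_states c) (K', False), ts')"
  using assms
proof (induction t arbitrary: K \<sigma> out ts)
  case 0
  then show ?case by (intro exI[of _ 0]) auto
next
  case (Suc t)
  obtain K1 \<sigma>1 out1 where s1: "step (K, \<sigma>, out) = (K1, \<sigma>1, out1)" by (metis prod_cases3)
  have u: "list_all (uses m) K" using conts_uses[of m c "[]" K] Suc.prems by auto
  have K1: "K1 \<in> insert [] (conts c [])"
    using conts_step[of K c "[]" "(\<sigma>, out)"] Suc.prems(1) s1 by auto
  from compile_step[OF Suc.prems(1) u Suc.prems(3,4) s1] obtain j1 ts1 where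
    j1: "j1 \<le> 2" "sim m (\<sigma>1, out1) ts1"
     "(tm_step (compile m c) ^^ j1) (to_nat_on (control_states c) (K, False), ts) =
     (to_nat_on (control_states c) (K1, False), ts1)" by blast
  have "(step ^^ t) (K1, \<sigma>1, out1) = (K', \<sigma>', out')"
    using Suc.prems(5) s1 by (simp add: funpow_swap1)
  from Suc.IH[OF K1 Suc.prems(2,3) j1(2) this] obtain j2 ts2 where
    j2: "j2 \<le> 2 * t" "sim m (\<sigma>', out') ts2"
     "(tm_step (compile m c) ^^ j2) (to_nat_on (control_states c) (K1, False), ts1) =
     (to_nat_on (control_states c) (K', False), ts2)" by blast
  have "(tm_step (compile m c) ^^ (j2 + j1)) (to_nat_on (control_states c) (K, False), ts) =
     (to_nat_on (control_states c) (K', False), ts2)"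
    using j1 j2 by (simp add: funpow_add)
  then show ?case using j1 j2 by (intro exI[of _ "j2 + j1"]) auto
qed

lemma tm_step_halted: "(tm_step M ^^ t) (halt_state M, ts) = (halt_state M, ts)"
  by (induction t) auto

text \<open>\<open>computes_within\<close> inspects the configuration at one exact time. Since
  halted configurations are fixed points, any later time \<open>t'\<close> is as good as the moment
  of halting.\<close>

lemma compile_computes:
  assumes "uses m c" "1 \<le> m"
    and "(step ^^ t) ([c], (\<lambda>_. [])(0 := w), []) = ([], \<sigma>, out)" and "2 * t \<le> t'"
  shows "computes_within (compile m c) w out t'"
proof -
  have "sim m ((\<lambda>_. [])(0 := w), []) (snd (initial_config (compile m c) w))"
    using \<open>1 \<le> m\<close>
    by (auto simp: sim_def initial_config_def compile_def Let_def stack_tape_def tape_of_def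
        contents_of_Nil nth_Cons')
  from compile_steps[OF _ assms(1,2) this assms(3)] conts_self[of c "[]"] obtain j ts where
    j: "j \<le> 2 * t" "sim m (\<sigma>, out) ts"
     "(tm_step (compile m c) ^^ j) (initial_config (compile m c) w) = (halt_state (compile m c), ts)"
    by (auto simp: initial_config_def compile_def Let_def)
  have "(tm_step (compile m c) ^^ t') (initial_config (compile m c) w) =
     (tm_step (compile m c) ^^ (t' - j)) ((tm_step (compile m c) ^^ j) (initial_config (compile m c) w))"
    using j(1) assms(4) by (metis (no_types, opaque_lifting) comp_apply funpow_add le_add_diff_inverse2 order_trans)
  also have "\<dots> = (halt_state (compile m c), ts)"
    unfolding j(3) tm_step_halted ..
  finally show ?thesis
    using j(2) by (auto simp: computes_within_def sim_def)
qed

section \<open>Polynomial-time functions on encodable types\<close>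

definition run :: "nat \<Rightarrow> com \<Rightarrow> mem \<times> letter list \<Rightarrow> mem \<times> letter list \<Rightarrow> bool" where
  "run t c s s' \<longleftrightarrow> (\<exists>t'\<le>t. \<forall>K. (step ^^ t') (c # K, s) = (K, s'))"

lemma run_mono: "run t c s s' \<Longrightarrow> t \<le> t' \<Longrightarrow> run t' c s s'"
  unfolding run_def by (meson order_trans)

lemma run_cong: "run t c s s' \<Longrightarrow> t \<le> t' \<Longrightarrow> s = r \<Longrightarrow> s' = r' \<Longrightarrow> run t' c r r'"
  using run_mono by blast

lemma run_one: "(\<And>K. step (c # K, s) = (K, s')) \<Longrightarrow> run 1 c s s'"
  unfolding run_def by (intro exI[of _ 1]) auto

lemma run_Skip: "run 1 Skip s s"
  and run_Push: "run 1 (Push i a) (\<sigma>, out) (\<sigma>(i := a # \<sigma> i), out)"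
  and run_Pop: "run 1 (Pop i) (\<sigma>, out) (\<sigma>(i := tl (\<sigma> i)), out)"
  and run_Emit: "run 1 (Emit a) (\<sigma>, out) (\<sigma>, out @ [a])"
  by (rule run_one; cases s; simp)+

text \<open>Runs compose because \<open>run\<close> chooses the number of steps before quantifying
  over the commands \<open>K\<close> that follow: the first command may be run with the second one
  waiting.\<close>

lemma run_Seq:
  assumes "run t c s s'" "run t' d s' s''"
  shows "run (t + t' + 1) (c ;; d) s s''"
proof -
  obtain j j' where j: "j \<le> t" "\<And>K. (step ^^ j) (c # K, s) = (K, s')"
    "j' \<le> t'" "\<And>K. (step ^^ j') (d # K, s') = (K, s'')"
    using assms unfolding run_def by blast
  have "(step ^^ (j' + j + 1)) ((c ;; d) # K, s) = (K, s'')" for K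
    using j by (cases s) (simp add: funpow_add funpow_swap1)
  then show ?thesis
    unfolding run_def using j by (intro exI[of _ "j' + j + 1"]) auto
qed

lemma run_Sw:
  assumes "run t (f (peek (fst s i))) s s'"
  shows "run (t + 1) (Sw i f) s s'"
proof -
  obtain j where j: "j \<le> t" "\<And>K. (step ^^ j) (f (peek (fst s i)) # K, s) = (K, s')"
    using assms unfolding run_def by blast
  have "(step ^^ (Suc j)) (Sw i f # K, s) = (K, s')" for K
    using j by (cases s) (simp add: funpow_swap1)
  then show ?thesis
    unfolding run_def using j by (intro exI[of _ "Suc j"]) auto
qed

lemma run_While_end: "\<not> P (peek (fst s i)) \<Longrightarrow> run 1 (While i P c) s s"
  by (rule run_one) (cases s; simp)

lemma run_While_step:
  assumes "P (peek (fst s i))" "run t c s s'" "run t' (While i P c) s' s''"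
  shows "run (t + t' + 1) (While i P c) s s''"
proof -
  obtain j j' where j: "j \<le> t" "\<And>K. (step ^^ j) (c # K, s) = (K, s')"
    "j' \<le> t'" "\<And>K. (step ^^ j') (While i P c # K, s') = (K, s'')"
    using assms unfolding run_def by blast
  have "(step ^^ (j' + j + 1)) (While i P c # K, s) = (K, s'')" for K
    using j assms(1) by (cases s) (simp add: funpow_add funpow_swap1)
  then show ?thesis
    unfolding run_def using j by (intro exI[of _ "j' + j + 1"]) auto
qed

lemma run_While:
  assumes "\<And>j. j < n \<Longrightarrow> P (peek (fst (S j) i)) \<and> run t c (S j) (S (Suc j))"
    and "\<not> P (peek (fst (S n) i))"
  shows "run (n * (t + 1) + 1) (While i P c) (S 0) (S n)"
  using assms
proof (induction n arbitrary: S)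
  case 0
  then show ?case using run_While_end by simp
next
  case (Suc n)
  have "run (n * (t + 1) + 1) (While i P c) (S (Suc 0)) (S (Suc n))"
    using Suc.IH[of "\<lambda>j. S (Suc j)"] Suc.prems by auto
  with Suc.prems(1)[of 0] have "run (t + (n * (t + 1) + 1) + 1) (While i P c) (S 0) (S (Suc n))"
    by (intro run_While_step) auto
  then show ?case by (rule run_mono) simp
qed

text \<open>A step adds at most one letter to a stack. Hence time bounds also bound the sizes of
  results, which is how \<open>implements_sz\<close> gets its bound for free.\<close>

lemma run_length:
  assumes "run t c (\<sigma>, out) (\<sigma>', out')"
  shows "length (\<sigma>' i) \<le> length (\<sigma> i) + t"
proof -
  have 1: "step (K, \<sigma>, out) = (K', \<sigma>', out') \<Longrightarrow> length (\<sigma>' i) \<le> length (\<sigma> i) + 1"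
    for K K' \<sigma> \<sigma>' out out'
    by (cases "(K, \<sigma>, out)" rule: step.cases) (auto split: if_splits)
  have 2: "(step ^^ j) (K, \<sigma>, out) = (K', \<sigma>', out') \<Longrightarrow> length (\<sigma>' i) \<le> length (\<sigma> i) + j"
    for j K K' \<sigma> \<sigma>' out out'
  proof (induction j arbitrary: K' \<sigma>' out')
    case (Suc j)
    obtain K1 \<sigma>1 out1 where "(step ^^ j) (K, \<sigma>, out) = (K1, \<sigma>1, out1)" by (metis prod_cases3)
    then show ?case using Suc.IH[of K1 \<sigma>1 out1] 1[of K1 \<sigma>1 out1 K' \<sigma>' out'] Suc.prems by simp
  qed simp
  then show ?thesis using assms unfolding run_def by (meson add_le_mono le_refl order_trans)
qed

section \<open>Moving, copying, escaping and erasing letters on stacks\<close>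

definition shift :: "nat \<Rightarrow> (letter \<Rightarrow> com) \<Rightarrow> com" where
  "shift i f = While i (\<lambda>x. x \<noteq> None)
     (Sw i (\<lambda>x. case x of None \<Rightarrow> Skip | Some a \<Rightarrow> Pop i ;; f a))"

text \<open>The body may do anything that leaves stack \<open>i\<close> alone; the loops below for
  moving, copying, escaping and erasing are instances. Draining from the top reverses the order,
  which is why data that is put aside is later moved back once more.\<close>

lemma run_shift:
  assumes f: "\<And>a \<sigma>. run t (f a) (\<sigma>, out) (E a \<sigma>, out)"
    and E: "\<And>a \<sigma>. E a \<sigma> i = \<sigma> i"
  shows "run (length (\<sigma> i) * (t + 4) + 1) (shift i f) (\<sigma>, out)
    (fold (\<lambda>a \<sigma>. E a (\<sigma>(i := tl (\<sigma> i)))) (\<sigma> i) \<sigma>, out)"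
proof (induction "\<sigma> i" arbitrary: \<sigma>)
  case Nil
  show ?case unfolding shift_def
    by (rule run_cong[OF run_While_end[where s = "(\<sigma>, out)"]]) (simp_all add: Nil[symmetric])
next
  case (Cons a w)
  let ?\<sigma> = "E a (\<sigma>(i := tl (\<sigma> i)))"
  have w: "w = ?\<sigma> i" using Cons.hyps(2) E by (metis fun_upd_same list.sel(3))
  have "run ((1 + t + 1) + 1) (Sw i (\<lambda>x. case x of None \<Rightarrow> Skip | Some a \<Rightarrow> Pop i ;; f a))
     (\<sigma>, out) (?\<sigma>, out)"
    by (rule run_Sw) (use f run_Seq[OF run_Pop] in \<open>auto simp: Cons.hyps(2)[symmetric]\<close>)
  from run_While_step[where P = "\<lambda>x. x \<noteq> None", OF _ this
      Cons.hyps(1)[of ?\<sigma>, OF w, unfolded shift_def]]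
  have "run (1 + t + 1 + 1 + (length (?\<sigma> i) * (t + 4) + 1) + 1) (shift i f) (\<sigma>, out)
     (fold (\<lambda>a \<sigma>. E a (\<sigma>(i := tl (\<sigma> i)))) (?\<sigma> i) ?\<sigma>, out)"
    unfolding shift_def by (simp add: Cons.hyps(2)[symmetric])
  then show ?case
    by (rule run_cong) (simp_all add: Cons.hyps(2)[symmetric] E)
qed

lemma run_move_by:
  assumes "i \<noteq> j" and f: "\<And>a \<sigma>. run t (f a) (\<sigma>, out) (\<sigma>(j := g a @ \<sigma> j), out)"
  shows "run (length (\<sigma> i) * (t + 4) + 1) (shift i f) (\<sigma>, out)
    (\<sigma>(i := [], j := concat (map g (rev (\<sigma> i))) @ \<sigma> j), out)"
proof -
  have "fold (\<lambda>a \<sigma>. \<sigma>(i := tl (\<sigma> i), j := g a @ \<sigma> j)) w \<sigma> =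
      \<sigma>(i := [], j := concat (map g (rev w)) @ \<sigma> j)" if "\<sigma> i = w" for w \<sigma>
    using that assms(1) by (induction w arbitrary: \<sigma>) (auto simp: fun_eq_iff)
  from this[of \<sigma>, OF refl] show ?thesis
    using run_shift[of t f out "\<lambda>a \<sigma>. \<sigma>(j := g a @ \<sigma> j)" i \<sigma>] assms by simp
qed

lemma run_move:
  assumes "i \<noteq> j"
  shows "run (length (\<sigma> i) * 5 + 1) (shift i (\<lambda>a. Push j a)) (\<sigma>, out)
    (\<sigma>(i := [], j := rev (\<sigma> i) @ \<sigma> j), out)"
  by (rule run_cong[OF run_move_by[of i j 1 _ out "\<lambda>a. [a]" \<sigma>]])
    (use assms run_Push in \<open>auto simp: concat_map_singleton\<close>)

lemma run_move_both:
  assumes "i \<noteq> j" "i \<noteq> k" "j \<noteq> k"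
  shows "run (length (\<sigma> i) * 7 + 1) (shift i (\<lambda>a. Push j a ;; Push k a)) (\<sigma>, out)
    (\<sigma>(i := [], j := rev (\<sigma> i) @ \<sigma> j, k := rev (\<sigma> i) @ \<sigma> k), out)"
proof -
  have "fold (\<lambda>a \<sigma>. \<sigma>(i := tl (\<sigma> i), j := a # \<sigma> j, k := a # \<sigma> k)) w \<sigma> =
      \<sigma>(i := [], j := rev w @ \<sigma> j, k := rev w @ \<sigma> k)"
    if "\<sigma> i = w" for w \<sigma>
    using that assms by (induction w arbitrary: \<sigma>) (auto simp: fun_eq_iff)
  from this[of \<sigma>, OF refl]
  have eq: "fold (\<lambda>a \<sigma>. \<sigma>(i := tl (\<sigma> i), j := a # \<sigma> j, k := a # \<sigma> k)) (\<sigma> i) \<sigma> =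
      \<sigma>(i := [], j := rev (\<sigma> i) @ \<sigma> j, k := rev (\<sigma> i) @ \<sigma> k)" .
  have "run 3 (Push j a ;; Push k a) (\<sigma>, out) (\<sigma>(j := a # \<sigma> j, k := a # \<sigma> k), out)" for a \<sigma>
    using run_Seq[OF run_Push[of j a \<sigma> out] run_Push[of k a _ out]] assms
    by (simp add: numeral_3_eq_3)
  then show ?thesis
    using run_shift[of 3 "\<lambda>a. Push j a ;; Push k a" out "\<lambda>a \<sigma>. \<sigma>(j := a # \<sigma> j, k := a # \<sigma> k)" i \<sigma>]
      assms eq by simp
qed

text \<open>Once every letter is announced by \<open>Open\<close>, a \<open>Close\<close> in the
  place of an announcement can serve as a terminator, whatever letters the escaped word contains.
  Each nesting level doubles the length, which is harmless because the depth is fixed by the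
  type.\<close>

definition esc :: "letter list \<Rightarrow> letter list" where
  "esc w = concat (map (\<lambda>a. [Open, a]) w)"

lemma esc_simps [simp]: "esc [] = []" "esc (a # w) = Open # a # esc w" "esc (v @ w) = esc v @ esc w"
  by (simp_all add: esc_def)

lemma length_esc [simp]: "length (esc w) = 2 * length w"
  by (induction w) auto

lemma run_move_esc:
  assumes "i \<noteq> j"
  shows "run (length (\<sigma> i) * 7 + 1) (shift i (\<lambda>a. Push j a ;; Push j Open)) (\<sigma>, out)
    (\<sigma>(i := [], j := esc (rev (\<sigma> i)) @ \<sigma> j), out)"
proof -
  have "run 3 (Push j a ;; Push j Open) (\<sigma>, out) (\<sigma>(j := [Open, a] @ \<sigma> j), out)" for a \<sigma>
    by (rule run_cong[OF run_Seq[OF run_Push run_Push]]) auto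
  from run_move_by[of i j 3 _ out "\<lambda>a. [Open, a]", OF assms this] show ?thesis
    by (simp add: esc_def)
qed

lemma run_clear: "run (length (\<sigma> i) * 5 + 1) (shift i (\<lambda>a. Skip)) (\<sigma>, out) (\<sigma>(i := []), out)"
proof -
  have "fold (\<lambda>a \<sigma>. \<sigma>(i := tl (\<sigma> i))) w \<sigma> = \<sigma>(i := [])"
    if "\<sigma> i = w" for w \<sigma>
    using that by (induction w arbitrary: \<sigma>) (auto simp: fun_eq_iff)
  from this[of \<sigma>, OF refl] show ?thesis
    using run_shift[of 1 "\<lambda>a. Skip" out "\<lambda>a \<sigma>. \<sigma>" i \<sigma>] run_Skip by simp
qed

definition unescape :: "nat \<Rightarrow> nat \<Rightarrow> com" where
  "unescape i j = While i (\<lambda>x. x = Some Open)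
     (Pop i ;; Sw i (\<lambda>x. case x of None \<Rightarrow> Skip | Some a \<Rightarrow> Push j a) ;; Pop i)"

lemma run_unescape:
  assumes "i \<noteq> j" "\<sigma> i = esc w @ r" "peek r \<noteq> Some Open"
  shows "run (length w * 7 + 1) (unescape i j) (\<sigma>, out) (\<sigma>(i := r, j := rev w @ \<sigma> j), out)"
proof -
  let ?S = "\<lambda>n. (\<sigma>(i := esc (drop n w) @ r, j := rev (take n w) @ \<sigma> j), out)"
  let ?c = "Pop i ;; Sw i (\<lambda>x. case x of None \<Rightarrow> Skip | Some a \<Rightarrow> Push j a) ;; Pop i"
  have "peek (fst (?S n) i) = Some Open \<and> run 6 ?c (?S n) (?S (Suc n))" if "n < length w" for n
  proof -
    have d: "drop n w = w ! n # drop (Suc n) w" "take (Suc n) w = take n w @ [w ! n]"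
      using that by (simp_all add: Cons_nth_drop_Suc take_Suc_conv_app_nth)
    let ?s1 = "\<sigma>(i := w ! n # esc (drop (Suc n) w) @ r, j := rev (take n w) @ \<sigma> j)"
    let ?s2 = "?s1(j := w ! n # rev (take n w) @ \<sigma> j)"
    have 1: "run 1 (Pop i) (?S n) (?s1, out)"
      using run_Pop[of i "fst (?S n)" out] assms(1) d by (simp add: fun_upd_twist)
    have 2: "run (1 + 1) (Sw i (\<lambda>x. case x of None \<Rightarrow> Skip | Some a \<Rightarrow> Push j a)) (?s1, out) (?s2, out)"
      by (rule run_Sw) (use run_Push[of j "w ! n" ?s1 out] assms(1) in simp)
    have 3: "run 1 (Pop i) (?s2, out) (?S (Suc n))"
      using run_Pop[of i ?s2 out] assms(1) d by (simp add: fun_upd_twist)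
    show ?thesis
      using run_mono[OF run_Seq[OF 1 run_Seq[OF 2 3]], of 6] d assms(1) by simp
  qed
  moreover have "peek (fst (?S (length w)) i) \<noteq> Some Open"
    using assms by simp
  ultimately have "run (length w * (6 + 1) + 1) (unescape i j) (?S 0) (?S (length w))"
    unfolding unescape_def using run_While[of "length w" "\<lambda>x. x = Some Open" ?S i 6] by blast
  moreover have "?S 0 = (\<sigma>, out)" using assms by auto
  ultimately show ?thesis by simp
qed


section \<open>Codes of values, polynomial bounds and programs for functions\<close>

class encodable = fixes code :: "'a \<Rightarrow> letter list"

definition sz :: "'a::encodable \<Rightarrow> nat" where "sz x = length (code x)"

definition poly_bounded_by :: "('a \<Rightarrow> nat) \<Rightarrow> ('a \<Rightarrow> nat) \<Rightarrow> bool" where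
  "poly_bounded_by s t \<longleftrightarrow> (\<exists>p :: nat poly. \<forall>x. t x \<le> poly p (s x))"

abbreviation "poly_bd \<equiv> poly_bounded_by (\<lambda>n. n)"
abbreviation "pbounded \<equiv> poly_bounded_by sz"

lemma poly_nat_mono: "x \<le> y \<Longrightarrow> poly (p :: nat poly) x \<le> poly p y"
  by (induction p) (auto intro!: add_mono mult_mono)

lemma poly_bounded_by_const: "poly_bounded_by s (\<lambda>x. c)"
  unfolding poly_bounded_by_def by (intro exI[of _ "[:c:]"]) auto

lemma poly_bounded_by_self: "poly_bounded_by s s"
  unfolding poly_bounded_by_def by (intro exI[of _ "[:0, 1:]"]) auto

lemma poly_bounded_by_add:
  assumes "poly_bounded_by s f" "poly_bounded_by s g" shows "poly_bounded_by s (\<lambda>x. f x + g x)"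
proof -
  obtain p q where "\<forall>x. f x \<le> poly p (s x)" "\<forall>x. g x \<le> poly q (s x)"
    using assms unfolding poly_bounded_by_def by blast
  then show ?thesis unfolding poly_bounded_by_def by (intro exI[of _ "p + q"]) (simp add: add_mono)
qed

lemma poly_bounded_by_mult:
  assumes "poly_bounded_by s f" "poly_bounded_by s g" shows "poly_bounded_by s (\<lambda>x. f x * g x)"
proof -
  obtain p q where "\<forall>x. f x \<le> poly p (s x)" "\<forall>x. g x \<le> poly q (s x)"
    using assms unfolding poly_bounded_by_def by blast
  then show ?thesis unfolding poly_bounded_by_def by (intro exI[of _ "p * q"]) (simp add: mult_le_mono)
qed

lemma poly_bounded_by_poly:
  assumes "poly_bounded_by s f" shows "poly_bounded_by s (\<lambda>x. poly p (f x))"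
proof -
  obtain q where "\<forall>x. f x \<le> poly q (s x)"
    using assms unfolding poly_bounded_by_def by blast
  then show ?thesis unfolding poly_bounded_by_def
    by (intro exI[of _ "pcompose p q"]) (simp add: poly_pcompose poly_nat_mono)
qed

lemma poly_bounded_by_mono:
  assumes "poly_bounded_by s g" "\<And>x. f x \<le> g x" shows "poly_bounded_by s f"
proof -
  obtain p where "\<forall>x. g x \<le> poly p (s x)"
    using assms(1) unfolding poly_bounded_by_def by blast
  then show ?thesis unfolding poly_bounded_by_def using assms(2) order_trans by blast
qed

lemma poly_bounded_by_Suc: "poly_bounded_by s f \<Longrightarrow> poly_bounded_by s (\<lambda>x. Suc (f x))"
  using poly_bounded_by_add[OF _ poly_bounded_by_const, of s f 1] by simp

lemmas poly_bd_intros = poly_bounded_by_const poly_bounded_by_self poly_bounded_by_add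
  poly_bounded_by_mult poly_bounded_by_poly poly_bounded_by_Suc

text \<open>
  Stack 0 carries the input and then the output. The stacks below \<open>m\<close> are scratch space, empty
  before and after; those from \<open>m\<close> on keep their contents, so that a caller can store data there.
\<close>

definition implements :: "com \<Rightarrow> nat \<Rightarrow> nat poly \<Rightarrow> ('a::encodable \<Rightarrow> 'b::encodable) \<Rightarrow> bool" where
  "implements c m p f \<longleftrightarrow> 0 < m \<and> uses m c \<and>
     (\<forall>x \<sigma> out. \<sigma> 0 = code x \<longrightarrow> (\<forall>i. 0 < i \<and> i < m \<longrightarrow> \<sigma> i = []) \<longrightarrow>
        run (poly p (sz x)) c (\<sigma>, out) (\<sigma>(0 := code (f x)), out))"

definition pt :: "('a::encodable \<Rightarrow> 'b::encodable) \<Rightarrow> bool" where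
  "pt f \<longleftrightarrow> (\<exists>c m p. implements c m p f)"

lemma uses_mono: "uses m c \<Longrightarrow> m \<le> m' \<Longrightarrow> uses m' c"
  by (induction c) auto

lemma implements_mono: "implements c m p f \<Longrightarrow> m \<le> m' \<Longrightarrow> implements c m' p f"
  unfolding implements_def using uses_mono[of m c m'] by simp

lemma implements_uses: "implements c m p f \<Longrightarrow> uses m c"
  by (simp add: implements_def)

lemma implements_run:
  "implements c m p f \<Longrightarrow> \<sigma> 0 = code x \<Longrightarrow> (\<And>i. 0 < i \<Longrightarrow> i < m \<Longrightarrow> \<sigma> i = []) \<Longrightarrow>
    run (poly p (sz x)) c (\<sigma>, out) (\<sigma>(0 := code (f x)), out)"
  unfolding implements_def by blast

lemma ptI:
  assumes "poly_bd t" "0 < m" "uses m c"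
    and "\<And>x \<sigma> out. \<sigma> 0 = code x \<Longrightarrow> (\<And>i. 0 < i \<Longrightarrow> i < m \<Longrightarrow> \<sigma> i = []) \<Longrightarrow>
      run (t (sz x)) c (\<sigma>, out) (\<sigma>(0 := code (f x)), out)"
  shows "pt f"
proof -
  obtain p where "\<And>n. t n \<le> poly p n" using assms(1) unfolding poly_bounded_by_def by blast
  then have "implements c m p f"
    unfolding implements_def using assms(2,3) run_mono[OF assms(4)] by simp
  then show ?thesis unfolding pt_def by blast
qed

lemma implements_sz: 
  assumes "implements c m p f"
  shows "sz (f x) \<le> sz x + poly p (sz x)"
proof -
  let ?\<sigma> = "(\<lambda>_. [])(0 := code x)"
  have "run (poly p (sz x)) c (?\<sigma>, []) (?\<sigma>(0 := code (f x)), [])"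
    by (rule implements_run[OF assms]) auto
  from run_length[OF this, of 0] show ?thesis by (simp add: sz_def)
qed

lemma pbounded_sz:
  assumes "pt f" shows "pbounded (\<lambda>x. sz (f x))"
proof -
  obtain c m p where "implements c m p f" using assms unfolding pt_def by blast
  then show ?thesis
    unfolding poly_bounded_by_def by (intro exI[of _ "[:0, 1:] + p"]) (use implements_sz in force)
qed

text \<open>The two functions may differ in their result types: this is a cast at no cost. It
  reduces \<open>#\<close> to pairing, conditionals to lists, naturals to digit lists and integers
  to pairs.\<close>

lemma pt_same_code: "pt f \<Longrightarrow> (\<And>x. code (f x) = code (g x)) \<Longrightarrow> pt g"
  unfolding pt_def implements_def by simp

lemma pt_id: "pt (\<lambda>x. x)"
  by (rule ptI[of "\<lambda>n. 1" 1 Skip]) (auto intro!: poly_bd_intros run_cong[OF run_Skip])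

lemma pt_comp:
  assumes "pt g" "pt f"
  shows "pt (\<lambda>x. g (f x))"
proof -
  obtain c m p where "implements c m p f" using assms unfolding pt_def by blast
  moreover obtain d n q where "implements d n q g" using assms unfolding pt_def by blast
  ultimately have c: "implements c (max m n) p f" and d: "implements d (max m n) q g"
    by (auto elim: implements_mono)
  show ?thesis
  proof (rule ptI[of "\<lambda>n. poly p n + poly q (n + poly p n) + 1" "max m n" "c ;; d"])
    fix x :: 'c and \<sigma> :: mem and out
    assume \<sigma>: "\<sigma> 0 = code x" "\<And>i. 0 < i \<Longrightarrow> i < max m n \<Longrightarrow> \<sigma> i = []"
    have "run (poly q (sz (f x))) d (\<sigma>(0 := code (f x)), out) (\<sigma>(0 := code (g (f x))), out)"
      using implements_run[OF d, of "\<sigma>(0 := code (f x))" "f x" out] \<sigma> by auto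
    from run_mono[OF run_Seq[OF implements_run[OF c, of \<sigma> x out, OF \<sigma>] this]]
    show "run (poly p (sz x) + poly q (sz x + poly p (sz x)) + 1) (c ;; d) (\<sigma>, out)
      (\<sigma>(0 := code (g (f x))), out)"
      using poly_nat_mono[OF implements_sz[OF c, of x], of q] by simp
  qed (use c d in \<open>auto intro!: poly_bd_intros simp: implements_def\<close>)
qed

definition pushes :: "letter list \<Rightarrow> com" where
  "pushes w = foldr (\<lambda>a c. Push 0 a ;; c) (rev w) Skip"

lemma run_pushes: "run (2 * length w + 1) (pushes w) (\<sigma>, out) (\<sigma>(0 := w @ \<sigma> 0), out)"
proof -
  have "run (2 * length v + 1) (foldr (\<lambda>a c. Push 0 a ;; c) v Skip) (\<sigma>, out) (\<sigma>(0 := rev v @ \<sigma> 0), out)" for v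
  proof (induction v arbitrary: \<sigma>)
    case Nil
    then show ?case using run_Skip by simp
  next
    case (Cons a v)
    show ?case unfolding foldr.simps comp_apply
      by (rule run_cong[OF run_Seq[OF run_Push[of 0 a \<sigma> out] Cons.IH]]) auto
  qed
  from this[of "rev w"] show ?thesis by (simp add: pushes_def)
qed

lemma uses_pushes: "0 < m \<Longrightarrow> uses m (pushes w)"
proof -
  assume "0 < m"
  then have "uses m (foldr (\<lambda>a c. Push 0 a ;; c) v Skip)" for v by (induction v) auto
  then show ?thesis by (simp add: pushes_def)
qed

lemma uses_shift: "uses m (shift i f) \<longleftrightarrow> i < m \<and> (\<forall>a. uses m (f a))"
  by (auto simp: shift_def split: option.splits)

lemma pt_const:
  fixes c :: "'b::encodable"
  shows "pt (\<lambda>x::'a::encodable. c)"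
proof (rule ptI[of "\<lambda>n. (n * 5 + 1) + (2 * length (code c) + 1) + 1" 1 "shift 0 (\<lambda>a. Skip) ;; pushes (code c)"])
  fix x :: 'a and \<sigma> :: mem and out
  assume \<sigma>: "\<sigma> 0 = code x"
  show "run ((sz x * 5 + 1) + (2 * length (code c) + 1) + 1) (shift 0 (\<lambda>a. Skip) ;; pushes (code c))
    (\<sigma>, out) (\<sigma>(0 := code c), out)"
    using run_Seq[OF run_clear[of \<sigma> 0 out] run_pushes[of "code c" "\<sigma>(0 := [])" out]]
    by (simp add: \<sigma> sz_def)
qed (auto intro!: poly_bd_intros uses_pushes simp: uses_shift)

section \<open>Pairs, Booleans, lists and case distinctions\<close>

instantiation prod :: (encodable, encodable) encodable
begin
definition "code p = esc (code (fst p)) @ Close # code (snd p)"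
instance ..
end

lemma sz_Pair: "sz (x, y) = 2 * sz x + 1 + sz y"
  by (simp add: code_prod_def sz_def)

lemma pt_Pair:
  assumes "pt f" "pt g"
  shows "pt (\<lambda>x. (f x, g x))"
proof -
  obtain c n p where "implements c n p f" using assms unfolding pt_def by blast
  moreover obtain d n' q where "implements d n' q g" using assms unfolding pt_def by blast
  moreover define m where "m = max n n'"
  ultimately have c: "implements c m p f" and d: "implements d m q g"
    by (auto elim: implements_mono)
  have m: "0 < m" using c by (simp add: implements_def)
  \<comment> \<open>Stacks \<open>m\<close> and \<open>Suc m\<close> lie above the scratch space of
    both programs: one preserves a copy of the input while \<open>c\<close> runs, the other the
    value of \<open>f\<close> while \<open>d\<close> runs.\<close>
  let ?P = "shift 0 (\<lambda>a. Push m a ;; Push (Suc m) a) ;; shift m (\<lambda>a. Push 0 a) ;; c ;;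
    shift 0 (\<lambda>a. Push m a) ;; shift (Suc m) (\<lambda>a. Push 0 a) ;; d ;; Push 0 Close ;;
    shift m (\<lambda>a. Push 0 a ;; Push 0 Open)"
  \<comment> \<open>The value of \<open>f\<close> has length at most \<open>n + poly p n\<close> and
    is moved twice, at 5 and at 7 steps per letter.\<close>
  let ?t = "\<lambda>n. 20 * n + 20 + poly p n + poly q n + 12 * (n + poly p n)"
  show ?thesis
  proof (rule ptI[of ?t "Suc (Suc m)" ?P])
    fix x :: 'a and \<sigma> :: mem and out
    assume \<sigma>: "\<sigma> 0 = code x" "\<And>i. 0 < i \<Longrightarrow> i < Suc (Suc m) \<Longrightarrow> \<sigma> i = []"
    let ?w = "code x" and ?F = "code (f x)" and ?G = "code (g x)"
    let ?s1 = "\<sigma>(0 := [], m := rev ?w, Suc m := rev ?w)" and ?s2 = "\<sigma>(Suc m := rev ?w)"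
    let ?s3 = "?s2(0 := ?F)" and ?s4 = "?s2(0 := [], m := rev ?F)" and ?s5 = "\<sigma>(m := rev ?F)"
    let ?s6 = "?s5(0 := ?G)" and ?s7 = "?s5(0 := Close # ?G)"
    have 1: "run (length ?w * 7 + 1) (shift 0 (\<lambda>a. Push m a ;; Push (Suc m) a)) (\<sigma>, out)
       (?s1, out)"
      using run_move_both[of 0 m "Suc m" \<sigma> out] m \<sigma> by simp
    have 2: "run (length ?w * 5 + 1) (shift m (\<lambda>a. Push 0 a))
       (?s1, out) (?s2, out)"
      by (rule run_cong[OF run_move[of m 0 "?s1" out]]) (use m \<sigma> in \<open>auto simp: fun_upd_def fun_eq_iff\<close>)
    have 3: "run (poly p (sz x)) c (?s2, out) (?s3, out)"
      by (rule implements_run[OF c]) (use m \<sigma> in auto)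
    have 4: "run (length ?F * 5 + 1) (shift 0 (\<lambda>a. Push m a)) (?s3, out)
       (?s4, out)"
      by (rule run_cong[OF run_move[of 0 m "?s3" out]]) (use m \<sigma> in \<open>auto simp: fun_eq_iff\<close>)
    have 5: "run (length ?w * 5 + 1) (shift (Suc m) (\<lambda>a. Push 0 a))
       (?s4, out) (?s5, out)"
      by (rule run_cong[OF run_move[of "Suc m" 0 "?s4" out]]) (use m \<sigma> in \<open>auto simp: fun_eq_iff\<close>)
    have 6: "run (poly q (sz x)) d (?s5, out) (?s6, out)"
      by (rule implements_run[OF implements_mono[OF d]]) (use m \<sigma> in auto)
    have 7: "run 1 (Push 0 Close) (?s6, out) (?s7, out)"
      using run_Push[of 0 Close "?s6" out] by simp
    have 8: "run (length ?F * 7 + 1) (shift m (\<lambda>a. Push 0 a ;; Push 0 Open))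
       (?s7, out) (\<sigma>(0 := code (f x, g x)), out)"
      by (rule run_cong[OF run_move_esc[of m 0 "?s7" out]]) (use m \<sigma> in \<open>auto simp: fun_eq_iff code_prod_def\<close>)
    from run_Seq[OF 1 run_Seq[OF 2 run_Seq[OF 3 run_Seq[OF 4 run_Seq[OF 5 run_Seq[OF 6 run_Seq[OF 7 8]]]]]]]
    show "run (?t (sz x)) ?P (\<sigma>, out) (\<sigma>(0 := code (f x, g x)), out)"
      by (rule run_mono) (use implements_sz[OF c, of x] in \<open>simp add: sz_def\<close>)
  qed (use m in \<open>auto intro!: poly_bd_intros uses_mono[OF implements_uses[OF c]]
      uses_mono[OF implements_uses[OF d]] simp: uses_shift\<close>)
qed

lemma pt_fst0: "pt fst"
proof (rule ptI[of "\<lambda>n. 20 * n + 20" 2 "unescape 0 1 ;; shift 0 (\<lambda>a. Skip) ;; shift 1 (\<lambda>a. Push 0 a)"])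
  fix x :: "'a \<times> 'b" and \<sigma> :: mem and out
  assume \<sigma>: "\<sigma> 0 = code x" "\<And>i. 0 < i \<Longrightarrow> i < 2 \<Longrightarrow> \<sigma> i = []"
  let ?v = "code (fst x)" and ?w = "Close # code (snd x)"
  have 1: "run (length ?v * 7 + 1) (unescape 0 1) (\<sigma>, out) (\<sigma>(0 := ?w, 1 := rev ?v), out)"
    using run_unescape[of 0 1 \<sigma> ?v ?w out] \<sigma> by (simp add: code_prod_def)
  have 2: "run (length ?w * 5 + 1) (shift 0 (\<lambda>a. Skip)) (\<sigma>(0 := ?w, 1 := rev ?v), out)
     (\<sigma>(0 := [], 1 := rev ?v), out)"
    using run_clear[of "\<sigma>(0 := ?w, 1 := rev ?v)" 0 out] by (simp add: fun_upd_twist)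
  have 3: "run (length ?v * 5 + 1) (shift 1 (\<lambda>a. Push 0 a)) (\<sigma>(0 := [], 1 := rev ?v), out)
     (\<sigma>(0 := code (fst x)), out)"
    by (rule run_cong[OF run_move[of 1 0 "\<sigma>(0 := [], 1 := rev ?v)" out]]) (use \<sigma> in \<open>auto simp: fun_eq_iff\<close>)
  from run_Seq[OF 1 run_Seq[OF 2 3]]
  show "run (20 * sz x + 20) (unescape 0 1 ;; shift 0 (\<lambda>a. Skip) ;; shift 1 (\<lambda>a. Push 0 a))
      (\<sigma>, out) (\<sigma>(0 := code (fst x)), out)"
    by (rule run_mono) (simp add: sz_def code_prod_def)
qed (auto intro!: poly_bd_intros simp: uses_shift unescape_def split: option.splits)

lemma pt_snd0: "pt snd"
proof (rule ptI[of "\<lambda>n. 20 * n + 20" 2 "unescape 0 1 ;; shift 1 (\<lambda>a. Skip) ;; Pop 0"])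
  fix x :: "'a \<times> 'b" and \<sigma> :: mem and out
  assume \<sigma>: "\<sigma> 0 = code x" "\<And>i. 0 < i \<Longrightarrow> i < 2 \<Longrightarrow> \<sigma> i = []"
  let ?v = "code (fst x)" and ?w = "Close # code (snd x)"
  have 1: "run (length ?v * 7 + 1) (unescape 0 1) (\<sigma>, out) (\<sigma>(0 := ?w, 1 := rev ?v), out)"
    using run_unescape[of 0 1 \<sigma> ?v ?w out] \<sigma> by (simp add: code_prod_def)
  have 2: "run (length ?v * 5 + 1) (shift 1 (\<lambda>a. Skip)) (\<sigma>(0 := ?w, 1 := rev ?v), out)
     (\<sigma>(0 := ?w), out)"
    by (rule run_cong[OF run_clear[of "\<sigma>(0 := ?w, 1 := rev ?v)" 1 out]]) (use \<sigma> in \<open>auto simp: fun_eq_iff\<close>)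
  have 3: "run 1 (Pop 0) (\<sigma>(0 := ?w), out) (\<sigma>(0 := code (snd x)), out)"
    using run_Pop[of 0 "\<sigma>(0 := ?w)" out] by simp
  from run_Seq[OF 1 run_Seq[OF 2 3]]
  show "run (20 * sz x + 20) (unescape 0 1 ;; shift 1 (\<lambda>a. Skip) ;; Pop 0)
      (\<sigma>, out) (\<sigma>(0 := code (snd x)), out)"
    by (rule run_mono) (simp add: sz_def code_prod_def)
qed (auto intro!: poly_bd_intros simp: uses_shift unescape_def split: option.splits)

lemma pt_fst: "pt f \<Longrightarrow> pt (\<lambda>x. fst (f x))"
  and pt_snd: "pt f \<Longrightarrow> pt (\<lambda>x. snd (f x))"
  by (rule pt_comp[OF pt_fst0] pt_comp[OF pt_snd0]; assumption)+

instantiation unit :: encodable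
begin
definition "code (x :: unit) = []"
instance ..
end

instantiation bool :: encodable
begin
definition "code b = (if b then [Close] else [])"
instance ..
end

instantiation letter :: encodable
begin
definition "code (a :: letter) = [a]"
instance ..
end

instantiation list :: (encodable) encodable
begin
definition "code xs = concat (map (\<lambda>x. esc (code x) @ [Close]) xs)"
instance ..
end

lemma code_Nil: "code [] = []"
  and code_Cons: "code (x # xs) = code (x, xs)"
  by (simp_all add: code_list_def code_prod_def)

lemma code_list_eq_Nil: "code (xs :: 'a::encodable list) = [] \<longleftrightarrow> xs = []"
  by (cases xs) (auto simp: code_list_def)

text \<open>A nonempty list has the code of the pair of its head and tail, so the decomposition
  costs nothing: the code of \<open>(z # zs, x)\<close> is already that of
  \<open>((z, zs), x)\<close>. One look at the top letter separates the cases, since a pair with an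
  empty list as first component begins with \<open>Close\<close>.\<close>

lemma pt_case_list:
  assumes "pt l" "pt f" "pt (\<lambda>p. h (fst p) (fst (snd p)) (snd (snd p)))"
  shows "pt (\<lambda>x. case l x of [] \<Rightarrow> f x | y # ys \<Rightarrow> h x y ys)"
proof -
  have "pt (\<lambda>r. (\<lambda>p. h (fst p) (fst (snd p)) (snd (snd p))) (snd r, fst r))"
    by (rule pt_comp[OF assms(3) pt_Pair[OF pt_snd0 pt_fst0]])
  then have h: "pt (\<lambda>r. h (snd r) (fst (fst r)) (snd (fst r)))" (is "pt ?h") by simp
  obtain c n p where "implements c n p ?h" using h unfolding pt_def by blast
  moreover obtain d n' q where "implements d n' q f" using assms unfolding pt_def by blast
  moreover define m where "m = max n n'"
  ultimately have c: "implements c m p ?h" and d: "implements d m q f"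
    by (auto elim: implements_mono)
  have m: "0 < m" using c by (simp add: implements_def)
  let ?P = "Sw 0 (\<lambda>x. if x = Some Open then c else Pop 0 ;; d)"
  let ?F = "\<lambda>y. case fst y of [] \<Rightarrow> f (snd y) | z # zs \<Rightarrow> h (snd y) z zs"
  have "pt ?F"
  proof (rule ptI[of "\<lambda>n. 20 + poly p n + poly q n" m ?P])
    fix y :: "'b list \<times> 'a" and \<sigma> :: mem and out
    assume \<sigma>: "\<sigma> 0 = code y" "\<And>i. 0 < i \<Longrightarrow> i < m \<Longrightarrow> \<sigma> i = []"
    obtain xs x where y: "y = (xs, x)" by fastforce
    show "run (20 + poly p (sz y) + poly q (sz y)) ?P (\<sigma>, out) (\<sigma>(0 := code (?F y)), out)"
    proof (cases xs)
      case Nil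
      then have s: "\<sigma> 0 = Close # code x"
        using \<sigma>(1) by (simp add: y code_prod_def code_Nil)
      have 1: "run 1 (Pop 0) (\<sigma>, out) (\<sigma>(0 := code x), out)"
        by (rule run_cong[OF run_Pop]) (auto simp: s)
      have d': "run (poly q (sz x)) d (\<sigma>(0 := code x), out) (\<sigma>(0 := code (f x)), out)"
        using implements_run[OF d, of "\<sigma>(0 := code x)" x out] \<sigma> by simp
      have "run (1 + poly q (sz x) + 1 + 1) ?P (\<sigma>, out) (\<sigma>(0 := code (f x)), out)"
        by (rule run_Sw) (use run_Seq[OF 1 d'] in \<open>simp add: s\<close>)
      moreover have "poly q (sz x) \<le> poly q (sz y)" by (simp add: y sz_Pair poly_nat_mono)
      ultimately show ?thesis by (rule_tac run_cong) (use Nil y in auto)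
    next
      case (Cons z zs)
      have eq: "code y = code ((z, zs), x)"
        by (simp add: y Cons code_prod_def code_Cons)
      have "code xs \<noteq> []" using Cons by (simp add: code_list_eq_Nil)
      then obtain a w where "code xs = a # w" by (cases "code xs") auto
      then have pk: "peek (\<sigma> 0) = Some Open" using \<sigma>(1) by (simp add: y code_prod_def)
      have c': "run (poly p (sz y)) c (\<sigma>, out) (\<sigma>(0 := code (h x z zs)), out)"
        using implements_run[OF c, of \<sigma> "((z, zs), x)" out] \<sigma> eq by (simp add: sz_def)
      have "run (poly p (sz y) + 1) ?P (\<sigma>, out) (\<sigma>(0 := code (h x z zs)), out)"
        by (rule run_Sw) (use c' pk in simp)
      then show ?thesis by (rule run_cong) (use Cons y in auto)
    qed
  qed (use m implements_uses[OF c] implements_uses[OF d] in \<open>auto intro!: poly_bd_intros\<close>)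
  from pt_comp[OF this pt_Pair[OF assms(1) pt_id]] show ?thesis
    by (simp cong: if_cong list.case_cong)
qed

text \<open>Truth values have the codes of \<open>[()]\<close> and \<open>[]\<close>, so a
  conditional is a case distinction on lists.\<close>

lemma pt_if:
  assumes "pt b" "pt f" "pt g"
  shows "pt (\<lambda>x. if b x then f x else g x)"
proof -
  have "pt (\<lambda>x. if b x then [()] else [])"
    using assms(1) by (rule pt_same_code) (simp add: code_bool_def code_list_def code_unit_def)
  from pt_case_list[OF this assms(3) pt_comp[OF assms(2) pt_fst0]]
  show ?thesis by (rule back_subst[of pt]) auto
qed

lemma pt_letter:
  fixes P :: "letter \<Rightarrow> bool"
  shows "pt P"
proof (rule ptI[of "\<lambda>n. 4" 1 "Sw 0 (\<lambda>x. case x of None \<Rightarrow> Skip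
    | Some a \<Rightarrow> if P a then Pop 0 ;; Push 0 Close else Pop 0)"])
  fix a :: letter and \<sigma> :: mem and out
  assume s: "\<sigma> 0 = code a"
  have 1: "run 1 (Pop 0) (\<sigma>, out) (\<sigma>(0 := []), out)"
    by (rule run_cong[OF run_Pop]) (auto simp: s code_letter_def)
  have 2: "run 1 (Push 0 Close) (\<sigma>(0 := []), out) (\<sigma>(0 := [Close]), out)"
    by (rule run_cong[OF run_Push]) auto
  have "run (3 + 1) (Sw 0 (\<lambda>x. case x of None \<Rightarrow> Skip
    | Some a \<Rightarrow> if P a then Pop 0 ;; Push 0 Close else Pop 0)) (\<sigma>, out) (\<sigma>(0 := code (P a)), out)"
    by (rule run_Sw) (use run_mono[OF 1] run_Seq[OF 1 2] in
        \<open>auto simp: s code_letter_def code_bool_def numeral_3_eq_3\<close>)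
  then show "run 4 (Sw 0 (\<lambda>x. case x of None \<Rightarrow> Skip
    | Some a \<Rightarrow> if P a then Pop 0 ;; Push 0 Close else Pop 0)) (\<sigma>, out) (\<sigma>(0 := code (P a)), out)"
    by simp
qed (auto intro!: poly_bd_intros split: option.splits)

section \<open>Iteration along a list\<close>

text \<open>The end of an element is the only closing bracket that is not escaped.\<close>

definition repeat_com :: "nat \<Rightarrow> com \<Rightarrow> com" where
  "repeat_com j c = While j (\<lambda>x. x \<noteq> None)
     (Sw j (\<lambda>x. if x = Some Open then Pop j ;; Pop j else Pop j ;; c))"

lemma run_repeat_com_esc:
  assumes "run t (repeat_com j c) (\<sigma>(j := r), out) s'"
  shows "run (t + 5 * length w) (repeat_com j c) (\<sigma>(j := esc w @ r), out) s'"
proof (induction w)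
  case Nil
  show ?case by (rule run_cong[OF assms]) auto
next
  case (Cons a w)
  let ?c = "Sw j (\<lambda>x. if x = Some Open then Pop j ;; Pop j else Pop j ;; c)"
  let ?s = "\<sigma>(j := Open # a # esc w @ r)"
  have 1: "run 1 (Pop j) (?s, out) (\<sigma>(j := a # esc w @ r), out)"
    by (rule run_cong[OF run_Pop]) auto
  have 2: "run 1 (Pop j) (\<sigma>(j := a # esc w @ r), out) (\<sigma>(j := esc w @ r), out)"
    by (rule run_cong[OF run_Pop]) auto
  have 3: "run (1 + 1 + 1 + 1) ?c
     (?s, out) (\<sigma>(j := esc w @ r), out)"
    by (rule run_Sw) (use run_Seq[OF 1 2] in simp)
  have "run (1 + 1 + 1 + 1 + (t + 5 * length w) + 1) (repeat_com j c) (?s, out) s'"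
    unfolding repeat_com_def
    by (rule run_While_step[OF _ 3 Cons[unfolded repeat_com_def]]) simp
  then show ?case by (rule run_cong) auto
qed

lemma run_repeat_com:
  fixes h :: "'s::encodable \<Rightarrow> 's"
  assumes c: "implements c j p h"
    and "\<sigma> 0 = code s" "\<sigma> j = code us" "\<And>i. 0 < i \<Longrightarrow> i < j \<Longrightarrow> \<sigma> i = []"
    and "\<And>i. i \<le> length us \<Longrightarrow> sz ((h ^^ i) s) \<le> B"
  shows "run ((poly p B + 5) * length (code us) + 1) (repeat_com j c) (\<sigma>, out)
    (\<sigma>(0 := code ((h ^^ length us) s), j := []), out)"
  using assms(2-)
proof (induction us arbitrary: s \<sigma>)
  case Nil
  show ?case unfolding repeat_com_def
    by (rule run_cong[OF run_While_end[where s = "(\<sigma>, out)"]]) (use Nil in \<open>auto simp: code_Nil fun_eq_iff\<close>)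
next
  case (Cons e us)
  have j: "0 < j" using c by (simp add: implements_def)
  let ?c = "Sw j (\<lambda>x. if x = Some Open then Pop j ;; Pop j else Pop j ;; c)"
  let ?P = "poly p B"
  let ?s = "\<sigma>(j := Close # code us)"
  have 1: "run 1 (Pop j) (?s, out) (\<sigma>(j := code us), out)"
    by (rule run_cong[OF run_Pop]) auto
  have 2: "run (poly p (sz s)) c (\<sigma>(j := code us), out) (\<sigma>(j := code us, 0 := code (h s)), out)"
    by (rule implements_run[OF c]) (use Cons.prems j in auto)
  have "sz s \<le> B" using Cons.prems(4)[of 0] by simp
  then have le: "poly p (sz s) \<le> ?P" by (rule poly_nat_mono)
  have "run (1 + poly p (sz s) + 1 + 1) ?c
     (?s, out) (\<sigma>(j := code us, 0 := code (h s)), out)"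
    by (rule run_Sw) (use run_Seq[OF 1 2] in simp)
  with le have 3: "run (?P + 3) ?c
     (?s, out) (\<sigma>(j := code us, 0 := code (h s)), out)"
    by (rule_tac run_mono) auto
  have 4: "run ((?P + 5) * length (code us) + 1) (repeat_com j c) (\<sigma>(j := code us, 0 := code (h s)), out)
    (\<sigma>(j := code us, 0 := code (h s), 0 := code ((h ^^ length us) (h s)), j := []), out)"
  proof (rule Cons.IH)
    fix i assume "i \<le> length us"
    then show "sz ((h ^^ i) (h s)) \<le> B"
      using Cons.prems(4)[of "Suc i"] by (simp add: funpow_swap1)
  qed (use Cons.prems j in auto)
  have "run (?P + 3 + ((?P + 5) * length (code us) + 1) + 1) (repeat_com j c) (?s, out)
    (\<sigma>(j := code us, 0 := code (h s), 0 := code ((h ^^ length us) (h s)), j := []), out)"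
    unfolding repeat_com_def
    by (rule run_While_step[OF _ 3 4[unfolded repeat_com_def]]) simp
  from run_repeat_com_esc[OF this, of "code e"] show ?case
    by (rule run_cong)
      (use Cons.prems(2) j in \<open>auto simp: code_list_def algebra_simps funpow_swap1 fun_eq_iff\<close>)
qed

text \<open>The number of iterations is the length of a list, that is, unary. This alone would not
  keep the time polynomial, because each iteration could square the size; the bound on all
  intermediate values excludes that.\<close>

lemma pt_funpow0:
  fixes h :: "'s::encodable \<Rightarrow> 's" and s :: "'a::encodable \<Rightarrow> 's"
  assumes "pt h" "pt u" "pt s"
    and "pbounded (\<lambda>x. Max ((\<lambda>i. sz ((h ^^ i) (s x))) ` {..length (u x)}))"
  shows "pt (\<lambda>x. (h ^^ length (u x)) (s x))"
proof -
  obtain c n p where "implements c n p h" using assms unfolding pt_def by blast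
  moreover obtain d n' q where "implements d n' q (\<lambda>x. (u x, s x))"
    using pt_Pair[OF assms(2,3)] unfolding pt_def by blast
  moreover define m where "m = max n n'"
  ultimately have c: "implements c m p h" and d: "implements d m q (\<lambda>x. (u x, s x))"
    by (auto elim: implements_mono)
  have m: "0 < m" using c by (simp add: implements_def)
  obtain r where r: "\<And>x. Max ((\<lambda>i. sz ((h ^^ i) (s x))) ` {..length (u x)}) \<le> poly r (sz x)"
    using assms(4) unfolding poly_bounded_by_def by blast
  let ?P = "d ;; unescape 0 (Suc m) ;; Pop 0 ;; shift (Suc m) (\<lambda>a. Push m a) ;; repeat_com m c"
  let ?t = "\<lambda>n. poly q n + (12 + (poly p (poly r n) + 5)) * (n + poly q n) + 20"
  show ?thesis
  proof (rule ptI[of ?t "Suc (Suc m)" ?P])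
    fix x :: 'a and \<sigma> :: mem and out
    assume \<sigma>: "\<sigma> 0 = code x" "\<And>i. 0 < i \<Longrightarrow> i < Suc (Suc m) \<Longrightarrow> \<sigma> i = []"
    let ?w = "code (u x)" and ?v = "code (s x)"
    have 1: "run (poly q (sz x)) d (\<sigma>, out) (\<sigma>(0 := esc ?w @ Close # ?v), out)"
      using implements_run[OF d, of \<sigma> x out] \<sigma> by (auto simp: code_prod_def)
    have 2: "run (length ?w * 7 + 1) (unescape 0 (Suc m)) (\<sigma>(0 := esc ?w @ Close # ?v), out)
       (\<sigma>(0 := Close # ?v, Suc m := rev ?w), out)"
      by (rule run_cong[OF run_unescape[where w = ?w and r = "Close # ?v"]]) (use \<sigma> in auto)
    have 3: "run 1 (Pop 0) (\<sigma>(0 := Close # ?v, Suc m := rev ?w), out)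
       (\<sigma>(0 := ?v, Suc m := rev ?w), out)"
      by (rule run_cong[OF run_Pop]) auto
    have 4: "run (length ?w * 5 + 1) (shift (Suc m) (\<lambda>a. Push m a))
       (\<sigma>(0 := ?v, Suc m := rev ?w), out) (\<sigma>(0 := ?v, m := ?w), out)"
      by (rule run_cong[OF run_move[of "Suc m" m "\<sigma>(0 := ?v, Suc m := rev ?w)" out]]) (use \<sigma> m in \<open>auto simp: fun_eq_iff\<close>)
    have 5: "run ((poly p (poly r (sz x)) + 5) * length ?w + 1) (repeat_com m c) (\<sigma>(0 := ?v, m := ?w), out)
       (\<sigma>(0 := ?v, m := ?w, 0 := code ((h ^^ length (u x)) (s x)), m := []), out)"
    proof (rule run_repeat_com[OF c])
      fix i assume "i \<le> length (u x)"
      then have "sz ((h ^^ i) (s x)) \<le> Max ((\<lambda>i. sz ((h ^^ i) (s x))) ` {..length (u x)})"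
        by (intro Max_ge) auto
      then show "sz ((h ^^ i) (s x)) \<le> poly r (sz x)" using r[of x] by (rule order_trans)
    qed (use \<sigma> m in auto)
    have "length ?w \<le> sz x + poly q (sz x)"
      using implements_sz[OF d, of x] by (simp add: sz_Pair) (simp add: sz_def)
    then have "(12 + (poly p (poly r (sz x)) + 5)) * length ?w
      \<le> (12 + (poly p (poly r (sz x)) + 5)) * (sz x + poly q (sz x))"
      by (rule mult_le_mono2)
    then show "run (?t (sz x)) ?P (\<sigma>, out) (\<sigma>(0 := code ((h ^^ length (u x)) (s x))), out)"
      by (intro run_cong[OF run_Seq[OF 1 run_Seq[OF 2 run_Seq[OF 3 run_Seq[OF 4 5]]]]]) (use m \<sigma> in \<open>auto simp: algebra_simps fun_eq_iff\<close>)
  qed (use m in \<open>auto intro!: poly_bd_intros uses_mono[OF implements_uses[OF c]]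
      uses_mono[OF implements_uses[OF d]] simp: uses_shift unescape_def repeat_com_def split: option.splits\<close>)
qed

text \<open>The parameter of \<open>h\<close> is carried along in the state, since the iterated
  program sees nothing else.\<close>

lemma pt_funpow:
  fixes h :: "'a::encodable \<Rightarrow> 's::encodable \<Rightarrow> 's"
  assumes "pt (\<lambda>p. h (fst p) (snd p))" "pt u" "pt s"
    and B: "pbounded B" "\<And>x i. i \<le> length (u x) \<Longrightarrow> sz ((h x ^^ i) (s x)) \<le> B x"
  shows "pt (\<lambda>x. (h x ^^ length (u x)) (s x))"
proof -
  let ?h = "\<lambda>p. (fst p, h (fst p) (snd p))"
  have eq: "(?h ^^ i) (x, y) = (x, (h x ^^ i) y)" for i x y
    by (induction i) auto
  have "pt (\<lambda>x. (?h ^^ length (u x)) (x, s x))"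
  proof (rule pt_funpow0)
    show "pbounded (\<lambda>x. Max ((\<lambda>i. sz ((?h ^^ i) (x, s x))) ` {..length (u x)}))"
    proof (rule poly_bounded_by_mono)
      show "pbounded (\<lambda>x. 2 * sz x + 1 + B x)"
        by (intro poly_bd_intros B)
      show "Max ((\<lambda>i. sz ((?h ^^ i) (x, s x))) ` {..length (u x)}) \<le> 2 * sz x + 1 + B x" for x
        by (subst Max_le_iff) (auto simp: eq sz_Pair B)
    qed
  qed (intro pt_Pair pt_fst0 assms pt_id)+
  from pt_snd[OF this] show ?thesis by (simp add: eq)
qed

section \<open>From programs on codes to machines on plain strings\<close>

lemma code_letters: "code (w :: letter list) = concat (map (\<lambda>a. [Open, a, Close]) w)"
  by (simp add: code_list_def code_letter_def)

definition emit_all :: com where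
  "emit_all = While 0 (\<lambda>x. x \<noteq> None)
     (Pop 0 ;; Sw 0 (\<lambda>x. case x of None \<Rightarrow> Skip | Some a \<Rightarrow> Emit a) ;; Pop 0 ;; Pop 0)"

lemma run_emit_all:
  "\<sigma> 0 = code w \<Longrightarrow> run (10 * length w + 1) emit_all (\<sigma>, out) (\<sigma>(0 := []), out @ w)"
proof (induction w arbitrary: \<sigma> out)
  case Nil
  show ?case unfolding emit_all_def
    by (rule run_cong[OF run_While_end[where s = "(\<sigma>, out)"]]) (use Nil in \<open>auto simp: code_Nil fun_eq_iff\<close>)
next
  case (Cons a w)
  have s: "\<sigma> 0 = Open # a # Close # code w" using Cons.prems by (simp add: code_letters)
  have 1: "run 1 (Pop 0) (\<sigma>, out) (\<sigma>(0 := a # Close # code w), out)"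
    by (rule run_cong[OF run_Pop]) (auto simp: s)
  have 2: "run (1 + 1) (Sw 0 (\<lambda>x. case x of None \<Rightarrow> Skip | Some a \<Rightarrow> Emit a)) (\<sigma>(0 := a # Close # code w), out)
     (\<sigma>(0 := a # Close # code w), out @ [a])"
    by (rule run_Sw) (use run_Emit in simp)
  have 3: "run 1 (Pop 0) (\<sigma>(0 := a # Close # code w), out @ [a]) (\<sigma>(0 := Close # code w), out @ [a])"
    by (rule run_cong[OF run_Pop]) auto
  have 4: "run 1 (Pop 0) (\<sigma>(0 := Close # code w), out @ [a]) (\<sigma>(0 := code w), out @ [a])"
    by (rule run_cong[OF run_Pop]) auto
  have 5: "run (10 * length w + 1) emit_all (\<sigma>(0 := code w), out @ [a]) (\<sigma>(0 := code w, 0 := []), (out @ [a]) @ w)"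
    by (rule Cons.IH) simp
  have "run (1 + (1 + 1 + (1 + 1 + 1) + 1) + 1 + (10 * length w + 1) + 1) emit_all (\<sigma>, out)
    (\<sigma>(0 := code w, 0 := []), (out @ [a]) @ w)"
    unfolding emit_all_def
    by (rule run_While_step[OF _ run_Seq[OF 1 run_Seq[OF 2 run_Seq[OF 3 4]]] 5[unfolded emit_all_def]])
      (simp add: s)
  then show ?case by (rule run_cong) auto
qed

lemma run_move_code:
  assumes "i \<noteq> j"
  shows "run (length (\<sigma> i) * 9 + 1) (shift i (\<lambda>a. Push j Close ;; Push j a ;; Push j Open)) (\<sigma>, out)
    (\<sigma>(i := [], j := code (rev (\<sigma> i)) @ \<sigma> j), out)"
proof -
  have "run 5 (Push j Close ;; Push j a ;; Push j Open) (\<sigma>, out) (\<sigma>(j := [Open, a, Close] @ \<sigma> j), out)" for a \<sigma>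
    by (rule run_cong[OF run_Seq[OF run_Push run_Seq[OF run_Push run_Push]]]) auto
  from run_move_by[of i j 5 _ out "\<lambda>a. [Open, a, Close]", OF assms this] show ?thesis
    by (simp add: code_letters)
qed

text \<open>The codes of the class \<open>encodable\<close> are internal to programs. This is the
  passage to the encodings of search problems: the input string is wrapped into the code of a list
  of letters, \<open>F\<close> works on it as a value, and \<open>emit_all\<close> unwraps the
  result. \<open>F\<close> may be arbitrary on strings that encode nothing in
  \<open>A\<close>.\<close>

lemma pt_poly_time_computable_on:
  assumes "pt F" and F: "\<And>x. x \<in> A \<Longrightarrow> F (e x) = e' (f x)"
  shows "poly_time_computable_on A e e' f"
proof -
  obtain c m p where c: "implements c m p F" using assms unfolding pt_def by blast
  have m: "0 < m" using c by (simp add: implements_def)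
  let ?P = "shift 0 (\<lambda>a. Push m a) ;; shift m (\<lambda>a. Push 0 Close ;; Push 0 a ;; Push 0 Open) ;; c ;; emit_all"
  \<comment> \<open>A string of length \<open>n\<close> has a code of length \<open>3 * n\<close>;
    the two wrapping passes take 5 and 9 steps per letter, and the outer 2 is the cost of
    compilation.\<close>
  let ?t = "\<lambda>n. 2 * (n * 14 + poly p (3 * n) + 10 * (3 * n + poly p (3 * n)) + 20)"
  have "poly_bd ?t" by (intro poly_bd_intros)
  then obtain q where q: "\<And>n. ?t n \<le> poly q n" unfolding poly_bounded_by_def by blast
  have "computes_within (compile (Suc m) ?P) (e x) (e' (f x)) (poly q (length (e x)))" if "x \<in> A" for x
  proof -
    let ?w = "e x" and ?\<sigma> = "(\<lambda>_. []) :: mem"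
    have l: "length (code ?w) = 3 * length ?w" for w by (simp add: code_letters sum_list_triv length_concat comp_def)
    have l': "length w \<le> sz w" for w :: "letter list" 
      by (simp add: code_letters sum_list_triv length_concat comp_def sz_def)
    have 1: "run (length ?w * 5 + 1) (shift 0 (\<lambda>a. Push m a)) (?\<sigma>(0 := ?w), []) (?\<sigma>(m := rev ?w), [])"
      by (rule run_cong[OF run_move[of 0 m "?\<sigma>(0 := ?w)" "[]"]]) (use m in \<open>auto simp: fun_eq_iff\<close>)
    have 2: "run (length ?w * 9 + 1) (shift m (\<lambda>a. Push 0 Close ;; Push 0 a ;; Push 0 Open))
      (?\<sigma>(m := rev ?w), []) (?\<sigma>(0 := code ?w), [])"
      by (rule run_cong[OF run_move_code[of m 0 "?\<sigma>(m := rev ?w)" "[]"]]) (use m in \<open>auto simp: fun_eq_iff\<close>)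
    have 3: "run (poly p (sz ?w)) c (?\<sigma>(0 := code ?w), []) (?\<sigma>(0 := code (e' (f x))), [])"
      using implements_run[OF c, of "?\<sigma>(0 := code ?w)" ?w "[]"] F[OF that] by simp
    have 4: "run (10 * length (e' (f x)) + 1) emit_all (?\<sigma>(0 := code (e' (f x))), [])
      (?\<sigma>(0 := code (e' (f x)), 0 := []), [] @ e' (f x))"
      by (rule run_emit_all) simp
    have "length (e' (f x)) \<le> sz (F ?w)" using l' F[OF that] by simp
    also have "\<dots> \<le> 3 * length ?w + poly p (3 * length ?w)"
      using implements_sz[OF c, of ?w] l by (simp add: sz_def)
    finally have "length (e' (f x)) \<le> 3 * length ?w + poly p (3 * length ?w)" .
    moreover obtain t where t: "t \<le> length ?w * 5 + 1 + (length ?w * 9 + 1 +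
        (poly p (sz ?w) + (10 * length (e' (f x)) + 1) + 1) + 1) + 1"
      "(step ^^ t) ([?P], ?\<sigma>(0 := ?w), []) = ([], ?\<sigma>(0 := code (e' (f x)), 0 := []), [] @ e' (f x))"
      using run_Seq[OF 1 run_Seq[OF 2 run_Seq[OF 3 4]]] unfolding run_def by blast
    ultimately have "2 * t \<le> ?t (length ?w)"
      using l by (simp add: sz_def)
    then have t': "2 * t \<le> poly q (length ?w)" using q order_trans by blast
    then show ?thesis
      by (intro compile_computes[OF _ _ _ t', of _ _ _ "?\<sigma>(0 := code (e' (f x)), 0 := [])"])
        (use t(2) m in \<open>auto simp: uses_shift emit_all_def
          intro: uses_mono[OF implements_uses[OF c]] split: option.splits\<close>)
  qed
  moreover have "valid_tm (compile (Suc m) ?P)" by (rule valid_compile) simp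
  ultimately show ?thesis unfolding poly_time_computable_on_def by blast
qed

section \<open>Lists and binary arithmetic\<close>

named_theorems pt_intros

lemma pt_cong: "pt f \<Longrightarrow> (\<And>x. f x = g x) \<Longrightarrow> pt g"
  by (simp add: ext[of f g])

lemma pt_app2:
  assumes "pt (\<lambda>p. h (fst p) (snd p))" "pt a" "pt b"
  shows "pt (\<lambda>x. h (a x) (b x))"
  using pt_comp[OF assms(1) pt_Pair[OF assms(2,3)]] by simp

lemma pt_app3:
  assumes "pt (\<lambda>p. h (fst p) (fst (snd p)) (snd (snd p)))" "pt a" "pt b" "pt c"
  shows "pt (\<lambda>x. h (a x) (b x) (c x))"
  using pt_comp[OF assms(1) pt_Pair[OF assms(2) pt_Pair[OF assms(3,4)]]] by simp

declare pt_const[pt_intros] pt_id[pt_intros] pt_fst[pt_intros] pt_snd[pt_intros]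
  pt_Pair[pt_intros] pt_if[pt_intros] pt_case_list[pt_intros]

lemma pt_Let [pt_intros]:
  assumes "pt f" "pt (\<lambda>p. h (fst p) (snd p))"
  shows "pt (\<lambda>x. let a = f x in h x a)"
  using pt_app2[OF assms(2) pt_id assms(1)] by simp

lemma pt_case_prod [pt_intros]:
  assumes "pt f" "pt (\<lambda>p. h (fst p) (fst (snd p)) (snd (snd p)))"
  shows "pt (\<lambda>x. case f x of (a, b) \<Rightarrow> h x a b)"
  using pt_app3[OF assms(2) pt_id pt_fst[OF assms(1)] pt_snd[OF assms(1)]] by (simp add: case_prod_unfold)

lemma pt_Cons [pt_intros]: "pt f \<Longrightarrow> pt g \<Longrightarrow> pt (\<lambda>x. f x # g x)"
  using pt_same_code[OF pt_Pair, of f g "\<lambda>x. f x # g x"] by (simp add: code_Cons)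

lemma pt_Not [pt_intros]: "pt f \<Longrightarrow> pt (\<lambda>x. \<not> f x)"
  by (rule pt_cong[OF pt_if[of f "\<lambda>x. False" "\<lambda>x. True"]]) (auto intro: pt_const)

lemma pt_conj [pt_intros]: "pt f \<Longrightarrow> pt g \<Longrightarrow> pt (\<lambda>x. f x \<and> g x)"
  by (rule pt_cong[OF pt_if[of f g "\<lambda>x. False"]]) (auto intro: pt_const)

lemma pt_disj [pt_intros]: "pt f \<Longrightarrow> pt g \<Longrightarrow> pt (\<lambda>x. f x \<or> g x)"
  using pt_Not[OF pt_conj[OF pt_Not pt_Not], of f g] by simp

lemma pt_bool_eq [pt_intros]:
  fixes f g :: "'a::encodable \<Rightarrow> bool"
  shows "pt f \<Longrightarrow> pt g \<Longrightarrow> pt (\<lambda>x. f x = g x)"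
proof -
  assume "pt f" "pt g"
  then have "pt (\<lambda>x. if f x then g x else \<not> g x)" by (intro pt_intros)
  then show ?thesis by (rule pt_cong) auto
qed

lemma pt_letter_eq [pt_intros]: "pt f \<Longrightarrow> pt (\<lambda>x. f x = (a :: letter))"
  using pt_comp[OF pt_letter, of f "\<lambda>b. b = a"] by simp

lemma pt_null [pt_intros]:
  fixes f :: "'a::encodable \<Rightarrow> 'b::encodable list"
  assumes "pt f" shows "pt (\<lambda>x. f x = [])"
proof -
  have "pt (\<lambda>x. case f x of [] \<Rightarrow> True | _ # _ \<Rightarrow> False)" by (intro pt_intros assms)
  then show ?thesis by (rule pt_cong) (auto split: list.splits)
qed

lemma pt_tl [pt_intros]:
  assumes "pt f" shows "pt (\<lambda>x. tl (f x))"
proof -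
  have "pt (\<lambda>x. case f x of [] \<Rightarrow> [] | _ # ys \<Rightarrow> ys)" by (intro pt_intros assms)
  then show ?thesis by (rule pt_cong) (auto split: list.splits)
qed

lemma sz_Nil [simp]: "sz [] = 0"
  and sz_Cons [simp]: "sz (x # xs) = 2 * sz x + 1 + sz xs"
  by (simp_all add: sz_def code_list_def)

lemma sz_append [simp]: "sz (xs @ ys) = sz xs + sz ys"
  by (induction xs) auto

lemma sz_rev [simp]: "sz (rev xs) = sz xs"
  by (induction xs) auto

lemma length_le_sz: "length xs \<le> sz xs"
  by (induction xs) auto

lemma sz_elem_le: "x \<in> set xs \<Longrightarrow> sz x \<le> sz xs"
  by (induction xs) auto

lemma sz_list_le: "(\<And>x. x \<in> set xs \<Longrightarrow> sz x \<le> b) \<Longrightarrow> sz xs \<le> length xs * (2 * b + 1)"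
proof (induction xs)
  case (Cons x xs)
  then have "sz x \<le> b" "sz xs \<le> length xs * (2 * b + 1)" by auto
  then show ?case by (simp add: algebra_simps)
qed simp

lemma sz_bool_le: "sz (b :: bool) \<le> 1"
  by (simp add: sz_def code_bool_def)

lemmas pbounded_intros = poly_bounded_by_add poly_bounded_by_mult poly_bounded_by_const
  poly_bounded_by_poly pbounded_sz

lemma pt_foldl:
  fixes h :: "'a::encodable \<Rightarrow> 's::encodable \<Rightarrow> 'b::encodable \<Rightarrow> 's"
  assumes h: "pt (\<lambda>p. h (fst p) (fst (snd p)) (snd (snd p)))" and "pt l" "pt s" "pbounded B"
    and B: "\<And>x ys zs. l x = ys @ zs \<Longrightarrow> sz (foldl (h x) (s x) ys) \<le> B x"
  shows "pt (\<lambda>x. foldl (h x) (s x) (l x))"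
proof -
  define st where "st x p = (case fst p of [] \<Rightarrow> p | a # zs \<Rightarrow> (zs, h x (snd p) a))" for x p
  have st1: "st x (a # zs, s) = (zs, h x s a)" for x a zs s
    by (simp add: st_def)
  have st: "(st x ^^ i) (xs, s) = (drop i xs, foldl (h x) s (take i xs))" if "i \<le> length xs" for x i xs s
    using that
  proof (induction i arbitrary: xs s)
    case (Suc i)
    then obtain a zs where "xs = a # zs" by (cases xs) auto
    then show ?case using Suc by (simp add: funpow_Suc_right st1 del: funpow.simps(2))
  qed simp
  have "pt (\<lambda>x. (st x ^^ length (l x)) (l x, s x))"
  proof (rule pt_funpow)
    show "pt (\<lambda>p. st (fst p) (snd p))"
      unfolding st_def by (intro pt_intros pt_app3[OF h])
    show "pbounded (\<lambda>x. 2 * sz (l x) + 1 + B x)"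
      by (intro pbounded_intros assms)
    show "sz ((st x ^^ i) (l x, s x)) \<le> 2 * sz (l x) + 1 + B x" if "i \<le> length (l x)" for x i
    proof -
      have "sz (take i (l x)) + sz (drop i (l x)) = sz (l x)"
        by (metis append_take_drop_id sz_append)
      then show ?thesis using st[OF that] B[of x "take i (l x)" "drop i (l x)"]
        by (simp add: sz_Pair)
    qed
  qed (intro pt_intros assms)+
  from pt_snd[OF this] show ?thesis by (simp add: st)
qed

lemma pt_rev [pt_intros]:
  assumes "pt l" shows "pt (\<lambda>x. rev (l x))"
proof -
  have eq: "foldl (\<lambda>acc a. a # acc) [] ys = rev ys" for ys :: "'b list"
    by (induction ys rule: rev_induct) auto
  have "pt (\<lambda>x. foldl (\<lambda>acc a. a # acc) [] (l x))"
    by (rule pt_foldl[where B = "\<lambda>x. sz (l x)"]) (intro pt_intros pbounded_intros assms | simp add: eq)+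
  then show ?thesis by (simp add: eq)
qed

lemma pt_append [pt_intros]:
  assumes "pt l" "pt r" shows "pt (\<lambda>x. l x @ r x)"
proof -
  have eq: "foldl (\<lambda>acc a. a # acc) zs ys = rev ys @ zs" for ys zs :: "'b list"
    by (induction ys rule: rev_induct) auto
  have "pt (\<lambda>x. foldl (\<lambda>acc a. a # acc) (r x) (rev (l x)))"
  proof (rule pt_foldl[where B = "\<lambda>x. sz (l x) + sz (r x)"])
    fix x ys zs assume "rev (l x) = ys @ zs"
    then have "sz (l x) = sz ys + sz zs" by (metis sz_append sz_rev)
    then show "sz (foldl (\<lambda>acc a. a # acc) (r x) ys) \<le> sz (l x) + sz (r x)" by (simp add: eq)
  qed (intro pt_intros pbounded_intros assms)+
  then show ?thesis by (simp add: eq)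
qed

text \<open>No size hypothesis is left to the user: \<open>h\<close> is itself polynomial-time, so
  each of the at most \<open>sz (l x)\<close> blocks has polynomial size. All nested loops of the
  reduction are written in this form.\<close>

lemma pt_concat_map [pt_intros]:
  fixes h :: "'a::encodable \<Rightarrow> 'b::encodable \<Rightarrow> 'c::encodable list"
  assumes h: "pt (\<lambda>p. h (fst p) (snd p))" and l: "pt l"
  shows "pt (\<lambda>x. concat (map (h x) (l x)))"
proof -
  have eq: "foldl (\<lambda>acc a. acc @ h x a) [] ys = concat (map (h x) ys)" for x ys
    by (induction ys rule: rev_induct) auto
  obtain q where q: "sz (h x a) \<le> poly q (sz (x, a))" for x a
    using pbounded_sz[OF h] unfolding poly_bounded_by_def by force
  let ?b = "\<lambda>x. poly q (2 * sz x + 1 + sz (l x))"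
  have "pt (\<lambda>x. foldl (\<lambda>acc a. acc @ h x a) [] (l x))"
  proof (rule pt_foldl[where B = "\<lambda>x. sz (l x) * ?b x"])
    show "pt (\<lambda>p. fst (snd p) @ h (fst p) (snd (snd p)))"
      by (intro pt_intros pt_app2[OF h])
    fix x ys zs assume x: "l x = ys @ zs"
    have "sz (h x a) \<le> ?b x" if "a \<in> set ys" for a
    proof -
      have "sz (x, a) \<le> 2 * sz x + 1 + sz (l x)"
        using sz_elem_le[of a "l x"] that x by (simp add: sz_Pair)
      then show ?thesis using q[of x a] poly_nat_mono order_trans by blast
    qed
    then have "sz (concat (map (h x) ys)) \<le> length ys * ?b x"
      by (induction ys) (auto intro: add_mono)
    also have "\<dots> \<le> sz (l x) * ?b x"
      using length_le_sz[of "l x"] x by (intro mult_le_mono1) simp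
    finally show "sz (foldl (\<lambda>acc a. acc @ h x a) [] ys) \<le> sz (l x) * ?b x" by (simp add: eq)
  qed (intro pt_intros pbounded_intros assms)+
  then show ?thesis by (simp add: eq)
qed

lemma pt_map [pt_intros]:
  assumes h: "pt (\<lambda>p. h (fst p) (snd p))" and l: "pt l"
  shows "pt (\<lambda>x. map (h x) (l x))"
proof -
  have "pt (\<lambda>x. concat (map (\<lambda>a. [h x a]) (l x)))"
    by (intro pt_intros assms)
  then show ?thesis by simp
qed

lemma pt_filter [pt_intros]:
  assumes P: "pt (\<lambda>p. P (fst p) (snd p))" and l: "pt l"
  shows "pt (\<lambda>x. filter (P x) (l x))"
proof -
  have eq: "concat (map (\<lambda>a. if P x a then [a] else []) ys) = filter (P x) ys" for x ys
    by (induction ys) auto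
  have "pt (\<lambda>x. concat (map (\<lambda>a. if P x a then [a] else []) (l x)))"
    by (intro pt_intros assms)
  then show ?thesis by (simp add: eq)
qed


section \<open>Binary numbers and their arithmetic\<close>

instantiation nat :: encodable
begin
definition "code (n :: nat) = code (binary n)"
instance ..
end

lemma binary_0 [simp]: "binary 0 = []"
  by (simp add: binary.simps)

lemma binary_odd [simp]: "binary (Suc (2 * n)) = Digit1 # binary n"
  by (subst binary.simps) simp

lemma binary_even: "binary (2 * n) = (if n = 0 then [] else Digit0 # binary n)"
  by (subst binary.simps) simp

lemma binary_eq_Nil [simp]: "binary n = [] \<longleftrightarrow> n = 0"
  by (subst binary.simps) simp

lemma binary_half: "binary (n div 2) = tl (binary n)"
  by (subst (2) binary.simps) simp

lemma length_binary_le_iff: "length (binary n) \<le> k \<longleftrightarrow> n < 2 ^ k"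
proof (induction k arbitrary: n)
  case (Suc k)
  have "length (binary n) \<le> Suc k \<longleftrightarrow> length (binary (n div 2)) \<le> k"
    by (auto simp: binary_half)
  also have "\<dots> \<longleftrightarrow> n < 2 ^ Suc k" unfolding Suc by auto
  finally show ?case .
qed simp

lemma less_two_power_length_binary: "n < 2 ^ length (binary n)"
  using length_binary_le_iff by blast

lemma length_binary_mono: "m \<le> n \<Longrightarrow> length (binary m) \<le> length (binary n)"
  using length_binary_le_iff[of m "length (binary n)"] less_two_power_length_binary[of n] by simp

lemma sz_nat: "sz (n :: nat) = 3 * length (binary n)"
  by (simp add: sz_def code_nat_def code_letters length_concat comp_def sum_list_triv)

lemma sz_nat_mono: "(m :: nat) \<le> n \<Longrightarrow> sz m \<le> sz n"
  using length_binary_mono by (simp add: sz_nat)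

lemma sz_nat_le: "sz (n :: nat) \<le> 3 * n"
  using length_binary_le_iff[of n n] by (simp add: sz_nat)

lemma pt_binary [pt_intros]: "pt f \<Longrightarrow> pt (\<lambda>x. binary (f x))"
  by (erule pt_same_code) (simp add: code_nat_def)

lemma pt_of_binary: "pt (\<lambda>x. binary (f x)) \<Longrightarrow> pt f"
  by (erule pt_same_code) (simp add: code_nat_def)

lemma pt_zero_eq [pt_intros]: "pt f \<Longrightarrow> pt (\<lambda>x. f x = (0 :: nat))"
  using pt_null[OF pt_binary, of f] by simp

lemma pt_half [pt_intros]: "pt f \<Longrightarrow> pt (\<lambda>x. f x div (2 :: nat))"
  by (rule pt_of_binary, unfold binary_half) (intro pt_intros)

lemma pt_odd [pt_intros]:
  fixes f :: "'a::encodable \<Rightarrow> nat"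
  assumes "pt f" shows "pt (\<lambda>x. odd (f x))"
proof -
  have "pt (\<lambda>x. case binary (f x) of [] \<Rightarrow> False | d # _ \<Rightarrow> d = Digit1)"
    by (intro pt_intros assms)
  moreover have "(case binary n of [] \<Rightarrow> False | d # _ \<Rightarrow> d = Digit1) = odd n" for n
    by (subst binary.simps) simp
  ultimately show ?thesis by simp
qed

lemma pt_double [pt_intros]:
  assumes "pt f" shows "pt (\<lambda>x. 2 * f x :: nat)"
  by (rule pt_of_binary, unfold binary_even) (intro pt_intros assms)

lemma pt_Suc_double:
  assumes "pt f" shows "pt (\<lambda>x. Suc (2 * f x))"
  by (rule pt_of_binary, unfold binary_odd) (intro pt_intros assms)

text \<open>Digits are read most significant first. Evaluating them, instead of storing them
  directly, removes the leading zeros that digitwise arithmetic produces and so restores the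
  canonical \<open>binary\<close> form.\<close>

definition horner :: "nat \<Rightarrow> bool list \<Rightarrow> nat" where
  "horner = foldl (\<lambda>v b. if b then Suc (2 * v) else 2 * v)"

lemma length_binary_horner: "length (binary (horner v bs)) \<le> length (binary v) + length bs"
proof (induction bs rule: rev_induct)
  case (snoc b bs)
  have "length (binary (if b then Suc (2 * w) else 2 * w)) \<le> Suc (length (binary w))" for w
    by (auto simp: binary_even)
  from this[of "horner v bs"] have "length (binary (horner v (bs @ [b]))) \<le> Suc (length (binary (horner v bs)))"
    unfolding horner_def by simp
  then show ?case using snoc by simp
qed (simp add: horner_def)

lemma pt_horner [pt_intros]:
  assumes "pt v" "pt bs"
  shows "pt (\<lambda>x. horner (v x) (bs x))"
  unfolding horner_def
proof (rule pt_foldl[where B = "\<lambda>x. sz (v x) + 3 * sz (bs x)"])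
  fix x ys zs assume "bs x = ys @ zs"
  then have "length ys \<le> sz (bs x)" using length_le_sz[of "bs x"] by simp
  with length_binary_horner[of "v x" ys]
  show "sz (foldl (\<lambda>v b. if b then Suc (2 * v) else 2 * v) (v x) ys) \<le> sz (v x) + 3 * sz (bs x)"
    by (simp add: sz_nat flip: horner_def)
qed (intro pt_intros pt_Suc_double pbounded_intros assms)+

text \<open>
  Schoolbook addition (\<open>s\<close> true) and subtraction (\<open>s\<close> false), collecting the digits of the result
  most significant digit first; \<open>c\<close> is the carry or the borrow.
\<close>

definition ripple :: "bool \<Rightarrow> nat \<times> nat \<times> bool \<times> bool list \<Rightarrow> nat \<times> nat \<times> bool \<times> bool list" where
  "ripple s = (\<lambda>(x, y, c, bs).
     (x div 2, y div 2, if odd x = s then odd y \<or> c else odd y \<and> c, (odd x = (odd y = c)) # bs))"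

lemma ripple_simp [simp]: "ripple s (x, y, c, bs) =
    (x div 2, y div 2, if odd x = s then odd y \<or> c else odd y \<and> c, (odd x = (odd y = c)) # bs)"
  by (simp add: ripple_def)

text \<open>The extra letter \<open>Digit1\<close> only makes the list longer by one. When both
  arguments are used up, the additional step writes the last carry of an addition as a digit; in a
  subtraction a borrow survives it and signals a negative result.\<close>

definition rippled :: "bool \<Rightarrow> nat \<Rightarrow> nat \<Rightarrow> nat \<times> nat \<times> bool \<times> bool list" where
  "rippled s x y = (ripple s ^^ length (Digit1 # binary x @ binary y)) (x, y, False, [])"

lemma ripple_state:
  "(ripple s ^^ i) (x, y, False, []) = (a, b, c, bs) \<Longrightarrow>
    a = x div 2 ^ i \<and> b = y div 2 ^ i \<and> length bs = i"
proof (induction i arbitrary: a b c bs)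
  case (Suc i)
  obtain a' b' c' bs' where st: "(ripple s ^^ i) (x, y, False, []) = (a', b', c', bs')"
    by (metis prod_cases4)
  have "a = a' div 2" "b = b' div 2" "length bs = Suc (length bs')"
    using Suc.prems by (auto simp: st)
  with Suc.IH[OF st] show ?case by (simp only: power_Suc2 div_mult2_eq)
qed simp

lemma pt_rippled: "pt f \<Longrightarrow> pt g \<Longrightarrow> pt (\<lambda>x. rippled s (f x) (g x))"
proof -
  have "pt (\<lambda>p. rippled s (fst p) (snd p))"
    unfolding rippled_def
  proof (rule pt_funpow[where B = "\<lambda>p. 2 * sz (fst p) + 1 + (2 * sz (snd p) + 1 +
      (3 + (2 * 1 + 1) * sz (Digit1 # binary (fst p) @ binary (snd p))))"])
    show "pt (\<lambda>p. ripple s (snd p))" unfolding ripple_def by (intro pt_intros)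
    fix p :: "nat \<times> nat" and i assume i: "i \<le> length (Digit1 # binary (fst p) @ binary (snd p))"
    obtain a b c bs where st: "(ripple s ^^ i) (fst p, snd p, False, []) = (a, b, c, bs)"
      by (metis prod_cases4)
    from ripple_state[OF st] have "a \<le> fst p" "b \<le> snd p" "length bs = i" by auto
    moreover have "sz bs \<le> length bs * (2 * 1 + 1)" by (rule sz_list_le) (rule sz_bool_le)
    ultimately show "sz ((ripple s ^^ i) (fst p, snd p, False, [])) \<le> 2 * sz (fst p) + 1 +
      (2 * sz (snd p) + 1 + (3 + (2 * 1 + 1) * sz (Digit1 # binary (fst p) @ binary (snd p))))"
      unfolding st using sz_nat_mono[of a "fst p"] sz_nat_mono[of b "snd p"] sz_bool_le[of c]
        length_le_sz[of "Digit1 # binary (fst p) @ binary (snd p)"] i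
      by (simp add: sz_Pair)
  qed (intro pt_intros pbounded_intros)+
  then show "pt f \<Longrightarrow> pt g \<Longrightarrow> ?thesis" by (rule pt_app2)
qed

abbreviation ihorner :: "int \<Rightarrow> bool list \<Rightarrow> int" where
  "ihorner \<equiv> foldl (\<lambda>v b. 2 * v + of_bool b)"

lemma ihorner_horner: "ihorner (int v) bs = int (horner v bs)"
  unfolding horner_def by (induction bs rule: rev_induct) auto

lemma ihorner_neg: "v < 0 \<Longrightarrow> ihorner v bs < 0"
  by (induction bs arbitrary: v) auto

lemma int_half: "int n = 2 * int (n div 2) + of_bool (odd n)"
  unfolding of_bool_def by presburger

text \<open>The unread parts of the arguments, together with the carry or borrow, act as a leading
  digit in front of the digits written so far. Over the integers this leading digit may be negative,
  so that addition and subtraction share one invariant.\<close>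

lemma ripple_inv:
  "(ripple s ^^ i) (x, y, False, []) = (x', y', c', bs) \<Longrightarrow>
    ihorner (int x' + (if s then 1 else -1) * (int y' + of_bool c')) bs = int x + (if s then 1 else -1) * int y"
proof (induction i arbitrary: x' y' c' bs)
  case (Suc i)
  let ?e = "if s then 1 else -1 :: int"
  obtain a b c cs where st: "(ripple s ^^ i) (x, y, False, []) = (a, b, c, cs)" by (metis prod_cases4)
  have "x' = a div 2" "y' = b div 2" "c' = (if odd a = s then odd b \<or> c else odd b \<and> c)"
    "bs = (odd a = (odd b = c)) # cs"
    using Suc.prems by (auto simp: st)
  moreover from this have "2 * (int x' + ?e * (int y' + of_bool c')) + of_bool (odd a = (odd b = c)) =
      int a + ?e * (int b + of_bool c)"
    using int_half[of a] int_half[of b] by (cases "odd a"; cases "odd b"; cases c; cases s) simp_all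
  ultimately show ?case using Suc.IH[OF st] by simp
qed simp

lemma ripple_zero:
  "(ripple s ^^ (length (binary x) + length (binary y))) (x, y, False, []) = (x', y', c', bs) \<Longrightarrow> x' = 0 \<and> y' = 0"
proof -
  have "x < 2 ^ (length (binary x) + length (binary y))" "y < 2 ^ (length (binary x) + length (binary y))"
    using length_binary_le_iff[of x "length (binary x) + length (binary y)"]
      length_binary_le_iff[of y "length (binary x) + length (binary y)"] by simp_all
  then show "(ripple s ^^ (length (binary x) + length (binary y))) (x, y, False, []) = (x', y', c', bs) \<Longrightarrow> ?thesis"
    using ripple_state by fastforce
qed

lemma rippled_add: "horner 0 (snd (snd (snd (rippled True x y)))) = x + y"
proof -
  let ?n = "length (binary x) + length (binary y)"
  obtain a b c bs where st: "(ripple True ^^ ?n) (x, y, False, []) = (a, b, c, bs)" by (metis prod_cases4)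
  have 0: "a = 0" "b = 0" using ripple_zero[OF st] by auto
  have eq: "(ripple True ^^ Suc ?n) (x, y, False, []) = (0, 0, False, c # bs)"
    by (simp add: st 0)
  from ripple_inv[OF eq] have "int (horner 0 (c # bs)) = int (x + y)"
    using ihorner_horner[of 0 "c # bs"] by simp
  then show ?thesis using eq by (simp add: rippled_def del: funpow.simps)
qed

text \<open>A remaining borrow is a leading digit -1, which outweighs all later digits
  (\<open>ihorner_neg\<close>); then \<open>x < y\<close>, and truncated subtraction gives
  0.\<close>

lemma rippled_sub:
  "(if fst (snd (snd (rippled False x y))) then 0 else horner 0 (snd (snd (snd (rippled False x y))))) = x - y"
proof -
  let ?n = "length (binary x) + length (binary y)"
  obtain a b c bs where st: "(ripple False ^^ ?n) (x, y, False, []) = (a, b, c, bs)" by (metis prod_cases4)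
  have 0: "a = 0" "b = 0" using ripple_zero[OF st] by auto
  have eq: "(ripple False ^^ Suc ?n) (x, y, False, []) = (0, 0, c, c # bs)"
    by (simp add: st 0)
  then have r: "rippled False x y = (0, 0, c, c # bs)" by (simp add: rippled_def del: funpow.simps)
  have inv: "ihorner (- of_bool c) (c # bs) = int x - int y"
    using ripple_inv[OF eq] by simp
  show ?thesis
  proof (cases c)
    case True
    then have "int x - int y < 0" using inv ihorner_neg[of "-1" "c # bs"] by simp
    then show ?thesis using True r by simp
  next
    case False
    then have "int (horner 0 (c # bs)) = int x - int y" using inv ihorner_horner[of 0 "c # bs"] by simp
    then show ?thesis using False r by simp
  qed
qed

lemma pt_add [pt_intros]:
  assumes "pt f" "pt g" shows "pt (\<lambda>x. f x + g x :: nat)"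
  unfolding rippled_add[symmetric] by (intro pt_intros pt_rippled assms)

lemma pt_sub [pt_intros]:
  assumes "pt f" "pt g" shows "pt (\<lambda>x. f x - g x :: nat)"
  unfolding rippled_sub[symmetric] by (intro pt_intros pt_rippled assms)

lemma pt_Suc [pt_intros]: "pt f \<Longrightarrow> pt (\<lambda>x. Suc (f x))"
  using pt_add[OF _ pt_const, of f 1] by simp

lemma pt_less [pt_intros]: "pt f \<Longrightarrow> pt g \<Longrightarrow> pt (\<lambda>x. f x < (g x :: nat))"
  by (rule pt_cong[OF pt_Not[OF pt_zero_eq[OF pt_sub[of g f]]]]) auto

text \<open>Russian peasant multiplication: doubling one factor while halving the other.\<close>

definition mult_step :: "nat \<times> nat \<times> nat \<Rightarrow> nat \<times> nat \<times> nat" where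
  "mult_step = (\<lambda>(x, y, z). (2 * x, y div 2, if odd y then z + x else z))"

lemma mult_steps: "(mult_step ^^ i) (x, y, 0) = (2 ^ i * x, y div 2 ^ i, (y mod 2 ^ i) * x)"
proof (induction i)
  case (Suc i)
  have 1: "y mod 2 ^ Suc i = (if odd (y div 2 ^ i) then 2 ^ i else 0) + y mod 2 ^ i"
    unfolding power_Suc2 mod_mult2_eq by (simp add: odd_iff_mod_2_eq_one even_iff_mod_2_eq_zero)
  have 2: "y div 2 ^ Suc i = y div 2 ^ i div 2"
    unfolding power_Suc2 div_mult2_eq ..
  show ?case
    unfolding funpow.simps comp_apply Suc 1 2 by (simp add: mult_step_def algebra_simps)
qed (simp add: mult_step_def)

lemma pt_mult [pt_intros]:
  assumes "pt f" "pt g" shows "pt (\<lambda>x. f x * g x :: nat)"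
proof -
  let ?h = "\<lambda>p :: nat \<times> nat. (mult_step ^^ length (binary (snd p))) (fst p, snd p, 0)"
  have "pt ?h"
  proof (rule pt_funpow[where B = "\<lambda>p. 2 * (sz (fst p) + sz (snd p)) + 1 + (2 * sz (snd p) + 1 +
      (sz (fst p) + sz (snd p)))"])
    show "pt (\<lambda>p. mult_step (snd p))" unfolding mult_step_def by (intro pt_intros)
    fix p :: "nat \<times> nat" and i assume i: "i \<le> length (binary (snd p))"
    obtain x y where p: "p = (x, y)" by fastforce
    let ?k = "length (binary x) + length (binary y)"
    have x: "x < 2 ^ length (binary x)" and y: "y < 2 ^ length (binary y)"
      by (rule less_two_power_length_binary)+
    have "2 ^ i * x < 2 ^ i * 2 ^ length (binary x)" using x by simp
    also have "\<dots> \<le> 2 ^ ?k" unfolding power_add[symmetric] using i p by (intro power_increasing) auto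
    finally have "length (binary (2 ^ i * x)) \<le> ?k" by (simp add: length_binary_le_iff)
    moreover have "length (binary ((y mod 2 ^ i) * x)) \<le> ?k"
    proof -
      have "(y mod 2 ^ i) * x \<le> y * x" by simp
      also have "\<dots> < 2 ^ length (binary y) * 2 ^ length (binary x)"
        using x y by (intro mult_strict_mono') auto
      finally show ?thesis by (simp add: length_binary_le_iff power_add mult.commute)
    qed
    moreover have "sz (y div 2 ^ i) \<le> sz y" by (rule sz_nat_mono) simp
    ultimately show "sz ((mult_step ^^ i) (fst p, snd p, 0)) \<le> 2 * (sz (fst p) + sz (snd p)) + 1 +
      (2 * sz (snd p) + 1 + (sz (fst p) + sz (snd p)))"
      by (simp add: p mult_steps sz_Pair) (simp add: sz_nat)
  qed (intro pt_intros pbounded_intros)+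
  then have "pt (\<lambda>p. snd (snd (?h p)))" by (intro pt_intros)
  moreover have "snd (snd (?h p)) = fst p * snd p" for p
    using less_two_power_length_binary[of "snd p"] by (simp add: mult_steps)
  ultimately have "pt (\<lambda>p. fst p * snd p :: nat)" by simp
  from pt_app2[OF this assms] show ?thesis .
qed

lemma pt_length [pt_intros]:
  assumes "pt l" shows "pt (\<lambda>x. length (l x))"
proof -
  have eq: "foldl (\<lambda>n a. Suc n) m ys = m + length ys" for m and ys :: "'b list"
    by (induction ys arbitrary: m) auto
  have "pt (\<lambda>x. foldl (\<lambda>n a. Suc n) 0 (l x))"
  proof (rule pt_foldl[where B = "\<lambda>x. 3 * sz (l x)"])
    fix x and ys zs :: "'b list" assume "l x = ys @ zs"
    then have "length ys \<le> sz (l x)" using length_le_sz[of "l x"] by simp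
    then show "sz (foldl (\<lambda>n a. Suc n) 0 ys) \<le> 3 * sz (l x)"
      using sz_nat_le[of "length ys"] by (simp add: eq)
  qed (intro pt_intros pbounded_intros assms)+
  then show ?thesis by (simp add: eq)
qed

lemma pt_enumerate [pt_intros]:
  assumes "pt l" shows "pt (\<lambda>x. List.enumerate 0 (l x))"
proof -
  have eq: "foldl (\<lambda>acc a. (length acc, a) # acc) [] ys = rev (List.enumerate 0 ys)" for ys :: "'b list"
    by (induction ys rule: rev_induct) (auto simp: enumerate_append_eq)
  have "pt (\<lambda>x. rev (foldl (\<lambda>acc a. (length acc, a) # acc) [] (l x)))"
  proof (intro pt_rev pt_foldl[where B = "\<lambda>x. sz (l x) * (2 * (6 * sz (l x) + 1 + sz (l x)) + 1)"])
    fix x and ys zs :: "'b list" assume l: "l x = ys @ zs"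
    have "sz p \<le> 6 * sz (l x) + 1 + sz (l x)" if p: "p \<in> set (List.enumerate 0 ys)" for p
    proof -
      obtain i a where [simp]: "p = (i, a)" by fastforce
      have "i < length ys" "a \<in> set ys"
        using p by (auto simp: in_set_enumerate_eq)
      then show ?thesis
        using sz_nat_le[of i] l sz_elem_le[of a "l x"] length_le_sz[of "l x"] by (auto simp: sz_Pair)
    qed
    then have "sz (List.enumerate 0 ys) \<le> length ys * (2 * (6 * sz (l x) + 1 + sz (l x)) + 1)"
      using sz_list_le[of "List.enumerate 0 ys" "6 * sz (l x) + 1 + sz (l x)"] by simp
    also have "\<dots> \<le> sz (l x) * (2 * (6 * sz (l x) + 1 + sz (l x)) + 1)"
      using length_le_sz[of "l x"] l by (intro mult_le_mono1) simp
    finally show "sz (foldl (\<lambda>acc a. (length acc, a) # acc) [] ys) \<le>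
      sz (l x) * (2 * (6 * sz (l x) + 1 + sz (l x)) + 1)" by (simp add: eq)
  qed (intro pt_intros pbounded_intros assms)+
  then show ?thesis by (simp add: eq)
qed

lemma pt_upt [pt_intros]: 
  assumes "pt l" shows "pt (\<lambda>x. [0..<length (l x)])"
proof -
  have "pt (\<lambda>x. map fst (List.enumerate 0 (l x)))" by (intro pt_intros assms)
  then show ?thesis by (simp add: map_fst_enumerate)
qed

text \<open>The exponent must be unary: for an exponent in binary the result would have
  exponentially many digits.\<close>

lemma pt_two_power [pt_intros]:
  assumes "pt l" shows "pt (\<lambda>x. 2 ^ length (l x) :: nat)"
proof -
  have eq: "((\<lambda>v. 2 * v) ^^ i) 1 = (2 ^ i :: nat)" for i
    by (induction i) auto
  have "pt (\<lambda>x. ((\<lambda>v :: nat. 2 * v) ^^ length (l x)) 1)"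
  proof (rule pt_funpow[where B = "\<lambda>x. 3 * (sz (l x) + 1)"])
    fix x i assume "i \<le> length (l x)"
    then have "i < sz (l x) + 1" using length_le_sz[of "l x"] by simp
    then have "(2 :: nat) ^ i < 2 ^ (sz (l x) + 1)" by (intro power_strict_increasing) auto
    then show "sz (((\<lambda>v :: nat. 2 * v) ^^ i) 1) \<le> 3 * (sz (l x) + 1)"
      unfolding eq sz_nat using length_binary_le_iff[of "2 ^ i" "sz (l x) + 1"] by simp
  qed (intro pt_intros pbounded_intros assms)+
  then show ?thesis unfolding eq .
qed

section \<open>Integers as pairs of a positive and a negative part\<close>

instantiation int :: encodable
begin
definition "code (z :: int) = code (nat z, nat (- z))"
instance ..
end

lemma pt_nat_diff [pt_intros]:
  assumes "pt f" "pt g" shows "pt (\<lambda>x. int (f x) - int (g x))"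
proof -
  have "pt (\<lambda>x. (f x - g x, g x - f x))" by (intro pt_intros assms)
  moreover have "nat (int m - int n) = m - n" for m n by simp
  ultimately show ?thesis by (elim pt_same_code) (simp only: code_int_def minus_diff_eq)
qed

lemma pt_nat [pt_intros]:
  assumes "pt f" shows "pt (\<lambda>x. nat (f x))"
proof -
  have "pt (\<lambda>x. (nat (f x), nat (- f x)))"
    using assms by (rule pt_same_code) (simp add: code_int_def)
  from pt_fst[OF this] show ?thesis by simp
qed

lemma pt_nat_uminus [pt_intros]:
  assumes "pt f" shows "pt (\<lambda>x. nat (- f x))"
proof -
  have "pt (\<lambda>x. (nat (f x), nat (- f x)))"
    using assms by (rule pt_same_code) (simp add: code_int_def)
  from pt_snd[OF this] show ?thesis by simp
qed

lemma pt_int [pt_intros]: "pt f \<Longrightarrow> pt (\<lambda>x. int (f x))"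
  using pt_nat_diff[OF _ pt_const, of f 0] by simp

lemma pt_int_add [pt_intros]:
  assumes "pt f" "pt g" shows "pt (\<lambda>x. f x + g x :: int)"
proof -
  have "pt (\<lambda>x. int (nat (f x) + nat (g x)) - int (nat (- f x) + nat (- g x)))"
    by (intro pt_intros assms)
  then show ?thesis by (rule pt_cong) auto
qed

lemma pt_int_mult [pt_intros]:
  assumes "pt f" "pt g" shows "pt (\<lambda>x. f x * int (g x))"
proof -
  have "pt (\<lambda>x. int (nat (f x) * g x) - int (nat (- f x) * g x))"
    by (intro pt_intros assms)
  moreover have "int (nat z * n) - int (nat (- z) * n) = z * int n" for z n
    by (cases "0 \<le> z") auto
  ultimately show ?thesis by simp
qed

lemma pt_int_less [pt_intros]:
  assumes "pt f" "pt g" shows "pt (\<lambda>x. f x < (g x :: int))"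
proof -
  have "pt (\<lambda>x. nat (f x) + nat (- g x) < nat (g x) + nat (- f x))"
    by (intro pt_intros assms)
  then show ?thesis by (rule pt_cong) auto
qed

section \<open>Parsing instances\<close>

text \<open>The default 0 makes the parser total; its behaviour matters only on encodings of
  instances, where enough numbers are present.\<close>

definition head_or_zero :: "int list \<Rightarrow> int" where
  "head_or_zero xs = (case xs of [] \<Rightarrow> 0 | x # _ \<Rightarrow> x)"

lemma head_or_zero_Cons [simp]: "head_or_zero (x # xs) = x"
  by (simp add: head_or_zero_def)

lemma pt_head_or_zero [pt_intros]: "pt f \<Longrightarrow> pt (\<lambda>x. head_or_zero (f x))"
  unfolding head_or_zero_def by (intro pt_intros)

lemma sz_head_or_zero: "sz (head_or_zero xs) \<le> sz xs + 1"
proof (cases xs)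
  case Nil
  then show ?thesis by (simp add: head_or_zero_def sz_def code_int_def code_prod_def code_nat_def code_Nil)
qed simp

lemma sz_tl: "sz (tl xs) \<le> sz xs"
  by (cases xs) auto

definition piece_of_ints :: "int list \<Rightarrow> piece" where
  "piece_of_ints ts =
     ((head_or_zero ts, nat (head_or_zero (tl ts))),
      (head_or_zero (tl (tl ts)), nat (head_or_zero (tl (tl (tl ts))))),
      (head_or_zero (tl (tl (tl (tl ts)))), nat (head_or_zero (tl (tl (tl (tl (tl ts))))))))"

definition piece_step :: "int list \<times> piece list \<Rightarrow> int list \<times> piece list" where
  "piece_step p = (if fst p = [] then p
     else (tl (tl (tl (tl (tl (tl (fst p)))))), piece_of_ints (fst p) # snd p))"

text \<open>A piece takes six numbers, so \<open>length ts\<close> iterations are more than enough;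
  the surplus ones are idle because \<open>piece_step\<close> does nothing on the empty
  list.\<close>

definition pieces_of_ints :: "int list \<Rightarrow> piece list" where
  "pieces_of_ints ts = rev (snd ((piece_step ^^ length ts) (ts, [])))"

lemma sz_nat_int: "sz (nat z) \<le> sz z"
  by (simp add: sz_def code_int_def code_prod_def)

lemma sz_piece_of_ints: "sz (piece_of_ints ts) \<le> 100 * sz ts + 100"
proof -
  have "sz (head_or_zero (tl xs)) \<le> sz ts + 1" "sz (tl xs) \<le> sz ts" if "sz xs \<le> sz ts" for xs
    using sz_tl[of xs] sz_head_or_zero[of "tl xs"] that by linarith+
  moreover from this have "sz (nat (head_or_zero (tl xs))) \<le> sz ts + 1" if "sz xs \<le> sz ts" for xs
    using that sz_nat_int order_trans by blast
  ultimately have "sz (head_or_zero ts) \<le> sz ts + 1" "sz (nat (head_or_zero (tl ts))) \<le> sz ts + 1"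
    "sz (head_or_zero (tl (tl ts))) \<le> sz ts + 1" "sz (nat (head_or_zero (tl (tl (tl ts))))) \<le> sz ts + 1"
    "sz (head_or_zero (tl (tl (tl (tl ts))))) \<le> sz ts + 1"
    "sz (nat (head_or_zero (tl (tl (tl (tl (tl ts))))))) \<le> sz ts + 1"
    using sz_head_or_zero[of ts] by simp_all
  then show ?thesis by (simp add: piece_of_ints_def sz_Pair)
qed

lemma pt_pieces_of_ints [pt_intros]:
  assumes "pt f" shows "pt (\<lambda>x. pieces_of_ints (f x))"
proof -
  have st: "sz (fst ((piece_step ^^ i) (ts, []))) \<le> sz ts \<and>
    length (snd ((piece_step ^^ i) (ts, []))) \<le> i \<and>
    (\<forall>P\<in>set (snd ((piece_step ^^ i) (ts, []))). sz P \<le> 100 * sz ts + 100)" (is "?I i") for i ts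
  proof (induction i)
    case (Suc i)
    obtain us Ps where eq: "(piece_step ^^ i) (ts, []) = (us, Ps)" by fastforce
    have tl6: "sz (tl (tl (tl (tl (tl (tl us)))))) \<le> sz us"
      by (intro order_trans[OF sz_tl] order_refl)
    show ?case
      using Suc tl6 sz_piece_of_ints[of us] by (auto simp: eq piece_step_def[of "(us, Ps)"])
  qed simp
  have "pt (\<lambda>x. (piece_step ^^ length (f x)) (f x, []))"
  proof (rule pt_funpow[where B = "\<lambda>x. 2 * sz (f x) + 1 + sz (f x) * (2 * (100 * sz (f x) + 100) + 1)"])
    show "pt (\<lambda>p. piece_step (snd p))"
      unfolding piece_step_def piece_of_ints_def by (intro pt_intros)
    fix x i assume i: "i \<le> length (f x)"
    obtain us Ps where eq: "(piece_step ^^ i) (f x, []) = (us, Ps)" by fastforce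
    have "sz Ps \<le> length Ps * (2 * (100 * sz (f x) + 100) + 1)"
      using st[of i "f x"] by (intro sz_list_le) (auto simp: eq)
    also have "\<dots> \<le> sz (f x) * (2 * (100 * sz (f x) + 100) + 1)"
      using st[of i "f x"] i length_le_sz[of "f x"] by (intro mult_le_mono1) (simp add: eq)
    finally show "sz ((piece_step ^^ i) (f x, [])) \<le>
      2 * sz (f x) + 1 + sz (f x) * (2 * (100 * sz (f x) + 100) + 1)"
      using st[of i "f x"] unfolding eq sz_Pair by simp
  qed (intro pt_intros pbounded_intros assms)+
  then show ?thesis unfolding pieces_of_ints_def by (intro pt_intros)
qed

type_synonym parse_state = "bool list \<times> bool \<times> int list \<times> int list \<times> int list list"

text \<open>
  The components are the digits of the number being read, its sign, the numbers read since the
  last bracket, the numbers before the first bracket, and the groups closed so far; all lists are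
  in reverse order.
\<close>

definition parse_step :: "parse_state \<Rightarrow> letter \<Rightarrow> parse_state" where
  "parse_step s a = (case s of (bs, neg, ts, hdr, gs) \<Rightarrow>
     if a = Digit0 then (False # bs, neg, ts, hdr, gs)
     else if a = Digit1 then (True # bs, neg, ts, hdr, gs)
     else if a = Minus then (bs, True, ts, hdr, gs)
     else if a = Stop then
       ([], False, (if neg then int 0 - int (horner 0 bs) else int (horner 0 bs)) # ts, hdr, gs)
     else if a = Open then (bs, neg, [], if hdr = [] then ts else hdr, gs)
     else (bs, neg, [], hdr, ts # gs))"

lemma parse_step_simp: "parse_step (bs, neg, ts, hdr, gs) a = (
     if a = Digit0 then (False # bs, neg, ts, hdr, gs)
     else if a = Digit1 then (True # bs, neg, ts, hdr, gs)
     else if a = Minus then (bs, True, ts, hdr, gs)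
     else if a = Stop then
       ([], False, (if neg then int 0 - int (horner 0 bs) else int (horner 0 bs)) # ts, hdr, gs)
     else if a = Open then (bs, neg, [], if hdr = [] then ts else hdr, gs)
     else (bs, neg, [], hdr, ts # gs))"
  by (simp add: parse_step_def)

type_synonym con_data = "nat \<times> nat \<times> (frac \<times> frac) \<times> piece list list"

text \<open>The four numbers of the interval are read as an incomplete piece whose height defaults
  to zero. The most recent group is discarded by \<open>tl gs\<close>: it is the empty one recorded
  when the bracket around the list of agents closes.\<close>

definition con_data_of :: "parse_state \<Rightarrow> con_data" where
  "con_data_of = (\<lambda>(bs, neg, ts, hdr, gs).
     let h = rev hdr; P = piece_of_ints (tl (tl h)) in
     (nat (head_or_zero h), nat (head_or_zero (tl h)), (fst P, fst (snd P)),
        map (\<lambda>g. pieces_of_ints (rev g)) (rev (tl gs))))"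

definition parse :: "letter list \<Rightarrow> con_data" where
  "parse w = con_data_of (foldl parse_step ([], False, [], [], []) w)"

text \<open>A natural number with \<open>i\<close> digits has a code of length \<open>3 * i\<close>.
  The pair representing an integer doubles its first component and adds a separator, so
  \<open>6 * i + 1 + 3 * i\<close> suffices.\<close>

definition small_ints :: "nat \<Rightarrow> int list \<Rightarrow> bool" where
  "small_ints i zs \<longleftrightarrow> length zs \<le> i \<and> (\<forall>z\<in>set zs. sz z \<le> 9 * i + 1)"

lemma small_ints_Suc: "small_ints i zs \<Longrightarrow> small_ints (Suc i) zs"
  by (force simp: small_ints_def)

lemma small_ints_Cons: "small_ints i zs \<Longrightarrow> sz z \<le> 9 * Suc i + 1 \<Longrightarrow> small_ints (Suc i) (z # zs)"
  by (force simp: small_ints_def)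

lemma sz_int: "sz (z :: int) = 2 * sz (nat z) + 1 + sz (nat (- z))"
  by (simp add: sz_def code_int_def code_prod_def)

lemma sz_signed_horner:
  "sz (if neg then int 0 - int (horner 0 bs) else int (horner 0 bs)) \<le> 9 * length bs + 1"
  using length_binary_horner[of 0 bs] by (auto simp: sz_int sz_nat)

lemma parse_step_small:
  "foldl parse_step ([], False, [], [], []) w = (bs, neg, ts, hdr, gs) \<Longrightarrow>
    length bs \<le> length w \<and> small_ints (length w) ts \<and> small_ints (length w) hdr \<and>
    length gs \<le> length w \<and> (\<forall>g\<in>set gs. small_ints (length w) g)"
proof (induction w arbitrary: bs neg ts hdr gs rule: rev_induct)
  case Nil
  then show ?case by (auto simp: small_ints_def)
next
  case (snoc a w)
  obtain bs' neg' ts' hdr' gs' where eq: "foldl parse_step ([], False, [], [], []) w = (bs', neg', ts', hdr', gs')"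
    by (metis prod_cases5)
  have "sz (if neg' then int 0 - int (horner 0 bs') else int (horner 0 bs')) \<le> 9 * Suc (length w) + 1"
    using snoc.IH[OF eq] by (intro order_trans[OF sz_signed_horner]) simp
  then show ?case
    using snoc.prems snoc.IH[OF eq] small_ints_Suc small_ints_Cons[of "length w" ts'] small_ints_def[of _ "[]"]
    by (cases a) (auto simp: eq parse_step_simp)
qed

lemma pt_parse [pt_intros]:
  assumes "pt f" shows "pt (\<lambda>x. parse (f x))"
proof -
  let ?b = "\<lambda>n. n * (2 * (9 * n + 1) + 1)"
  have "pt (\<lambda>x. foldl parse_step ([], False, [], [], []) (f x))"
  proof (rule pt_foldl[where B = "\<lambda>x. 2 * (sz (f x) * 3) + 1 + (3 + (2 * ?b (sz (f x)) + 1 +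
      (2 * ?b (sz (f x)) + 1 + sz (f x) * (2 * ?b (sz (f x)) + 1))))"])
    show "pt (\<lambda>p. parse_step (fst (snd p)) (snd (snd p)))"
      unfolding parse_step_def by (intro pt_intros)
    fix x ys zs assume f: "f x = ys @ zs"
    let ?n = "sz (f x)"
    have n: "length ys \<le> ?n" using length_le_sz[of "f x"] f by simp
    have small: "sz ts \<le> ?b ?n" if "small_ints (length ys) ts" for ts
    proof -
      have "sz ts \<le> length ts * (2 * (9 * ?n + 1) + 1)"
        using that n by (intro sz_list_le) (fastforce simp: small_ints_def)
      also have "\<dots> \<le> ?b ?n" using that n by (intro mult_le_mono1) (auto simp: small_ints_def)
      finally show ?thesis .
    qed
    obtain bs neg ts hdr gs where eq: "foldl parse_step ([], False, [], [], []) ys = (bs, neg, ts, hdr, gs)"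
      by (metis prod_cases5)
    note sm = parse_step_small[OF eq]
    have "sz gs \<le> length gs * (2 * ?b ?n + 1)"
      using sm small by (intro sz_list_le) blast
    also have "\<dots> \<le> ?n * (2 * ?b ?n + 1)" using sm n by (intro mult_le_mono1) simp
    finally have "sz gs \<le> ?n * (2 * ?b ?n + 1)" .
    moreover have "sz bs \<le> length bs * (2 * 1 + 1)" by (rule sz_list_le) (rule sz_bool_le)
    then have "sz bs \<le> ?n * 3" using sm n by simp
    moreover have "sz ts \<le> ?b ?n" "sz hdr \<le> ?b ?n" using sm small by blast+
    ultimately show "sz (foldl parse_step ([], False, [], [], []) ys) \<le> 2 * (?n * 3) + 1 +
       (3 + (2 * ?b ?n + 1 + (2 * ?b ?n + 1 + ?n * (2 * ?b ?n + 1))))"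
      unfolding eq sz_Pair using sz_bool_le[of neg] by linarith
  qed (intro pt_intros pbounded_intros assms)+
  then show ?thesis unfolding parse_def con_data_of_def piece_of_ints_def by (intro pt_intros)
qed

section \<open>Correctness of the parser\<close>

definition con_data :: "con_instance \<Rightarrow> con_data" where
  "con_data X = (num_agents X, con_parts X, con_interval X, con_agents X)"

lemma horner_snoc: "horner v (bs @ [b]) = (if b then Suc (2 * horner v bs) else 2 * horner v bs)"
  by (simp add: horner_def)

lemma horner_binary: "horner 0 (rev (map (\<lambda>d. d = Digit1) (binary n))) = n"
proof (induction n rule: less_induct)
  case (less n)
  show ?case
  proof (cases "n = 0")
    case True
    then show ?thesis by (simp add: horner_def)
  next
    case False
    then have "horner 0 (rev (map (\<lambda>d. d = Digit1) (binary (n div 2)))) = n div 2"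
      by (intro less) simp
    then show ?thesis using False by (subst binary.simps) (simp add: horner_snoc)
  qed
qed

lemma binary_digits: "set (binary n) \<subseteq> {Digit0, Digit1}"
proof (induction n rule: less_induct)
  case (less n)
  then have "n \<noteq> 0 \<Longrightarrow> set (binary (n div 2)) \<subseteq> {Digit0, Digit1}" by simp
  then show ?case by (subst binary.simps) simp
qed

lemma parse_digits:
  "set ds \<subseteq> {Digit0, Digit1} \<Longrightarrow> foldl parse_step (bs, neg, ts, hdr, gs) ds =
    (rev (map (\<lambda>d. d = Digit1) ds) @ bs, neg, ts, hdr, gs)"
  by (induction ds arbitrary: bs) (auto simp: parse_step_simp)

lemma parse_enc_nat:
  "foldl parse_step ([], neg, ts, hdr, gs) (enc_nat n) =
    ([], False, (if neg then - int n else int n) # ts, hdr, gs)"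
  using parse_digits[OF binary_digits, of "[]" neg ts hdr gs n] horner_binary[of n]
  by (simp add: enc_nat_def) (simp add: parse_step_simp)

lemma parse_enc_int:
  "foldl parse_step ([], False, ts, hdr, gs) (enc_int z) = ([], False, z # ts, hdr, gs)"
proof -
  have "parse_step ([], False, ts, hdr, gs) Minus = ([], True, ts, hdr, gs)"
    by (simp add: parse_step_simp)
  then show ?thesis by (simp add: enc_int_def parse_enc_nat)
qed

lemma parse_enc_frac:
  "foldl parse_step ([], False, ts, hdr, gs) (enc_frac r) = ([], False, int (snd r) # fst r # ts, hdr, gs)"
  by (simp add: enc_frac_def enc_prod_def case_prod_unfold parse_enc_int parse_enc_nat)

abbreviation enc_piece :: "piece encoding" where
  "enc_piece \<equiv> enc_prod enc_frac (enc_prod enc_frac enc_frac)"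

definition ints_of_piece :: "piece \<Rightarrow> int list" where
  "ints_of_piece = (\<lambda>(l, r, h). [fst l, int (snd l), fst r, int (snd r), fst h, int (snd h)])"

lemma parse_enc_piece:
  "foldl parse_step ([], False, ts, hdr, gs) (enc_piece P) = ([], False, rev (ints_of_piece P) @ ts, hdr, gs)"
  by (cases P) (simp add: enc_prod_def parse_enc_frac ints_of_piece_def)

lemma parse_enc_pieces:
  "foldl parse_step ([], False, ts, hdr, gs) (concat (map enc_piece Ps)) =
    ([], False, rev (concat (map ints_of_piece Ps)) @ ts, hdr, gs)"
  by (induction Ps arbitrary: ts) (simp_all add: parse_enc_piece)

text \<open>An opening bracket takes the numbers before it as the header only while the header is
  still empty; hence the hypothesis for all brackets after the first.\<close>

lemma parse_Open: "hdr \<noteq> [] \<Longrightarrow> parse_step ([], False, ts, hdr, gs) Open = ([], False, [], hdr, gs)"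
  and parse_Close: "parse_step ([], False, ts, hdr, gs) Close = ([], False, [], hdr, ts # gs)"
  by (simp_all add: parse_step_def)

lemma parse_enc_agents:
  "hdr \<noteq> [] \<Longrightarrow> foldl parse_step ([], False, [], hdr, gs) (concat (map (enc_list enc_piece) As)) =
    ([], False, [], hdr, rev (map (\<lambda>Ps. rev (concat (map ints_of_piece Ps))) As) @ gs)"
  by (induction As arbitrary: gs) (simp_all add: enc_list_def parse_Open parse_Close parse_enc_pieces)

lemma piece_of_ints_of_piece: "piece_of_ints (ints_of_piece P @ ts) = P"
  by (cases P) (auto simp: piece_of_ints_def ints_of_piece_def)

lemma pieces_of_ints: "pieces_of_ints (concat (map ints_of_piece Ps)) = Ps"
proof -
  have "snd ((piece_step ^^ n) (concat (map ints_of_piece Ps), acc)) = rev Ps @ acc" if "length Ps \<le> n" for n acc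
    using that
  proof (induction Ps arbitrary: n acc)
    case Nil
    have "piece_step ([], acc) = ([], acc)" by (simp add: piece_step_def)
    then have "(piece_step ^^ n) ([], acc) = ([], acc)" by (induction n) auto
    then show ?case by simp
  next
    case (Cons P Ps)
    then obtain m where n: "n = Suc m" "length Ps \<le> m" by (cases n) auto
    have "piece_step (ints_of_piece P @ ts, acc) = (ts, P # acc)" for ts
      using piece_of_ints_of_piece[of P ts] by (cases P) (simp add: piece_step_def ints_of_piece_def)
    then show ?case using Cons.IH[OF n(2)] by (simp add: n funpow_Suc_right del: funpow.simps(2))
  qed
  moreover have "length Ps \<le> length (concat (map ints_of_piece Ps))"
    by (induction Ps) (auto simp: ints_of_piece_def case_prod_unfold)
  ultimately show ?thesis by (simp add: pieces_of_ints_def)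
qed

lemma parse_enc_con_instance: "parse (enc_con_instance X) = con_data X"
proof -
  obtain a b where ab: "con_interval X = (a, b)" by (cases "con_interval X")
  let ?hdr = "rev [int (num_agents X), int (con_parts X), fst a, int (snd a), fst b, int (snd b)]"
  have 1: "foldl parse_step ([], False, [], [], []) (enc_nat (num_agents X) @ enc_nat (con_parts X) @
      enc_prod enc_frac enc_frac (con_interval X)) = ([], False, ?hdr, [], [])"
    by (simp add: parse_enc_nat enc_prod_def ab parse_enc_frac)
  have 2: "foldl parse_step ([], False, ?hdr, [], []) (enc_list (enc_list enc_piece) (con_agents X)) =
      ([], False, [], ?hdr, [] # rev (map (\<lambda>Ps. rev (concat (map ints_of_piece Ps))) (con_agents X)))"
  proof -
    have "parse_step ([], False, ?hdr, [], []) Open = ([], False, [], ?hdr, [])"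
      by (simp add: parse_step_simp)
    then show ?thesis
      unfolding enc_list_def[of "enc_list enc_piece"]
      using parse_enc_agents[of ?hdr "[]" "con_agents X"] by (simp add: parse_Close)
  qed
  have "foldl parse_step ([], False, [], [], []) (enc_con_instance X) =
      ([], False, [], ?hdr, [] # rev (map (\<lambda>Ps. rev (concat (map ints_of_piece Ps))) (con_agents X)))"
    using 1 2 by (simp add: enc_con_instance_def)
  then show ?thesis
    by (simp add: parse_def con_data_of_def Let_def con_data_def ab piece_of_ints_def pieces_of_ints
        map_idI rev_map comp_def)
qed

section \<open>Writing encodings, and cutting an instance off a string\<close>

lemma pt_enc_nat [pt_intros]: "pt f \<Longrightarrow> pt (\<lambda>x. enc_nat (f x))"
  unfolding enc_nat_def by (intro pt_intros)

lemma pt_enc_int [pt_intros]: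
  assumes "pt f" shows "pt (\<lambda>x. enc_int (f x))"
proof -
  have "pt (\<lambda>x. if f x < int 0 then Minus # enc_nat (nat (- f x)) else enc_nat (nat (f x)))"
    by (intro pt_intros assms)
  then show ?thesis by (simp add: enc_int_def)
qed

lemma pt_enc_frac [pt_intros]: "pt f \<Longrightarrow> pt (\<lambda>x. enc_frac (f x))"
  unfolding enc_frac_def enc_prod_def by (intro pt_intros)

text \<open>The state records whether a bracket has been opened, the depth, and the letters that follow
  the outermost closing bracket.\<close>

definition skip_step :: "bool \<times> nat \<times> letter list \<Rightarrow> letter \<Rightarrow> bool \<times> nat \<times> letter list" where
  "skip_step s a = (case s of (opened, d, acc) \<Rightarrow>
     if opened \<and> d = 0 then (opened, d, a # acc)
     else if a = Open then (True, Suc d, acc)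
     else if a = Close then (opened, d - 1, acc)
     else (opened, d, acc))"

lemma skip_step_simp: "skip_step (opened, d, acc) a =
     (if opened \<and> d = 0 then (opened, d, a # acc)
     else if a = Open then (True, Suc d, acc)
     else if a = Close then (opened, d - 1, acc)
     else (opened, d, acc))"
  by (simp add: skip_step_def)

text \<open>The solution map of the reduction is \<open>snd\<close>. On strings it must delete the
  encoded instance, whose end is where its only outermost bracket closes.\<close>

definition skip_instance :: "letter list \<Rightarrow> letter list" where
  "skip_instance w = rev (snd (snd (foldl skip_step (False, 0, []) w)))"

lemma pt_skip_instance: "pt skip_instance"
proof -
  have bound: "fst (snd (foldl skip_step (False, 0, []) w)) \<le> length w \<and>
    sz (snd (snd (foldl skip_step (False, 0, []) w))) \<le> 3 * length w" for w
  proof (induction w rule: rev_induct)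
    case (snoc a w)
    have "sz a = 1" by (simp add: sz_def code_letter_def)
    then show ?case using snoc
      by (cases "foldl skip_step (False, 0, []) w") (auto simp: skip_step_simp)
  qed simp
  have "pt (\<lambda>w. foldl skip_step (False, 0, []) w)"
  proof (rule pt_foldl[where B = "\<lambda>w. 3 + (2 * (3 * sz w) + 1 + 3 * sz w)"])
    fix x ys zs :: "letter list" assume "x = ys @ zs"
    then have n: "length ys \<le> sz x" using length_le_sz[of x] by simp
    obtain b d acc where eq: "foldl skip_step (False, 0, []) ys = (b, d, acc)" by (metis prod_cases3)
    have "sz d \<le> 3 * sz x" "sz acc \<le> 3 * sz x"
      using bound[of ys] n sz_nat_le[of d] by (simp_all add: eq)
    then show "sz (foldl skip_step (False, 0, []) ys) \<le> 3 + (2 * (3 * sz x) + 1 + 3 * sz x)"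
      unfolding eq sz_Pair using sz_bool_le[of b] by linarith
  next
    show "pt (\<lambda>p. skip_step (fst (snd p)) (snd (snd p)))"
      unfolding skip_step_def by (intro pt_intros)
  qed (intro pt_intros pbounded_intros)+
  then show ?thesis unfolding skip_instance_def by (intro pt_intros)
qed

lemma skip_plain:
  assumes "set w \<inter> {Open, Close} = {}" "opened \<longrightarrow> d \<noteq> 0"
  shows "foldl skip_step (opened, d, acc) w = (opened, d, acc)"
  using assms by (induction w) (auto simp: skip_step_simp)

lemma enc_nat_plain: "set (enc_nat n) \<inter> {Open, Close} = {}"
  using binary_digits[of n] by (auto simp: enc_nat_def)

lemma enc_int_plain: "set (enc_int z) \<inter> {Open, Close} = {}"
  using enc_nat_plain by (auto simp: enc_int_def)

lemma enc_frac_plain: "set (enc_frac r) \<inter> {Open, Close} = {}"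
  using enc_nat_plain enc_int_plain by (fastforce simp: enc_frac_def enc_prod_def case_prod_unfold)

lemma skip_enc_con_instance: "skip_instance (enc_con_instance X @ v) = v"
proof -
  have piece: "set (enc_piece P) \<inter> {Open, Close} = {}" for P
    using enc_frac_plain[of "fst P"] enc_frac_plain[of "fst (snd P)"] enc_frac_plain[of "snd (snd P)"]
    by (auto simp: enc_prod_def case_prod_unfold)
  have pieces: "set (concat (map enc_piece Ps)) \<inter> {Open, Close} = {}" for Ps
    using piece by (induction Ps) auto
  have agent: "foldl skip_step (True, Suc 0, acc) (enc_list enc_piece Ps) = (True, Suc 0, acc)" for Ps acc
    using skip_plain[OF pieces, of True 2 acc Ps]
    by (simp add: enc_list_def) (simp add: skip_step_simp numeral_2_eq_2)
  have agents: "foldl skip_step (True, Suc 0, acc) (concat (map (enc_list enc_piece) As)) = (True, Suc 0, acc)" for As acc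
    by (induction As) (simp_all add: agent)
  have "set (enc_nat (num_agents X) @ enc_nat (con_parts X) @ enc_prod enc_frac enc_frac (con_interval X)) \<inter>
      {Open, Close} = {}"
    using enc_frac_plain[of "fst (con_interval X)"] enc_frac_plain[of "snd (con_interval X)"]
      enc_nat_plain[of "num_agents X"] enc_nat_plain[of "con_parts X"]
    by (auto simp: enc_prod_def case_prod_unfold)
  from skip_plain[OF this, of False 0 "[]"]
  have "foldl skip_step (False, 0, []) (enc_con_instance X) = (True, 0, [])"
    using agents[of "[]" "con_agents X"]
    by (simp add: enc_con_instance_def enc_list_def[of "enc_list enc_piece"]) (simp add: skip_step_simp)
  moreover have "foldl skip_step (True, 0, acc) v = (True, 0, rev v @ acc)" for acc
    by (induction v arbitrary: acc) (auto simp: skip_step_simp)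
  ultimately show ?thesis by (simp add: skip_instance_def)
qed

section \<open>The reduction\<close>

text \<open>Nested loops over the input, \<open>d\<close> of them. The exponent is a constant of the
  machine, so the recursion builds one program for each \<open>d\<close>.\<close>

fun unary_power :: "nat \<Rightarrow> letter list \<Rightarrow> unit list" where
  "unary_power 0 w = [()]"
| "unary_power (Suc d) w = concat (map (\<lambda>_. unary_power d w) w)"

lemma length_unary_power: "length (unary_power d w) = length w ^ d"
  by (induction d) (simp_all add: length_concat comp_def sum_list_triv)

lemma pt_unary_power: "pt (unary_power d)"
proof (induction d)
  case 0
  then show ?case by (simp add: pt_const)
next
  case (Suc d)
  have "pt (\<lambda>w. concat (map (\<lambda>_. unary_power d w) w))"
    by (intro pt_intros pt_comp[OF Suc])
  then show ?case by simp
qed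

text \<open>The bead number \<open>N = C * m ^ d\<close>, for inputs of length \<open>m\<close>, is
  produced in unary because it has to drive loops.\<close>

definition unary :: "nat \<Rightarrow> nat \<Rightarrow> letter list \<Rightarrow> unit list" where
  "unary C d w = concat (map (\<lambda>_. replicate C ()) (unary_power d w))"

lemma length_unary: "length (unary C d w) = C * length w ^ d"
  by (simp add: unary_def length_concat comp_def sum_list_triv length_unary_power)

lemma pt_unary [pt_intros]: "pt f \<Longrightarrow> pt (\<lambda>x. unary C d (f x))"
  unfolding unary_def by (intro pt_intros pt_comp[OF pt_unary_power])

text \<open>
  The point \<open>l + j / (h N)\<close>, with denominator 0 if \<open>h = 0\<close>; such a fraction never passes the test
  in \<open>ideal_points\<close>.
\<close>

definition ideal_point :: "nat \<Rightarrow> piece \<Rightarrow> nat \<Rightarrow> frac" where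
  "ideal_point N P j = (case P of (l, r, h) \<Rightarrow>
     (fst l * int (nat (fst h) * N) + int (j * snd h * snd l), snd l * nat (fst h) * N))"

lemma pt_ideal_point [pt_intros]:
  assumes "pt N" "pt P" "pt j"
  shows "pt (\<lambda>x. ideal_point (N x) (P x) (j x))"
  unfolding ideal_point_def by (intro pt_intros pt_comp[OF assms(1)] pt_comp[OF assms(2)] pt_comp[OF assms(3)])

definition frac_less :: "frac \<Rightarrow> frac \<Rightarrow> bool" where
  "frac_less x y \<longleftrightarrow> fst x * int (snd y) < fst y * int (snd x)"

lemma pt_frac_less [pt_intros]: "pt f \<Longrightarrow> pt g \<Longrightarrow> pt (\<lambda>x. frac_less (f x) (g x))"
  unfolding frac_less_def by (intro pt_intros)

text \<open>The inner \<open>concat\<close> is merely a list of length \<open>N * N\<close>: with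
  volumes at most \<open>N\<close>, a piece contains at most that many multiples of
  \<open>1 / N\<close>. Points at the right end of the piece are dropped, so that a shifted bead
  still finds room inside the interval.\<close>

definition ideal_points :: "unit list \<Rightarrow> piece \<Rightarrow> frac list" where
  "ideal_points u P = filter (\<lambda>x. frac_less x (fst (snd P)))
     (map (\<lambda>j. ideal_point (length u) P (Suc j)) [0..<length (concat (map (\<lambda>_. u) u))])"

lemma pt_ideal_points [pt_intros]:
  assumes "pt u" "pt P"
  shows "pt (\<lambda>x. ideal_points (u x) (P x))"
  unfolding ideal_points_def by (intro pt_intros pt_comp[OF assms(1)] pt_comp[OF assms(2)])

text \<open>The copies are made by a loop over the input with the test \<open>s < k\<close>, since
  \<open>k\<close> is given in binary; this yields exactly \<open>k\<close> copies because
  \<open>k\<close> does not exceed the length of the input.\<close>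

definition raw_beads :: "unit list \<Rightarrow> letter list \<Rightarrow> con_data \<Rightarrow> (frac \<times> nat) list" where
  "raw_beads u w X = (case X of (n, k, ab, As) \<Rightarrow>
     concat (map (\<lambda>(i, Ps). concat (map (\<lambda>x. concat (map (\<lambda>s. if s < k then [(x, i)] else []) [0..<length w]))
       (fst ab # concat (map (ideal_points u) Ps)))) (List.enumerate 0 As)))"

lemma pt_raw_beads [pt_intros]:
  assumes "pt u" "pt w" "pt X"
  shows "pt (\<lambda>x. raw_beads (u x) (w x) (X x))"
  unfolding raw_beads_def by (intro pt_intros pt_comp[OF assms(1)] pt_comp[OF assms(2)] pt_comp[OF assms(3)])

text \<open>
  \<open>Q\<close> bounds the denominators of the endpoints and of the unshifted beads, so that different
  points have distance at least \<open>1 / Q\<^sup>2\<close>; all shifts by \<open>(s + 1) / resolution\<close> are at most that.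
\<close>

definition resolution :: "unit list \<Rightarrow> letter list \<Rightarrow> (frac \<times> nat) list \<Rightarrow> nat" where
  "resolution u w xs = (let Q = 2 ^ length w * 2 ^ length w * length u in 2 ^ length xs * Q * Q)"

lemma pt_resolution [pt_intros]:
  assumes "pt u" "pt w" "pt xs"
  shows "pt (\<lambda>x. resolution (u x) (w x) (xs x))"
  unfolding resolution_def by (intro pt_intros pt_comp[OF assms(1)] pt_comp[OF assms(2)] pt_comp[OF assms(3)])

text \<open>The index runs through the beads of all colours together, so positions become distinct
  across colours as well.\<close>

definition spread :: "nat \<Rightarrow> (frac \<times> nat) list \<Rightarrow> (frac \<times> nat) list" where
  "spread D xs = map (\<lambda>(s, x, i). ((fst x * int D + int (Suc s * snd x), snd x * D), i)) (List.enumerate 0 xs)"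

lemma pt_spread [pt_intros]:
  assumes "pt D" "pt xs"
  shows "pt (\<lambda>x. spread (D x) (xs x))"
  unfolding spread_def by (intro pt_intros pt_comp[OF assms(1)] pt_comp[OF assms(2)])

definition beads_of :: "nat \<Rightarrow> nat \<Rightarrow> letter list \<Rightarrow> con_data \<Rightarrow> (frac \<times> nat) list" where
  "beads_of C d w X =
     (let u = unary C d w; xs = raw_beads u w X in spread (resolution u w xs) xs)"

lemma pt_beads_of [pt_intros]:
  assumes "pt w" "pt X"
  shows "pt (\<lambda>x. beads_of C d (w x) (X x))"
  unfolding beads_of_def by (intro pt_intros pt_comp[OF assms(1)] pt_comp[OF assms(2)])

definition neck_of :: "nat \<Rightarrow> nat \<Rightarrow> con_instance \<Rightarrow> neck_instance" where
  "neck_of C d X =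
     \<lparr>neck_colours = num_agents X, neck_parts = con_parts X, neck_interval = con_interval X,
      neck_beads = beads_of C d (enc_con_instance X) (con_data X)\<rparr>"

definition neck_string :: "nat \<Rightarrow> nat \<Rightarrow> letter list \<Rightarrow> letter list" where
  "neck_string C d w = (case parse w of (n, k, ab, As) \<Rightarrow>
     enc_nat n @ enc_nat k @ enc_frac (fst ab) @ enc_frac (snd ab) @
     Open # concat (map (\<lambda>b. enc_frac (fst b) @ enc_nat (snd b)) (beads_of C d w (n, k, ab, As))) @ [Close])"

lemma pt_neck_string: "pt (neck_string C d)"
  unfolding neck_string_def by (intro pt_intros)

lemma neck_string_enc: "neck_string C d (enc_con_instance X) = enc_neck_instance (neck_of C d X)"
  by (simp add: neck_string_def parse_enc_con_instance con_data_def neck_of_def enc_neck_instance_def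
      enc_prod_def enc_list_def case_prod_unfold)

section \<open>Masses and numbers of beads in the parts of a division\<close>

text \<open>The distribution function of a single piece.\<close>

definition piece_mass :: "piece \<Rightarrow> real \<Rightarrow> real" where
  "piece_mass P t = piece_height P * max 0 (min (piece_right P) t - piece_left P)"

definition agent_mass :: "piece list \<Rightarrow> real \<Rightarrow> real" where
  "agent_mass Ps t = (\<Sum>P\<leftarrow>Ps. piece_mass P t)"

lemma step_density_Cons:
  "step_density (P # Ps) x =
    piece_height P * indicator {piece_left P<..piece_right P} x + step_density Ps x"
  by (simp add: step_density_def)

lemma step_density_nonneg: "(\<And>P. P \<in> set Ps \<Longrightarrow> 0 \<le> piece_height P) \<Longrightarrow> 0 \<le> step_density Ps x"
  by (induction Ps) (auto simp: step_density_Cons step_density_def[of "[]"])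

lemma step_density_measurable [measurable]: "step_density Ps \<in> borel_measurable borel"
proof (induction Ps)
  case Nil
  then show ?case by (simp add: step_density_def)
next
  case (Cons P Ps)
  note [measurable] = this
  show ?case unfolding step_density_Cons[abs_def] by measurable
qed

lemma emeasure_value_measure:
  assumes [measurable]: "S \<in> sets borel" and "\<And>P. P \<in> set Ps \<Longrightarrow> 0 \<le> piece_height P"
  shows "emeasure (value_measure Ps) S =
    (\<Sum>P\<leftarrow>Ps. ennreal (piece_height P) * emeasure lborel ({piece_left P<..piece_right P} \<inter> S))"
proof -
  have "emeasure (value_measure Ps) S = (\<integral>\<^sup>+x. ennreal (step_density Ps x) * indicator S x \<partial>lborel)"
    unfolding value_measure_def by (subst emeasure_density) auto
  also have "\<dots> = (\<Sum>P\<leftarrow>Ps. ennreal (piece_height P) * emeasure lborel ({piece_left P<..piece_right P} \<inter> S))"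
    using assms(2)
  proof (induction Ps)
    case Nil
    then show ?case by (simp add: step_density_def)
  next
    case (Cons P Ps)
    let ?I = "{piece_left P<..piece_right P}"
    have eq: "ennreal (step_density (P # Ps) x) * indicator S x =
        ennreal (piece_height P) * indicator (?I \<inter> S) x + ennreal (step_density Ps x) * indicator S x" for x
      using Cons.prems step_density_nonneg[of Ps x]
      by (auto simp: step_density_Cons ennreal_plus indicator_def distrib_right)
    have "(\<integral>\<^sup>+x. ennreal (step_density (P # Ps) x) * indicator S x \<partial>lborel) =
      (\<integral>\<^sup>+x. ennreal (piece_height P) * indicator (?I \<inter> S) x \<partial>lborel) +
      (\<integral>\<^sup>+x. ennreal (step_density Ps x) * indicator S x \<partial>lborel)"
      unfolding eq by (rule nn_integral_add) auto
    also have "(\<integral>\<^sup>+x. ennreal (piece_height P) * indicator (?I \<inter> S) x \<partial>lborel) =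
      ennreal (piece_height P) * emeasure lborel (?I \<inter> S)"
      by (rule nn_integral_cmult_indicator) auto
    finally show ?case using Cons by simp
  qed
  finally show ?thesis .
qed

lemma emeasure_value_measure_Ioc:
  assumes "\<And>P. P \<in> set Ps \<Longrightarrow> 0 \<le> piece_height P" "u \<le> v"
  shows "emeasure (value_measure Ps) {u<..v} = ennreal (agent_mass Ps v - agent_mass Ps u)"
    and "agent_mass Ps u \<le> agent_mass Ps v"
proof -
  have le: "piece_mass P u \<le> piece_mass P v" if "P \<in> set Ps" for P
    using assms that unfolding piece_mass_def by (intro mult_left_mono) auto
  then show "agent_mass Ps u \<le> agent_mass Ps v"
    unfolding agent_mass_def by (intro sum_list_mono)
  have "ennreal (piece_height P) * emeasure lborel ({piece_left P<..piece_right P} \<inter> {u<..v}) =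
      ennreal (piece_mass P v - piece_mass P u)" if "P \<in> set Ps" for P
  proof -
    have "{piece_left P<..piece_right P} \<inter> {u<..v} = {max (piece_left P) u<..min (piece_right P) v}"
      by auto
    moreover have "emeasure lborel {x<..y} = ennreal (max 0 (y - x))" for x y :: real
      by (cases "x \<le> y") (auto simp: max_def)
    moreover have "piece_height P * max 0 (min (piece_right P) v - max (piece_left P) u) =
        piece_mass P v - piece_mass P u"
    proof -
      have "max 0 (min (piece_right P) v - max (piece_left P) u) =
        max 0 (min (piece_right P) v - piece_left P) - max 0 (min (piece_right P) u - piece_left P)"
        using assms(2) by (auto simp: max_def min_def)
      then show ?thesis by (simp add: piece_mass_def right_diff_distrib)
    qed
    ultimately show ?thesis
      using assms(1)[OF that] by (simp flip: ennreal_mult')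
  qed
  then have "emeasure (value_measure Ps) {u<..v} = (\<Sum>P\<leftarrow>Ps. ennreal (piece_mass P v - piece_mass P u))"
    using assms by (subst emeasure_value_measure) (auto intro!: arg_cong[of _ _ sum_list])
  also have "\<dots> = ennreal (agent_mass Ps v - agent_mass Ps u)"
    using le
  proof (induction Ps)
    case (Cons P Ps)
    have "agent_mass Ps u \<le> agent_mass Ps v"
      unfolding agent_mass_def using Cons.prems by (intro sum_list_mono) auto
    then show ?case
      using Cons by (simp add: agent_mass_def add_diff_add flip: ennreal_plus)
  qed (simp add: agent_mass_def)
  finally show "emeasure (value_measure Ps) {u<..v} = ennreal (agent_mass Ps v - agent_mass Ps u)" .
qed

section \<open>Mass and beads of a part as sums over subintervals\<close>

definition lower_end :: "frac \<times> frac \<Rightarrow> division \<Rightarrow> nat \<Rightarrow> real" where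
  "lower_end ab D j = (if j = 0 then frac_val (fst ab) else frac_val (cuts D ! (j - 1)))"

definition upper_end :: "frac \<times> frac \<Rightarrow> division \<Rightarrow> nat \<Rightarrow> real" where
  "upper_end ab D j = (if j < length (cuts D) then frac_val (cuts D ! j) else frac_val (snd ab))"

definition part_indices :: "division \<Rightarrow> nat \<Rightarrow> nat set" where
  "part_indices D t = {j. j < length (labels D) \<and> labels D ! j = t}"

context
  fixes ab k c D
  assumes ab: "proper_interval ab" and D: "is_division ab k c D"
begin

lemma cut_bounds:
  "j < c \<Longrightarrow> frac_val (fst ab) \<le> frac_val (cuts D ! j) \<and> frac_val (cuts D ! j) \<le> frac_val (snd ab)"
  using D nth_mem[of j "cuts D"] unfolding is_division_def interval_of_def by fastforce

lemma cut_mono: "i \<le> j \<Longrightarrow> j < c \<Longrightarrow> frac_val (cuts D ! i) \<le> frac_val (cuts D ! j)"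
  using D sorted_nth_mono[of "map frac_val (cuts D)" i j] unfolding is_division_def by simp

lemma length_cuts: "length (cuts D) = c" and length_labels: "length (labels D) = Suc c"
  using D by (auto simp: is_division_def)

lemma ends_bounds:
  assumes "j \<le> c"
  shows "frac_val (fst ab) \<le> lower_end ab D j" "lower_end ab D j \<le> upper_end ab D j"
    "upper_end ab D j \<le> frac_val (snd ab)"
  using cut_bounds[of j] cut_bounds[of "j - 1"] cut_mono[of "j - 1" j] ab assms
  by (auto simp: lower_end_def upper_end_def length_cuts proper_interval_def)

lemma upper_le_lower: "i < j \<Longrightarrow> j \<le> c \<Longrightarrow> upper_end ab D i \<le> lower_end ab D j"
  using cut_mono[of i "j - 1"] by (auto simp: lower_end_def upper_end_def length_cuts)

text \<open>Only the first subinterval contains its left end. Without that point all subintervals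
  are half-open and differences of values at the two ends describe them exactly; the pieces, being
  open on the left, and the beads, shifted to the right, avoid the point.\<close>

lemma subinterval_Ioc:
  assumes "j \<le> c"
  shows "subinterval ab D j \<inter> {frac_val (fst ab)<..} = {lower_end ab D j<..upper_end ab D j}"
proof -
  have "0 < j \<Longrightarrow> frac_val (fst ab) \<le> frac_val (cuts D ! (j - Suc 0))"
    using cut_bounds[of "j - Suc 0"] assms by simp
  then show ?thesis
    using cut_bounds[of j] assms
    by (auto simp: subinterval_def lower_end_def upper_end_def length_cuts interval_of_def)
qed

lemma part_Ioc:
  "part ab D t \<inter> {frac_val (fst ab)<..} =
    (\<Union>j\<in>part_indices D t. {lower_end ab D j<..upper_end ab D j})"
proof -
  have "part ab D t \<inter> {frac_val (fst ab)<..} =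
      (\<Union>j\<in>part_indices D t. subinterval ab D j \<inter> {frac_val (fst ab)<..})"
    by (auto simp: part_def part_indices_def)
  also have "\<dots> = (\<Union>j\<in>part_indices D t. {lower_end ab D j<..upper_end ab D j})"
    using subinterval_Ioc by (intro SUP_cong) (auto simp: part_indices_def length_labels)
  finally show ?thesis .
qed

lemma finite_part_indices: "finite (part_indices D t)"
  and card_part_indices: "card (part_indices D t) \<le> Suc c"
  and part_indices_le: "j \<in> part_indices D t \<Longrightarrow> j \<le> c"
proof -
  have "part_indices D t \<subseteq> {..c}" by (auto simp: part_indices_def length_labels)
  then show "finite (part_indices D t)" "card (part_indices D t) \<le> Suc c"
    "j \<in> part_indices D t \<Longrightarrow> j \<le> c"
    using finite_subset card_mono[of "{..c}"] by auto
qed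

lemma disjoint_Ioc:
  "i \<le> c \<Longrightarrow> j \<le> c \<Longrightarrow> i \<noteq> j \<Longrightarrow>
    {lower_end ab D i<..upper_end ab D i} \<inter> {lower_end ab D j<..upper_end ab D j} = {}"
  using upper_le_lower[of i j] upper_le_lower[of j i] by (cases "i < j") auto

lemma measure_part:
  assumes Ps: "list_all (proper_piece ab) Ps"
  shows "measure (value_measure Ps) (part ab D t) =
    (\<Sum>j\<in>part_indices D t. agent_mass Ps (upper_end ab D j) - agent_mass Ps (lower_end ab D j))"
proof -
  let ?a = "frac_val (fst ab)" and ?J = "part_indices D t"
  let ?I = "\<lambda>j. {lower_end ab D j<..upper_end ab D j}"
  have nonneg: "0 \<le> piece_height P" and left: "?a \<le> piece_left P" if "P \<in> set Ps" for P
    using Ps that by (auto simp: list_all_iff proper_piece_def interval_of_def)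
  have [measurable]: "part ab D t \<in> sets borel"
    unfolding part_def subinterval_def interval_of_def by measurable
  \<comment> \<open>Every piece is open on the left and starts no earlier than the interval, so the
    left end carries no mass.\<close>
  have "emeasure (value_measure Ps) (part ab D t) =
      emeasure (value_measure Ps) (part ab D t \<inter> {?a<..})"
  proof -
    have "{piece_left P<..piece_right P} \<inter> part ab D t =
        {piece_left P<..piece_right P} \<inter> (part ab D t \<inter> {?a<..})" if "P \<in> set Ps" for P
      using left[OF that] by auto
    then show ?thesis
      using nonneg by (subst (1 2) emeasure_value_measure) (auto intro!: arg_cong[of _ _ sum_list])
  qed
  also have "\<dots> = (\<Sum>j\<in>?J. emeasure (value_measure Ps) (?I j))"
    unfolding part_Ioc
  proof (rule sum_emeasure[symmetric])
    show "disjoint_family_on ?I ?J"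
      unfolding disjoint_family_on_def using disjoint_Ioc part_indices_le by blast
  qed (auto simp: value_measure_def finite_part_indices)
  also have "\<dots> = (\<Sum>j\<in>?J. ennreal (agent_mass Ps (upper_end ab D j) - agent_mass Ps (lower_end ab D j)))"
    using emeasure_value_measure_Ioc(1)[OF nonneg] ends_bounds(2) part_indices_le by (intro sum.cong) auto
  also have "\<dots> = ennreal (\<Sum>j\<in>?J. agent_mass Ps (upper_end ab D j) - agent_mass Ps (lower_end ab D j))"
    using emeasure_value_measure_Ioc(2)[OF nonneg] ends_bounds(2) part_indices_le by (intro sum_ennreal) auto
  finally show ?thesis
    using emeasure_value_measure_Ioc(2)[OF nonneg] ends_bounds(2) part_indices_le
    by (simp add: measure_def sum_nonneg)
qed

lemma card_part:
  fixes pos :: "'i \<Rightarrow> real"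
  assumes "finite S" "\<And>s. s \<in> S \<Longrightarrow> frac_val (fst ab) < pos s"
  shows "real (card {s \<in> S. pos s \<in> part ab D t}) =
    (\<Sum>j\<in>part_indices D t. real (card {s \<in> S. pos s \<le> upper_end ab D j}) -
       real (card {s \<in> S. pos s \<le> lower_end ab D j}))"
proof -
  let ?B = "\<lambda>x. real (card {s \<in> S. pos s \<le> x})"
  let ?J = "part_indices D t"
  let ?I = "\<lambda>j. {s \<in> S. pos s \<in> {lower_end ab D j<..upper_end ab D j}}"
  have un: "{s \<in> S. pos s \<in> part ab D t} = (\<Union>j\<in>?J. ?I j)"
    using part_Ioc[of t] assms(2) by blast
  have card_un: "card (\<Union>j\<in>?J. ?I j) = (\<Sum>j\<in>?J. card (?I j))"
  proof (rule card_UN_disjoint)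
    show "\<forall>i\<in>?J. \<forall>j\<in>?J. i \<noteq> j \<longrightarrow> ?I i \<inter> ?I j = {}"
      using disjoint_Ioc part_indices_le by blast
  qed (use assms(1) finite_part_indices in auto)
  have I: "real (card (?I j)) = ?B (upper_end ab D j) - ?B (lower_end ab D j)" if "j \<in> ?J" for j
  proof -
    have le: "lower_end ab D j \<le> upper_end ab D j" using ends_bounds(2)[OF part_indices_le[OF that]] .
    have "?I j = {s \<in> S. pos s \<le> upper_end ab D j} - {s \<in> S. pos s \<le> lower_end ab D j}" by auto
    moreover have "{s \<in> S. pos s \<le> lower_end ab D j} \<subseteq> {s \<in> S. pos s \<le> upper_end ab D j}"
      using le by auto
    ultimately show ?thesis
      using assms(1)
      by (simp add: card_Diff_subset of_nat_diff card_mono)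
  qed
  show ?thesis
    unfolding un card_un of_nat_sum by (intro sum.cong refl I)
qed

text \<open>\<open>K\<close> is the number of beads per unit of mass. A subinterval contributes the
  difference of the errors at its two ends, hence at most \<open>2 * E\<close>, and a part has at
  most \<open>c + 1\<close> subintervals.\<close>

lemma discrepancy:
  fixes pos :: "'i \<Rightarrow> real"
  assumes S: "finite S" "\<And>s. s \<in> S \<Longrightarrow> frac_val (fst ab) < pos s"
    and Ps: "list_all (proper_piece ab) Ps"
    and E: "\<And>x. x \<in> interval_of ab \<Longrightarrow> \<bar>real (card {s \<in> S. pos s \<le> x}) - K * agent_mass Ps x\<bar> \<le> E"
  shows "\<bar>real (card {s \<in> S. pos s \<in> part ab D t}) - K * measure (value_measure Ps) (part ab D t)\<bar>
    \<le> real (Suc c) * (2 * E)"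
proof -
  let ?J = "part_indices D t"
  let ?B = "\<lambda>x. real (card {s \<in> S. pos s \<le> x})"
  let ?d = "\<lambda>x. ?B x - K * agent_mass Ps x"
  have E': "\<bar>?d (lower_end ab D j)\<bar> \<le> E" "\<bar>?d (upper_end ab D j)\<bar> \<le> E" if "j \<in> ?J" for j
    using ends_bounds[OF part_indices_le[OF that]] by (intro E, simp add: interval_of_def)+
  have "frac_val (fst ab) \<in> interval_of ab" using ab by (simp add: interval_of_def proper_interval_def)
  from order_trans[OF abs_ge_zero E[OF this]] have "0 \<le> E" .
  have count: "real (card {s \<in> S. pos s \<in> part ab D t}) =
      (\<Sum>j\<in>?J. ?B (upper_end ab D j) - ?B (lower_end ab D j))"
    by (rule card_part[OF S(1)]) (rule S(2))
  have "\<bar>real (card {s \<in> S. pos s \<in> part ab D t}) - K * measure (value_measure Ps) (part ab D t)\<bar> =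
    \<bar>\<Sum>j\<in>?J. ?d (upper_end ab D j) - ?d (lower_end ab D j)\<bar>"
    unfolding count measure_part[OF Ps] sum_distrib_left sum_subtractf right_diff_distrib
    by (rule arg_cong[of _ _ abs]) linarith
  also have "\<dots> \<le> (\<Sum>j\<in>?J. \<bar>?d (upper_end ab D j) - ?d (lower_end ab D j)\<bar>)"
    by (rule sum_abs)
  also have "\<dots> \<le> (\<Sum>j\<in>?J. 2 * E)"
  proof (rule sum_mono)
    fix j assume "j \<in> ?J"
    from E'[OF this] show "\<bar>?d (upper_end ab D j) - ?d (lower_end ab D j)\<bar> \<le> 2 * E"
      using abs_triangle_ineq4[of "?d (upper_end ab D j)" "?d (lower_end ab D j)"] by linarith
  qed
  also have "\<dots> \<le> real (Suc c) * (2 * E)"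
    using card_part_indices[of t] \<open>0 \<le> E\<close> unfolding sum_constant by (intro mult_right_mono) simp_all
  finally show ?thesis .
qed

end

section \<open>Counting beads\<close>

lemma frac_less_iff:
  "0 < snd x \<Longrightarrow> 0 < snd y \<Longrightarrow> frac_less x y \<longleftrightarrow> frac_val x < frac_val y"
proof -
  assume "0 < snd x" "0 < snd y"
  then have "frac_val x < frac_val y \<longleftrightarrow> real_of_int (fst x * int (snd y)) < real_of_int (fst y * int (snd x))"
    by (simp add: frac_val_def field_simps)
  then show ?thesis unfolding frac_less_def of_int_less_iff by simp
qed

text \<open>The cross-multiplied difference of the two fractions is a positive integer, hence at
  least 1.\<close>

lemma frac_gap:
  assumes "0 < snd x" "0 < snd y" "snd x \<le> Q" "snd y \<le> Q" "frac_val x < frac_val y"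
  shows "frac_val x + 1 / (real Q * real Q) \<le> frac_val y"
proof -
  have "fst x * int (snd y) < fst y * int (snd x)"
    using assms frac_less_iff[of x y] by (simp add: frac_less_def)
  then have "real_of_int 1 \<le> real_of_int (fst y * int (snd x) - fst x * int (snd y))"
    unfolding of_int_le_iff by simp
  then have "1 / (real (snd x) * real (snd y)) \<le>
      real_of_int (fst y * int (snd x) - fst x * int (snd y)) / (real (snd x) * real (snd y))"
    using assms by (intro divide_right_mono) auto
  also have "\<dots> = frac_val y - frac_val x"
    using assms by (simp add: frac_val_def field_simps)
  finally have "1 / (real (snd x) * real (snd y)) \<le> frac_val y - frac_val x" .
  moreover have "1 / (real Q * real Q) \<le> 1 / (real (snd x) * real (snd y))"
    using assms by (intro divide_left_mono mult_mono) auto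
  ultimately show ?thesis by linarith
qed

lemma length_filter_upt: "length (filter p [1..<Suc m]) = card {j \<in> {1..m}. p j}"
  by (subst distinct_length_filter) (auto intro!: arg_cong[of _ _ card])

lemma card_le_bound:
  assumes "\<And>j. j \<in> A \<Longrightarrow> 1 \<le> j \<and> real j \<le> y" "0 \<le> y"
  shows "real (card A) \<le> y"
proof -
  have "A \<subseteq> {1..nat \<lfloor>y\<rfloor>}"
  proof
    fix j assume "j \<in> A"
    with assms(1) have "1 \<le> j" "real j \<le> y" by blast+
    moreover from this have "j \<le> nat \<lfloor>y\<rfloor>" by (intro le_nat_floor)
    ultimately show "j \<in> {1..nat \<lfloor>y\<rfloor>}" by simp
  qed
  then have "card A \<le> nat \<lfloor>y\<rfloor>" using card_mono[of "{1..nat \<lfloor>y\<rfloor>}"] by simp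
  then show ?thesis using assms(2) by linarith
qed

text \<open>The set contains \<open>1, ..., \<lceil>y\<rceil> - 2\<close>. One unit is lost to
  rounding; the other is the margin \<open>real j + 1 < y\<close>, which later absorbs the shift of
  a bead.\<close>

lemma card_ge_bound:
  assumes "finite A" "\<And>j. 1 \<le> j \<Longrightarrow> real j + 1 < y \<Longrightarrow> j \<in> A"
  shows "y - 2 \<le> real (card A)"
proof -
  let ?m = "nat (\<lceil>y\<rceil> - 2)"
  have ceil: "real_of_int \<lceil>y\<rceil> - 1 < y" "y \<le> real_of_int \<lceil>y\<rceil>"
    using ceiling_correct[of y] by simp_all
  have "{1..?m} \<subseteq> A"
  proof
    fix j assume j: "j \<in> {1..?m}"
    then have "int j + 2 \<le> \<lceil>y\<rceil>" by auto
    then have "real_of_int (int j + 2) \<le> real_of_int \<lceil>y\<rceil>" by (simp only: of_int_le_iff)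
    with ceil have "real j + 1 < y" by simp
    with j show "j \<in> A" by (intro assms(2)) auto
  qed
  then have "?m \<le> card A" using card_mono[OF assms(1), of "{1..?m}"] by simp
  then have "\<lceil>y\<rceil> - 2 \<le> int (card A)" by simp
  then have "real_of_int (\<lceil>y\<rceil> - 2) \<le> real_of_int (int (card A))" by (simp only: of_int_le_iff)
  then have "real_of_int \<lceil>y\<rceil> - 2 \<le> real (card A)" by simp
  with diff_right_mono[OF ceil(2)] show ?thesis by (rule order_trans)
qed

lemma ideal_point_val:
  assumes "P = (l, r, h)" "0 < snd l" "0 < snd h" "0 < fst h" "0 < N"
  shows "frac_val (ideal_point N P j) = piece_left P + real j / (piece_height P * real N)"
    and "0 < snd (ideal_point N P j)"
proof -
  have aux: "(a * (c * n) + j * d * b) / (b * c * n) = a / b + j / (c / d * n)"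
    if "0 < b" "0 < c" "0 < d" "0 < n" for a b c d n j :: real
    using that by (simp add: field_simps)
  define c where "c = nat (fst h)"
  have c: "real_of_int (fst h) = real c" "0 < c" using assms(4) by (simp_all add: c_def)
  show "frac_val (ideal_point N P j) = piece_left P + real j / (piece_height P * real N)"
    using aux[of "real (snd l)" "real c" "real (snd h)" "real N" "real_of_int (fst l)" "real j"] c assms(2,3,5)
    by (simp add: ideal_point_def frac_val_def piece_left_def piece_height_def assms(1) flip: c_def)
  show "0 < snd (ideal_point N P j)"
    using assms(2,5) c by (simp add: ideal_point_def assms(1) flip: c_def)
qed

lemma ideal_points_eq:
  assumes P: "P = (l, r, h)" "0 < snd l" "0 < snd r" "0 < snd h" "0 < fst h" "0 < length u"
  shows "ideal_points u P = map (ideal_point (length u) P)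
    (filter (\<lambda>j. frac_val (ideal_point (length u) P j) < piece_right P) [1..<Suc (length u * length u)])"
proof -
  have "map (\<lambda>j. ideal_point (length u) P (Suc j)) [0..<m] = map (ideal_point (length u) P) [1..<Suc m]" for m
  proof -
    have "[1..<Suc m] = map Suc [0..<m]" by (simp add: map_Suc_upt del: upt_Suc)
    then show ?thesis by (simp only: map_map comp_def)
  qed
  moreover have "frac_less (ideal_point (length u) P j) r \<longleftrightarrow> frac_val (ideal_point (length u) P j) < frac_val r" for j
    using assms ideal_point_val(2)[OF P(1,2,4,5,6)] by (intro frac_less_iff) auto
  ultimately show ?thesis
    using P(1) by (simp add: ideal_points_def filter_map comp_def length_concat sum_list_triv piece_right_def del: upt_Suc)
qed

lemma ideal_points_null:
  assumes "P = (l, r, h)" "fst h \<le> 0"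
  shows "ideal_points u P = []"
proof -
  have "\<not> frac_less (ideal_point (length u) P j) r" for j
    using assms by (auto simp: frac_less_def ideal_point_def not_less)
  then show ?thesis using assms by (simp add: ideal_points_def)
qed

text \<open>The upper bound counts unshifted points and the lower bound points shifted by the full
  \<open>\<delta>\<close>; together they enclose the count for any shifts between 0 and
  \<open>\<delta>\<close>. The hypothesis keeps \<open>\<delta>\<close> within the distance of
  neighbouring points, so that shifting costs at most one of them.\<close>

lemma ideal_points_count:
  assumes P: "proper_piece ab P" and u: "0 < length u" and vol: "piece_volume P \<le> real (length u)"
    and \<delta>: "0 < piece_height P \<Longrightarrow> \<delta> \<le> 1 / (piece_height P * real (length u))"
  shows "real (length (filter (\<lambda>x. frac_val x \<le> t) (ideal_points u P))) \<le> real (length u) * piece_mass P t"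
    and "real (length u) * piece_mass P t - 2 \<le>
      real (length (filter (\<lambda>x. frac_val x + \<delta> \<le> t) (ideal_points u P)))"
proof -
  let ?N = "length u" and ?l = "piece_left P" and ?r = "piece_right P" and ?h = "piece_height P"
  obtain l r h where Pe: "P = (l, r, h)" by (cases P)
  have pos: "0 < snd l" "0 < snd r" "0 < snd h" and lr: "?l < ?r" and h0: "0 \<le> ?h"
    using P Pe by (auto simp: proper_piece_def proper_frac_def)
  have mass0: "0 \<le> piece_mass P t" using h0 by (simp add: piece_mass_def)
  have "real (length (filter (\<lambda>x. frac_val x \<le> t) (ideal_points u P))) \<le> real ?N * piece_mass P t \<and>
    real ?N * piece_mass P t - 2 \<le> real (length (filter (\<lambda>x. frac_val x + \<delta> \<le> t) (ideal_points u P)))"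
  proof (cases "0 < fst h")
    case False
    then have "?h \<le> 0" using Pe by (simp add: piece_height_def frac_val_def divide_nonpos_nonneg)
    then have "?h = 0" using h0 by simp
    then show ?thesis using ideal_points_null[OF Pe, of u] False by (simp add: piece_mass_def)
  next
    case True
    have h: "0 < ?h" using True pos Pe by (simp add: piece_height_def frac_val_def)
    have hN: "0 < ?h * real ?N" using h u by simp
    let ?x = "\<lambda>j. ?l + real j / (?h * real ?N)"
    let ?y = "real ?N * piece_mass P t"
    have len: "length (filter R (ideal_points u P)) =
        card {j \<in> {1..?N * ?N}. ?x j < ?r \<and> R (ideal_point ?N P j)}" for R
      unfolding ideal_points_eq[OF Pe pos(1,2,3) True u] filter_map length_map filter_filter length_filter_upt
      using ideal_point_val(1)[OF Pe pos(1,3) True u] by (simp add: comp_def)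
    have val: "frac_val (ideal_point ?N P j) = ?x j" for j
      by (rule ideal_point_val(1)[OF Pe pos(1,3) True u])
    show ?thesis
    proof
      show "real (length (filter (\<lambda>x. frac_val x \<le> t) (ideal_points u P))) \<le> ?y"
        unfolding len val
      proof (rule card_le_bound)
        fix j assume j: "j \<in> {j \<in> {1..?N * ?N}. ?x j < ?r \<and> ?x j \<le> t}"
        then have "real j / (?h * real ?N) \<le> min ?r t - ?l" by auto
        then have "real j \<le> (min ?r t - ?l) * (?h * real ?N)" using hN by (simp add: pos_divide_le_eq)
        also have "\<dots> \<le> max 0 (min ?r t - ?l) * (?h * real ?N)" using hN by (intro mult_right_mono) auto
        finally show "1 \<le> j \<and> real j \<le> ?y" using j by (simp add: piece_mass_def mult_ac)
      qed (use mass0 in simp)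
      show "?y - 2 \<le> real (length (filter (\<lambda>x. frac_val x + \<delta> \<le> t) (ideal_points u P)))"
        unfolding len val
      proof (rule card_ge_bound)
        fix j :: nat assume j: "1 \<le> j" "real j + 1 < ?y"
        have y: "?y = max 0 (min ?r t - ?l) * (?h * real ?N)" by (simp add: piece_mass_def mult_ac)
        have "0 < min ?r t - ?l"
        proof (rule ccontr)
          assume "\<not> 0 < min ?r t - ?l"
          then have "max 0 (min ?r t - ?l) = 0" by linarith
          then show False using j y by simp
        qed
        with y have y': "?y = (min ?r t - ?l) * (?h * real ?N)" by (simp add: max_def)
        with j have "(real j + 1) / (?h * real ?N) < min ?r t - ?l"
          using hN by (simp add: pos_divide_less_eq)
        \<comment> \<open>A whole spacing of ideal points remains before \<open>min ?r t\<close>,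
          more than enough for \<open>\<delta>\<close>.\<close>
        then have *: "?x j + 1 / (?h * real ?N) < min ?r t"
          unfolding add_divide_distrib by linarith
        \<comment> \<open>The volume bound guarantees that the wanted multiples are among the
          \<open>?N * ?N\<close> candidates.\<close>
        have "?y \<le> real ?N * piece_volume P"
          unfolding y' piece_volume_def using h u by (simp add: mult_ac mult_left_mono)
        also have "\<dots> \<le> real ?N * real ?N" using vol by (intro mult_left_mono) auto
        finally have "real j < real (?N * ?N)" using j by simp
        then have "j < ?N * ?N" by (simp only: of_nat_less_iff)
        moreover have "0 < 1 / (?h * real ?N)" using hN by simp
        with * \<delta>[OF h] have "?x j < ?r" "?x j + \<delta> \<le> t" by linarith+
        ultimately show "j \<in> {j \<in> {1..?N * ?N}. ?x j < ?r \<and> ?x j + \<delta> \<le> t}"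
          using j by simp
      qed simp
    qed
  qed
  then show "real (length (filter (\<lambda>x. frac_val x \<le> t) (ideal_points u P))) \<le> real ?N * piece_mass P t"
    and "real ?N * piece_mass P t - 2 \<le> real (length (filter (\<lambda>x. frac_val x + \<delta> \<le> t) (ideal_points u P)))"
    by blast+
qed

section \<open>From ideal points to the list of beads\<close>

lemma concat_if_less: "concat (map (\<lambda>s. if s < k then [z] else []) [0..<m]) = replicate (min k m) z"
proof (induction m)
  case (Suc m)
  then show ?case
    by (cases "m < k") (simp_all add: min_absorb1 min_absorb2 replicate_append_same)
qed simp

lemma raw_beads_count:
  assumes "i < length As" "k \<le> length w"
  shows "length (filter (\<lambda>p. snd p = i \<and> R (fst p)) (raw_beads u w (n, k, ab, As))) =
    k * length (filter R (fst ab # concat (map (ideal_points u) (As ! i))))"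
proof -
  let ?p = "\<lambda>p. snd p = i \<and> R (fst p)"
  let ?g = "\<lambda>Ps. fst ab # concat (map (ideal_points u) Ps)"
  have group: "length (filter ?p (concat (map (\<lambda>x. replicate k (x, i')) xs))) =
      (if i' = i then k * length (filter R xs) else 0)" for i' and xs :: "frac list"
    by (induction xs) auto
  let ?G = "\<lambda>(i', Ps). concat (map (\<lambda>x. replicate k (x, i')) (?g Ps))"
  have "length (filter ?p (concat (map ?G (List.enumerate m As)))) =
      (if m \<le> i \<and> i < m + length As then k * length (filter R (?g (As ! (i - m)))) else 0)" for m
  proof (induction As arbitrary: m)
    case (Cons Ps As)
    have "length (filter ?p (?G (m, Ps))) = (if m = i then k * length (filter R (?g Ps)) else 0)"
      using group[of m "?g Ps"] by (simp only: prod.case)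
    then have "length (filter ?p (concat (map ?G (List.enumerate m (Ps # As))))) =
        (if m = i then k * length (filter R (?g Ps)) else 0) +
        (if Suc m \<le> i \<and> i < Suc m + length As then k * length (filter R (?g (As ! (i - Suc m)))) else 0)"
      using Cons by (simp only: enumerate_simps list.map concat.simps filter_append length_append)
    moreover have "Suc m \<le> i \<Longrightarrow> (Ps # As) ! (i - m) = As ! (i - Suc m)"
      by (metis Suc_diff_le diff_Suc_Suc nth_Cons_Suc)
    ultimately show ?case by (simp only: list.size) (cases "m = i"; force)
  qed simp
  from this[of 0] show ?thesis
    using assms by (simp add: raw_beads_def concat_if_less min_absorb1 del: list.map)
qed

lemma raw_beads_elem:
  assumes "(x, i) \<in> set (raw_beads u w (n, k, ab, As))"
  shows "i < length As \<and> (x = fst ab \<or> (\<exists>P\<in>set (As ! i). x \<in> set (ideal_points u P)))"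
proof -
  obtain q where q: "q \<in> set (List.enumerate 0 As)" "(x, i) \<in> set (concat (map
      (\<lambda>x. replicate (min k (length w)) (x, fst q)) (fst ab # concat (map (ideal_points u) (snd q)))))"
  proof -
    have in_concat: "\<exists>q\<in>set qs. y \<in> set (f q)" if "y \<in> set (concat (map f qs))"
      for y :: "frac \<times> nat" and f and qs :: "(nat \<times> piece list) list"
      using that by auto
    show thesis
      using in_concat[OF assms[unfolded raw_beads_def concat_if_less case_prod_unfold fst_conv snd_conv]] that
      by blast
  qed
  have in_reps: "y \<in> set ys \<and> j = j'" if "(y, j) \<in> set (concat (map (\<lambda>x. replicate m (x, j')) ys))"
    for y ys and j j' m :: nat
    using that by (induction ys) auto
  define Ps where "Ps = snd q"
  have Ps: "(i, Ps) \<in> set (List.enumerate 0 As)" "x \<in> set (fst ab # concat (map (ideal_points u) Ps))"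
    using in_reps[OF q(2)] q(1) by (simp_all add: Ps_def)
  from Ps(1) have "i < length As" "Ps = As ! i" by (simp_all add: in_set_enumerate_eq)
  then show ?thesis using Ps(2) by auto
qed

lemma length_spread [simp]: "length (spread D xs) = length xs"
  by (simp add: spread_def)

lemma spread_nth:
  assumes "s < length xs" "0 < D" "0 < snd (fst (xs ! s))"
  shows "snd (spread D xs ! s) = snd (xs ! s)" "0 < snd (fst (spread D xs ! s))"
    "frac_val (fst (spread D xs ! s)) = frac_val (fst (xs ! s)) + real (Suc s) / real D"
proof -
  obtain a b i where x: "xs ! s = ((a, b), i)" by (metis prod.collapse)
  have eq: "spread D xs ! s = ((a * int D + int (Suc s * b), b * D), i)"
    using assms(1) by (simp add: spread_def nth_enumerate_eq x)
  have aux: "(p * d + q * c) / (c * d) = p / c + q / d" if "0 < c" "0 < d" for p q c d :: real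
    using that by (simp add: field_simps)
  show "snd (spread D xs ! s) = snd (xs ! s)" "0 < snd (fst (spread D xs ! s))"
    using assms by (simp_all add: eq x)
  show "frac_val (fst (spread D xs ! s)) = frac_val (fst (xs ! s)) + real (Suc s) / real D"
    using aux[of "real b" "real D" "real_of_int a" "real (Suc s)"] assms
    by (simp add: eq x frac_val_def distrib_right)
qed

lemma beads_in_card:
  "beads_in Y i S = card {s. s < length (neck_beads Y) \<and> snd (neck_beads Y ! s) = i \<and>
     frac_val (fst (neck_beads Y ! s)) \<in> S}"
  unfolding beads_in_def length_filter_conv_card by (simp add: case_prod_unfold)

lemma length_enc_list_elem: "x \<in> set xs \<Longrightarrow> length (e x) \<le> length (enc_list e xs)"
  unfolding enc_list_def by (induction xs) auto

lemma length_le_enc_list: "(\<And>x. e x \<noteq> []) \<Longrightarrow> length xs \<le> length (enc_list e xs)"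
proof -
  assume e: "\<And>x. e x \<noteq> []"
  have "length xs \<le> length (concat (map e xs))"
  proof (induction xs)
    case (Cons x xs)
    have "0 < length (e x)" using e by simp
    then show ?case using Cons by (simp del: length_greater_0_conv)
  qed simp
  then show ?thesis by (simp add: enc_list_def)
qed

lemma enc_frac_bounds:
  assumes "length (enc_frac r) \<le> m"
  shows "snd r < 2 ^ m" "nat (fst r) < 2 ^ m"
  using assms length_binary_le_iff[of "snd r" m] length_binary_le_iff[of "nat (fst r)" m]
  by (auto simp: enc_frac_def enc_prod_def enc_int_def enc_nat_def case_prod_unfold split: if_splits)

section \<open>Correctness of the reduction\<close>

lemma poly_le_power:
  fixes p :: "real poly"
  shows "\<exists>(C :: nat) d. \<forall>x\<ge>1. poly p x \<le> real C * x ^ d"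
proof (induction p)
  case 0
  then show ?case by (intro exI[of _ 0]) simp
next
  case (pCons a p)
  then obtain C d where C: "\<And>x. 1 \<le> x \<Longrightarrow> poly p x \<le> real C * x ^ d" by blast
  obtain c :: nat where c: "a \<le> real c" using real_arch_simple by blast
  have "poly (pCons a p) x \<le> real (c + C) * x ^ Suc d" if x: "1 \<le> x" for x
  proof -
    have "a \<le> real c * 1" using c by simp
    also have "\<dots> \<le> real c * x ^ Suc d" using x by (intro mult_left_mono one_le_power) auto
    finally have "a \<le> real c * x ^ Suc d" .
    moreover have "x * poly p x \<le> x * (real C * x ^ d)" using x C by (intro mult_left_mono) auto
    ultimately show ?thesis by (simp add: distrib_right distrib_left mult_ac)
  qed
  then show ?case by blast
qed

text \<open>A real polynomial need not be monotone, but the monomial dominating it is. This allows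
  the number \<open>n\<close> of agents to be replaced by the input length \<open>m\<close>, the
  only quantity from which the machine computes \<open>N\<close>.\<close>

lemma poly_bounded_power:
  assumes "poly_bounded a"
  shows "\<exists>(C :: nat) d. \<forall>n m. 1 \<le> n \<longrightarrow> n \<le> m \<longrightarrow> a n \<le> real C * real m ^ d"
proof -
  obtain p where p: "\<And>n. 1 \<le> n \<Longrightarrow> a n \<le> poly p (real n)"
    using assms unfolding poly_bounded_def by blast
  obtain C d where C: "\<And>x. 1 \<le> x \<Longrightarrow> poly p x \<le> real C * x ^ d" using poly_le_power[of p] by blast
  have "a n \<le> real C * real m ^ d" if "1 \<le> n" "n \<le> m" for n m
  proof -
    have "a n \<le> real C * real n ^ d" using p[OF that(1)] C[of "real n"] that by simp
    also have "\<dots> \<le> real C * real m ^ d" using that by (intro mult_left_mono power_mono) auto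
    finally show ?thesis .
  qed
  then show ?thesis by blast
qed

lemma bead_number_exists:
  assumes ell: "poly_bounded (\<lambda>n. real (ell n))" and eps: "inverse_poly \<epsilon>"
  shows "\<exists>C d. 0 < C \<and> (\<forall>n m. 1 \<le> n \<longrightarrow> n \<le> m \<longrightarrow> poly pV (real n) \<le> real (C * m ^ d) \<and>
    (\<forall>c M. c \<le> m * ell n \<longrightarrow> M \<le> m \<longrightarrow>
      4 * real (c + 1) * real (2 * M + 1) / real (C * m ^ d) \<le> \<epsilon> n))"
proof -
  obtain C1 d1 where 1: "\<And>n m. 1 \<le> n \<Longrightarrow> n \<le> m \<Longrightarrow> real (ell n) \<le> real C1 * real m ^ d1"
    using poly_bounded_power[OF ell] by blast
  obtain C2 d2 where 2: "\<And>n m. 1 \<le> n \<Longrightarrow> n \<le> m \<Longrightarrow> 1 / \<epsilon> n \<le> real C2 * real m ^ d2"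
    using poly_bounded_power[of "\<lambda>n. 1 / \<epsilon> n"] eps unfolding inverse_poly_def by blast
  have "poly_bounded (\<lambda>n. poly pV (real n))"
    unfolding poly_bounded_def by (intro exI[of _ pV]) simp
  then obtain C3 d3 where 3: "\<And>n m. 1 \<le> n \<Longrightarrow> n \<le> m \<Longrightarrow> poly pV (real n) \<le> real C3 * real m ^ d3"
    using poly_bounded_power[of "\<lambda>n. poly pV (real n)"] by blast
  have eps0: "\<And>n. 1 \<le> n \<Longrightarrow> 0 < \<epsilon> n" using eps by (simp add: inverse_poly_def)
  \<comment> \<open>The 12 is 4 times the 3 of \<open>2 * M + 1 \<le> 3 * m\<close>;
    \<open>C1 + 1\<close> comes from \<open>c + 1\<close>, \<open>C2\<close> from
    \<open>1 / \<epsilon> n\<close> and \<open>C3\<close> from the volumes, and the last 1 ensures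
    positivity. In \<open>d\<close>, the summand 2 pays for one factor \<open>m\<close> in
    \<open>c\<close> and one in \<open>2 * M + 1\<close>.\<close>
  define C where "C = 12 * (C1 + 1) * C2 + C3 + 1"
  define d where "d = d1 + d2 + d3 + 2"
  have key: "poly pV (real n) \<le> real (C * m ^ d) \<and> 4 * real (c + 1) * real (2 * M + 1) / real (C * m ^ d) \<le> \<epsilon> n"
    if n: "1 \<le> n" "n \<le> m" and c: "c \<le> m * ell n" and M: "M \<le> m" for n m c M
  proof
    let ?m = "real m"
    have m: "1 \<le> ?m" using n by simp
    have pw: "?m ^ i \<le> ?m ^ d" if "i \<le> d" for i using m that by (intro power_increasing)
    have "0 < C" "0 < m" using n by (simp_all add: C_def)
    then have CN: "0 < real (C * m ^ d)" by simp
    have "poly pV (real n) \<le> real C3 * ?m ^ d3" using 3 n by blast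
    also have "\<dots> \<le> real C * ?m ^ d"
      by (intro mult_mono pw) (auto simp: C_def d_def)
    finally show "poly pV (real n) \<le> real (C * m ^ d)" by simp
    have "real c \<le> real (m * ell n)" using c by (simp only: of_nat_le_iff)
    also have "\<dots> = ?m * real (ell n)" by simp
    also have "\<dots> \<le> ?m * (real C1 * ?m ^ d1)" using 1[OF n] by (intro mult_left_mono) auto
    finally have "real c \<le> real C1 * ?m ^ (d1 + 1)" by (simp add: mult_ac)
    moreover have "1 \<le> ?m ^ (d1 + 1)" using m by (rule one_le_power)
    ultimately have "real c + 1 \<le> real C1 * ?m ^ (d1 + 1) + ?m ^ (d1 + 1)" by (rule add_mono)
    then have c': "real (c + 1) \<le> real (C1 + 1) * ?m ^ (d1 + 1)"
      by (simp only: of_nat_add of_nat_1 distrib_right mult_1_left)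
    have alg: "4 * ((A * x ^ (d1 + 1)) * ((3 * x) * (B * x ^ d2))) = (12 * A * B) * x ^ (d1 + d2 + 2)"
      for A B x :: real by (simp add: power_add power2_eq_square)
    have M': "real (2 * M + 1) \<le> 3 * ?m" using M m by simp
    have "4 * real (c + 1) * real (2 * M + 1) / \<epsilon> n = 4 * (real (c + 1) * (real (2 * M + 1) * (1 / \<epsilon> n)))"
      by simp
    also have "\<dots> \<le> 4 * ((real (C1 + 1) * ?m ^ (d1 + 1)) * ((3 * ?m) * (real C2 * ?m ^ d2)))"
      using c' M' 2[OF n] eps0[OF n(1)] by (intro mult_left_mono mult_mono) auto
    also have "\<dots> = real (12 * (C1 + 1) * C2) * ?m ^ (d1 + d2 + 2)"
      unfolding alg by (simp only: of_nat_mult of_nat_numeral)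
    also have "\<dots> \<le> real C * ?m ^ d"
      by (intro mult_mono pw) (auto simp: C_def d_def)
    finally have "4 * real (c + 1) * real (2 * M + 1) \<le> real (C * m ^ d) * \<epsilon> n"
      using eps0[OF n(1)] by (simp add: pos_divide_le_eq)
    then show "4 * real (c + 1) * real (2 * M + 1) / real (C * m ^ d) \<le> \<epsilon> n"
      using CN by (simp add: pos_divide_le_eq mult.commute)
  qed
  show ?thesis
  proof (rule exI[of _ C], rule exI[of _ d], intro conjI allI impI)
    show "0 < C" by (simp add: C_def)
  next
    fix n m :: nat assume n: "1 \<le> n" "n \<le> m"
    show "poly pV (real n) \<le> real (C * m ^ d)"
      by (rule key[OF n le0 le0, THEN conjunct1])
  next
    fix n m c M assume a: "1 \<le> n" "n \<le> m" "c \<le> m * ell n" "M \<le> m"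
    show "4 * real (c + 1) * real (2 * M + 1) / real (C * m ^ d) \<le> \<epsilon> n"
      by (rule key[OF a, THEN conjunct2])
  qed
qed

lemma concat_count_le:
  assumes "\<And>P. P \<in> set Ps \<Longrightarrow> real (length (filter R (g P))) \<le> K * m P"
  shows "real (length (filter R (concat (map g Ps)))) \<le> K * (\<Sum>P\<leftarrow>Ps. m P)"
  using assms by (induction Ps) (auto simp: distrib_left intro!: add_mono)

lemma concat_count_ge:
  assumes "\<And>P. P \<in> set Ps \<Longrightarrow> K * m P - 2 \<le> real (length (filter R (g P)))"
  shows "K * (\<Sum>P\<leftarrow>Ps. m P) - 2 * real (length Ps) \<le> real (length (filter R (concat (map g Ps))))"
  using assms
proof (induction Ps)
  case (Cons P Ps)
  then have "K * m P - 2 \<le> real (length (filter R (g P)))"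
    "K * (\<Sum>P\<leftarrow>Ps. m P) - 2 * real (length Ps) \<le> real (length (filter R (concat (map g Ps))))"
    by auto
  then show ?case by (simp add: distrib_left)
qed simp

lemma enc_con_instance_bounds:
  fixes X :: con_instance
  defines "m \<equiv> length (enc_con_instance X)"
  shows "num_agents X \<le> m"
    and "snd (fst (con_interval X)) < 2 ^ m" "snd (snd (con_interval X)) < 2 ^ m"
    and "Ps \<in> set (con_agents X) \<Longrightarrow> length Ps \<le> m"
    and "Ps \<in> set (con_agents X) \<Longrightarrow> P \<in> set Ps \<Longrightarrow>
      snd (fst P) < 2 ^ m \<and> snd (fst (snd P)) < 2 ^ m \<and> nat (fst (snd (snd P))) < 2 ^ m"
proof -
  have m: "length (enc_frac (fst (con_interval X))) \<le> m" "length (enc_frac (snd (con_interval X))) \<le> m"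
    "length (enc_list (enc_list enc_piece) (con_agents X)) \<le> m"
    by (auto simp: m_def enc_con_instance_def enc_prod_def case_prod_unfold)
  show "snd (fst (con_interval X)) < 2 ^ m" "snd (snd (con_interval X)) < 2 ^ m"
    using m enc_frac_bounds by blast+
  have "num_agents X \<le> length (enc_list (enc_list enc_piece) (con_agents X))"
    unfolding num_agents_def by (rule length_le_enc_list) (simp add: enc_list_def)
  then show "num_agents X \<le> m" using m by simp
  show "length Ps \<le> m" if "Ps \<in> set (con_agents X)"
  proof -
    have "length Ps \<le> length (enc_list enc_piece Ps)"
      by (rule length_le_enc_list) (simp add: enc_prod_def enc_frac_def enc_nat_def case_prod_unfold)
    then show ?thesis using length_enc_list_elem[OF that, of "enc_list enc_piece"] m by linarith
  qed
  show "snd (fst P) < 2 ^ m \<and> snd (fst (snd P)) < 2 ^ m \<and> nat (fst (snd (snd P))) < 2 ^ m"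
    if "Ps \<in> set (con_agents X)" "P \<in> set Ps"
  proof -
    have "length (enc_piece P) \<le> m"
      using length_enc_list_elem[OF that(1), of "enc_list enc_piece"]
        length_enc_list_elem[OF that(2), of enc_piece] m by linarith
    then have "length (enc_frac (fst P)) \<le> m" "length (enc_frac (fst (snd P))) \<le> m"
      "length (enc_frac (snd (snd P))) \<le> m"
      by (auto simp: enc_prod_def case_prod_unfold)
    then show ?thesis using enc_frac_bounds by blast
  qed
qed

section \<open>The necklace of a fixed instance\<close>

context
  fixes pM pV X C d
  assumes X: "is_con_instance pM pV X" and C: "0 < C"
    and vol: "poly pV (real (num_agents X)) \<le> real (C * length (enc_con_instance X) ^ d)"
begin

abbreviation (input) "enc_X \<equiv> enc_con_instance X"
abbreviation (input) "n_X \<equiv> num_agents X"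
abbreviation (input) "k_X \<equiv> con_parts X"
abbreviation (input) "ab_X \<equiv> con_interval X"
abbreviation (input) "a_X \<equiv> frac_val (fst ab_X)"
abbreviation (input) "b_X \<equiv> frac_val (snd ab_X)"
abbreviation (input) "N_X \<equiv> C * length enc_X ^ d"
abbreviation (input) "Q_X \<equiv> 2 ^ length enc_X * 2 ^ length enc_X * N_X"
abbreviation (input) "raw_X \<equiv> raw_beads (unary C d enc_X) enc_X (con_data X)"
abbreviation (input) "D_X \<equiv> 2 ^ length raw_X * Q_X * Q_X"

lemma instance_basics:
  shows "1 \<le> k_X" "k_X \<le> n_X" "n_X \<le> length enc_X" "k_X \<le> length enc_X" "proper_interval ab_X"
    "a_X < b_X" "0 < snd (fst ab_X)" "0 < snd (snd ab_X)" "0 < N_X" "0 < Q_X" "0 < D_X"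
proof -
  show *: "1 \<le> k_X" "k_X \<le> n_X" "proper_interval ab_X" using X by (auto simp: is_con_instance_def)
  show n: "n_X \<le> length enc_X" by (rule enc_con_instance_bounds)
  then show "k_X \<le> length enc_X" using * by simp
  show "a_X < b_X" "0 < snd (fst ab_X)" "0 < snd (snd ab_X)"
    using * by (auto simp: proper_interval_def proper_frac_def)
  have "0 < length enc_X" using * n by linarith
  then show "0 < N_X" using C by simp
  then show "0 < Q_X" "0 < D_X" by simp_all
qed

lemma neck_beads_eq: "neck_beads (neck_of C d X) = spread D_X raw_X"
  by (simp add: neck_of_def beads_of_def resolution_def Let_def length_unary)

lemma pieces_ok:
  assumes "Ps \<in> set (con_agents X)"
  shows "list_all (proper_piece ab_X) Ps" "P \<in> set Ps \<Longrightarrow> piece_volume P \<le> real N_X"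
  using X assms vol unfolding is_con_instance_def by (blast, fastforce intro: order_trans)

text \<open>The fraction \<open>y\<close> in the last claim is a point to the right of
  \<open>x\<close> at distance at least \<open>1 / Q\<^sup>2\<close>, which keeps the shifted bead
  in the interval. It is the right end of the interval if \<open>x\<close> is the left end, and
  otherwise the right end of the piece to which \<open>x\<close> belongs.\<close>

lemma raw_bead_facts:
  assumes "(x, i) \<in> set raw_X"
  shows "i < n_X" "0 < snd x" "snd x \<le> Q_X" "a_X \<le> frac_val x"
    "\<exists>y. 0 < snd y \<and> snd y \<le> Q_X \<and> frac_val x < frac_val y \<and> frac_val y \<le> b_X"
proof -
  let ?m = "length enc_X" and ?y = "\<exists>y. 0 < snd y \<and> snd y \<le> Q_X \<and> frac_val x < frac_val y \<and> frac_val y \<le> b_X"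
  have pw: "2 ^ ?m \<le> Q_X"
  proof -
    have "0 < 2 ^ ?m * N_X" by (rule mult_pos_pos[OF _ instance_basics(9)]) simp
    then have "1 \<le> 2 ^ ?m * N_X" by (simp only: One_nat_def Suc_le_eq)
    then have "2 ^ ?m * 1 \<le> 2 ^ ?m * (2 ^ ?m * N_X)" by (rule mult_le_mono2)
    then show ?thesis by (simp only: mult.assoc mult_1_right)
  qed
  have el: "i < length (con_agents X)"
    "x = fst ab_X \<or> (\<exists>P\<in>set (con_agents X ! i). x \<in> set (ideal_points (unary C d enc_X) P))"
    using raw_beads_elem[OF assms[unfolded con_data_def]] by auto
  show "i < n_X" using el by (simp add: num_agents_def)
  have "0 < snd x \<and> snd x \<le> Q_X \<and> a_X \<le> frac_val x \<and> ?y"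
    using el(2)
  proof
    assume x: "x = fst ab_X"
    have "snd (fst ab_X) \<le> Q_X" "snd (snd ab_X) \<le> Q_X"
      using enc_con_instance_bounds(2,3)[of X] pw by linarith+
    then show ?thesis using x instance_basics by blast
  next
    assume "\<exists>P\<in>set (con_agents X ! i). x \<in> set (ideal_points (unary C d enc_X) P)"
    then obtain P where P: "P \<in> set (con_agents X ! i)" "x \<in> set (ideal_points (unary C d enc_X) P)" by blast
    have Ps: "con_agents X ! i \<in> set (con_agents X)" using el(1) by simp
    obtain l r h where Pe: "P = (l, r, h)" by (cases P)
    have pp: "proper_piece ab_X P" using pieces_ok(1)[OF Ps] P(1) by (simp add: list_all_iff)
    have pos: "0 < snd l" "0 < snd r" "0 < snd h"
      and ends: "a_X \<le> piece_left P" "piece_right P \<le> b_X" "piece_left P < piece_right P" "0 \<le> piece_height P"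
      using pp Pe by (auto simp: proper_piece_def proper_frac_def interval_of_def)
    have h: "0 < fst h" using P(2) ideal_points_null[OF Pe] by (metis empty_iff list.set(1) not_less)
    have u: "0 < length (unary C d enc_X)" using instance_basics(9) by (simp add: length_unary)
    from P(2) obtain j where j: "x = ideal_point N_X P j" "frac_val x < piece_right P"
      unfolding ideal_points_eq[OF Pe pos h u] by (auto simp: length_unary)
    note val = ideal_point_val[OF Pe pos(1,3) h instance_basics(9), of j]
    have bounds: "snd l < 2 ^ ?m" "snd r < 2 ^ ?m" "nat (fst h) < 2 ^ ?m"
      using enc_con_instance_bounds(5)[OF Ps P(1)] by (auto simp: Pe)
    have "snd x = snd l * nat (fst h) * N_X" by (simp add: j(1) ideal_point_def Pe)
    also have "\<dots> \<le> Q_X" using bounds by (intro mult_le_mono1 mult_le_mono) auto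
    finally have "snd x \<le> Q_X" .
    moreover have "0 \<le> real j / (piece_height P * real N_X)" using ends by (intro divide_nonneg_nonneg mult_nonneg_nonneg) auto
    then have "a_X \<le> frac_val x" unfolding j(1) val(1) using ends(1) by linarith
    moreover have "0 < snd x" unfolding j(1) by (rule val(2))
    moreover have "snd r \<le> Q_X" by (rule order_trans[OF less_imp_le[OF bounds(2)] pw])
    with pos j(2) ends have "0 < snd r \<and> snd r \<le> Q_X \<and> frac_val x < frac_val r \<and> frac_val r \<le> b_X"
      by (simp only: Pe piece_right_def prod.case)
    ultimately show ?thesis by blast
  qed
  then show "0 < snd x" "snd x \<le> Q_X" "a_X \<le> frac_val x"
    ?y
    by blast+
qed

abbreviation (input) "pos_X s \<equiv> frac_val (fst (spread D_X raw_X ! s))"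

text \<open>The power of two in the resolution exceeds every bead index and cancels, leaving the
  minimal distance of different points with denominators at most \<open>Q_X\<close>.\<close>

lemma shift_bound:
  assumes "s < length raw_X"
  shows "real (Suc s) / real D_X \<le> 1 / (real Q_X * real Q_X)" "0 < real (Suc s) / real D_X"
proof -
  have "Suc s \<le> 2 ^ length raw_X" using assms less_exp[of "length raw_X"] by linarith
  then have "real (Suc s) \<le> 2 ^ length raw_X" by (metis of_nat_le_iff of_nat_numeral of_nat_power)
  then have "real (Suc s) / real D_X \<le> 2 ^ length raw_X / real D_X"
    using instance_basics(11) by (intro divide_right_mono) auto
  also have "\<dots> = 1 / (real Q_X * real Q_X)" by simp
  finally show "real (Suc s) / real D_X \<le> 1 / (real Q_X * real Q_X)" .
  show "0 < real (Suc s) / real D_X" using instance_basics(11) by (intro divide_pos_pos) auto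
qed

lemma bead_facts:
  assumes s: "s < length raw_X"
  shows "snd (spread D_X raw_X ! s) = snd (raw_X ! s)" "0 < snd (fst (spread D_X raw_X ! s))"
    "pos_X s = frac_val (fst (raw_X ! s)) + real (Suc s) / real D_X"
    "snd (raw_X ! s) < n_X" "a_X < pos_X s" "pos_X s \<le> b_X"
proof -
  have el: "(fst (raw_X ! s), snd (raw_X ! s)) \<in> set raw_X" using s by simp
  note f = raw_bead_facts[OF el]
  show sp: "snd (spread D_X raw_X ! s) = snd (raw_X ! s)" "0 < snd (fst (spread D_X raw_X ! s))"
    "pos_X s = frac_val (fst (raw_X ! s)) + real (Suc s) / real D_X"
    using spread_nth[OF s instance_basics(11) f(2)] by blast+
  show "snd (raw_X ! s) < n_X" by (rule f(1))
  show "a_X < pos_X s" using f(4) sp(3) shift_bound(2)[OF s] by linarith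
  obtain y where y: "0 < snd y" "snd y \<le> Q_X" "frac_val (fst (raw_X ! s)) < frac_val y" "frac_val y \<le> b_X"
    using f(5) by blast
  show "pos_X s \<le> b_X"
    using frac_gap[OF f(2) y(1) f(3) y(2,3)] y(4) sp(3) shift_bound(1)[OF s] by linarith
qed

text \<open>A coincidence would require the later bead, with its larger shift, to start from a
  smaller point. But different points are at least \<open>1 / Q\<^sup>2\<close> apart, and two
  shifts differ by strictly less than that.\<close>

lemma beads_distinct:
  assumes "s < length raw_X" "s' < length raw_X" "s < s'"
  shows "pos_X s \<noteq> pos_X s'"
proof
  assume eq: "pos_X s = pos_X s'"
  let ?x = "fst (raw_X ! s)" and ?y = "fst (raw_X ! s')"
  have el: "(?x, snd (raw_X ! s)) \<in> set raw_X" "(?y, snd (raw_X ! s')) \<in> set raw_X" using assms by simp_all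
  have "real (Suc s) / real D_X < real (Suc s') / real D_X"
    using assms(3) instance_basics(11) by (intro divide_strict_right_mono) auto
  then have "frac_val ?y < frac_val ?x"
    using eq bead_facts(3)[OF assms(1)] bead_facts(3)[OF assms(2)] by linarith
  from frac_gap[OF raw_bead_facts(2)[OF el(2)] raw_bead_facts(2)[OF el(1)]
      raw_bead_facts(3)[OF el(2)] raw_bead_facts(3)[OF el(1)] this]
  show False
    using eq bead_facts(3)[OF assms(1)] bead_facts(3)[OF assms(2)]
      shift_bound(1)[OF assms(2)] shift_bound(2)[OF assms(1)] by linarith
qed

abbreviation (input) "beads_X i \<equiv> {s. s < length raw_X \<and> snd (raw_X ! s) = i}"

lemma raw_count:
  assumes "i < n_X"
  shows "card {s \<in> beads_X i. R (fst (raw_X ! s))} =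
    k_X * length (filter R (fst ab_X # concat (map (ideal_points (unary C d enc_X)) (con_agents X ! i))))"
  using raw_beads_count[of i "con_agents X" k_X enc_X R "unary C d enc_X" n_X ab_X] assms
    instance_basics(4)
  by (simp add: length_filter_conv_card num_agents_def con_data_def)

text \<open>Every shift lies between 0 and \<open>1 / Q\<^sup>2\<close>, so the count of shifted
  beads is enclosed by the counts in \<open>ideal_points_count\<close>, multiplied by
  \<open>k\<close>.\<close>

lemma bead_count:
  assumes i: "i < n_X" and t: "a_X \<le> t"
  shows "\<bar>real (card {s \<in> beads_X i. pos_X s \<le> t}) - real k_X * real N_X * agent_mass (con_agents X ! i) t\<bar>
    \<le> real k_X * (2 * real (length (con_agents X ! i)) + 1)"
proof -
  let ?Ps = "con_agents X ! i" and ?u = "unary C d enc_X" and ?\<delta> = "1 / (real Q_X * real Q_X)"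
  let ?pts = "concat (map (ideal_points ?u) ?Ps)" and ?v = "\<lambda>s. frac_val (fst (raw_X ! s))"
  have Ps: "?Ps \<in> set (con_agents X)" using i by (simp add: num_agents_def)
  have u: "0 < length ?u" "length ?u = N_X" using instance_basics(9) by (simp_all add: length_unary)
  have cnt: "real (length (filter (\<lambda>x. frac_val x \<le> t) (ideal_points ?u P))) \<le> real N_X * piece_mass P t"
    "real N_X * piece_mass P t - 2 \<le> real (length (filter (\<lambda>x. frac_val x + ?\<delta> \<le> t) (ideal_points ?u P)))"
    if P: "P \<in> set ?Ps" for P
  proof -
    have pp: "proper_piece ab_X P" using pieces_ok(1)[OF Ps] P by (simp add: list_all_iff)
    have v: "piece_volume P \<le> real (length ?u)" using pieces_ok(2)[OF Ps P] u by simp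
    \<comment> \<open>The height times \<open>N\<close> is at most \<open>Q_X\<close>, hence at most
      \<open>Q_X\<close> squared: the largest shift does not exceed the spacing of the ideal
      points.\<close>
    have \<delta>: "?\<delta> \<le> 1 / (piece_height P * real (length ?u))" if h: "0 < piece_height P"
    proof -
      obtain l r h where Pe: "P = (l, r, h)" by (cases P)
      have sh: "0 < snd h" using pp by (simp add: Pe proper_piece_def proper_frac_def)
      then have "0 < fst h" using h by (simp add: Pe piece_height_def frac_val_def zero_less_divide_iff)
      then have "piece_height P \<le> real (nat (fst h))"
        using sh by (simp add: Pe piece_height_def frac_val_def pos_divide_le_eq)
      also have "nat (fst h) \<le> 2 ^ length enc_X * 2 ^ length enc_X"
      proof -
        have "nat (fst h) * 1 \<le> 2 ^ length enc_X * 2 ^ length enc_X"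
          using enc_con_instance_bounds(5)[OF Ps P] by (intro mult_le_mono) (auto simp: Pe)
        then show ?thesis by simp
      qed
      finally have "piece_height P * real N_X \<le> real (2 ^ length enc_X * 2 ^ length enc_X) * real N_X"
        by (intro mult_right_mono) auto
      also have "\<dots> = real Q_X" by simp
      also have "real Q_X \<le> real Q_X * real Q_X"
      proof -
        have "1 \<le> Q_X" using instance_basics(10) by (simp only: One_nat_def Suc_le_eq)
        then have "real 1 \<le> real Q_X" by (simp only: of_nat_le_iff)
        from mult_left_mono[OF this of_nat_0_le_iff[of Q_X]] show ?thesis
          by (simp only: of_nat_1 mult_1_right)
      qed
      finally have A: "piece_height P * real N_X \<le> real Q_X * real Q_X" .
      have B: "0 < piece_height P * real N_X" using h instance_basics(9) by (intro mult_pos_pos) auto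
      show ?thesis unfolding u(2)
        by (rule divide_left_mono[OF A zero_le_one mult_pos_pos[OF less_le_trans[OF B A] B]])
    qed
    show "real (length (filter (\<lambda>x. frac_val x \<le> t) (ideal_points ?u P))) \<le> real N_X * piece_mass P t"
      "real N_X * piece_mass P t - 2 \<le> real (length (filter (\<lambda>x. frac_val x + ?\<delta> \<le> t) (ideal_points ?u P)))"
      by (rule ideal_points_count[OF pp u(1) v, unfolded u(2)], erule \<delta>[unfolded u(2)])+
  qed
  define M where "M = real (length ?Ps)"
  define F where "F = agent_mass ?Ps t"
  define k N where "k = real k_X" and "N = real N_X"
  define m m' where "m = length (filter (\<lambda>x. frac_val x \<le> t) ?pts)"
    and "m' = length (filter (\<lambda>x. frac_val x + ?\<delta> \<le> t) ?pts)"
  define B where "B = card {s \<in> beads_X i. pos_X s \<le> t}"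
  have m: "real m \<le> N * F" unfolding m_def N_def F_def agent_mass_def
    by (rule concat_count_le) (rule cnt(1))
  have m': "N * F - 2 * M \<le> real m'" unfolding m'_def N_def F_def M_def agent_mass_def
    by (rule concat_count_ge) (rule cnt(2))
  have "B \<le> card {s \<in> beads_X i. ?v s \<le> t}"
    unfolding B_def
  proof (intro card_mono subsetI)
    fix s assume "s \<in> {s \<in> beads_X i. pos_X s \<le> t}"
    then have s: "s < length raw_X" "snd (raw_X ! s) = i" "pos_X s \<le> t" by blast+
    have "?v s \<le> t"
      using s(3) bead_facts(3)[OF s(1)] shift_bound(2)[OF s(1)] by linarith
    with s show "s \<in> {s \<in> beads_X i. ?v s \<le> t}" by blast
  qed simp
  \<comment> \<open>The additional 1 is the group at the left end, which is counted because
    \<open>a_X \<le> t\<close>.\<close>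
  also have "\<dots> = k_X * Suc m"
    unfolding raw_count[OF i, of "\<lambda>x. frac_val x \<le> t"] m_def filter.simps if_P[OF t] list.size(4) by simp
  finally have "real B \<le> real (k_X * Suc m)" by (simp only: of_nat_le_iff)
  also have "\<dots> = k * (real m + 1)" by (simp add: k_def distrib_left)
  also have "\<dots> \<le> k * (N * F + 1)" using m by (intro mult_left_mono) (simp_all add: k_def)
  finally have upper: "real B \<le> k * (N * F) + k" by (simp add: distrib_left)
  have "k_X * m' \<le> k_X * length (filter (\<lambda>x. frac_val x + ?\<delta> \<le> t) (fst ab_X # ?pts))"
    unfolding m'_def by (intro mult_le_mono2) (simp only: filter.simps list.size split: if_split, simp)
  also have "\<dots> = card {s \<in> beads_X i. ?v s + ?\<delta> \<le> t}"
    unfolding raw_count[OF i, of "\<lambda>x. frac_val x + ?\<delta> \<le> t"] ..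
  also have "\<dots> \<le> B"
    unfolding B_def
  proof (intro card_mono subsetI)
    fix s assume "s \<in> {s \<in> beads_X i. ?v s + ?\<delta> \<le> t}"
    then have s: "s < length raw_X" "snd (raw_X ! s) = i" "?v s + ?\<delta> \<le> t" by blast+
    have "pos_X s \<le> t"
      using s(3) bead_facts(3)[OF s(1)] shift_bound(1)[OF s(1)] by linarith
    with s show "s \<in> {s \<in> beads_X i. pos_X s \<le> t}" by blast
  qed simp
  finally have "real (k_X * m') \<le> real B" by (simp only: of_nat_le_iff)
  then have "k * real m' \<le> real B" by (simp add: k_def)
  moreover have "k * (N * F - 2 * M) \<le> k * real m'" using m' by (intro mult_left_mono) (simp_all add: k_def)
  ultimately have lower: "k * (N * F) - k * (2 * M) \<le> real B" by (simp add: right_diff_distrib)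
  have "0 \<le> k * (2 * M)" "0 \<le> k" by (simp_all add: k_def M_def)
  with upper lower have "\<bar>real B - k * (N * F)\<bar> \<le> k * (2 * M) + k" by linarith
  then show ?thesis
    unfolding B_def k_def N_def F_def M_def by (simp only: distrib_left mult_1_right mult.assoc)
qed

lemma beads_in_neck:
  "beads_in (neck_of C d X) i S = card {s \<in> beads_X i. pos_X s \<in> S}"
proof -
  have "{s. s < length raw_X \<and> snd (spread D_X raw_X ! s) = i \<and> pos_X s \<in> S} =
      {s \<in> beads_X i. pos_X s \<in> S}"
    using bead_facts(1) by auto
  then show ?thesis unfolding beads_in_card neck_beads_eq length_spread by simp
qed

lemma neck_of_instance: "is_neck_instance (neck_of C d X)"
proof -
  let ?Y = "neck_of C d X"
  have Y: "neck_parts ?Y = k_X" "neck_colours ?Y = n_X" "neck_interval ?Y = ab_X"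
    by (simp_all add: neck_of_def)
  have mem: "proper_frac x \<and> frac_val x \<in> interval_of ab_X \<and> c < n_X" if xc: "(x, c) \<in> set (spread D_X raw_X)" for x c
  proof -
    obtain s where s: "s < length raw_X" "spread D_X raw_X ! s = (x, c)"
      using xc unfolding in_set_conv_nth length_spread by blast
    show ?thesis
      using bead_facts(1,2,4,5,6)[OF s(1)] unfolding s(2) fst_conv snd_conv
      by (simp add: proper_frac_def interval_of_def)
  qed
  have dist: "distinct (map (frac_val \<circ> fst) (spread D_X raw_X))"
    unfolding distinct_conv_nth length_map length_spread
  proof (intro allI impI)
    fix s s' assume "s < length raw_X" "s' < length raw_X" "s \<noteq> s'"
    then have s: "s < length raw_X" "s' < length raw_X" "pos_X s \<noteq> pos_X s'"
      using beads_distinct[of s s'] beads_distinct[of s' s] by (metis nat_neq_iff)+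
    then show "map (frac_val \<circ> fst) (spread D_X raw_X) ! s \<noteq> map (frac_val \<circ> fst) (spread D_X raw_X) ! s'"
      using nth_map[of s "spread D_X raw_X"] nth_map[of s' "spread D_X raw_X"]
      by (simp only: length_spread comp_apply) simp
  qed
  have "\<exists>\<alpha>>0. beads_in ?Y i (interval_of ab_X) = \<alpha> * k_X" if i: "i < n_X" for i
  proof -
    have "pos_X s \<in> interval_of ab_X" if "s < length raw_X" for s
      using bead_facts(5,6)[OF that] by (simp only: interval_of_def atLeastAtMost_iff less_imp_le)
    then have eq: "{s \<in> beads_X i. pos_X s \<in> interval_of ab_X} = {s \<in> beads_X i. True}"
      by blast
    \<comment> \<open>The share is the number of groups of colour \<open>i\<close>; it is positive
      because of the group at the left end.\<close>
    show ?thesis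
      unfolding beads_in_neck eq raw_count[OF i, of "\<lambda>_. True"]
      by (rule exI[of _ "length (filter (\<lambda>_. True)
        (fst ab_X # concat (map (ideal_points (unary C d enc_X)) (con_agents X ! i))))"])
        (rule conjI[OF _ mult.commute], simp)
  qed
  then show ?thesis
    unfolding is_neck_instance_def Y neck_beads_eq
    using instance_basics(1,2,5) mem dist by blast
qed

text \<open>Both parts contain the same number of beads of the agent's colour, so \<open>k N\<close>
  times either mass is close to one common value. Dividing by \<open>k N\<close> cancels
  \<open>k\<close>, which is why the final error depends on \<open>k\<close> only through the number
  of cuts.\<close>

lemma neck_solution:
  assumes D: "is_neck_solution ell (neck_of C d X) D"
    and eps: "\<And>M. M \<le> length enc_X \<Longrightarrow>
      4 * real ((k_X - 1) * ell n_X + 1) * real (2 * M + 1) / real N_X \<le> \<epsilon> n_X"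
  shows "is_con_solution ell \<epsilon> X D"
proof -
  let ?c = "(k_X - 1) * ell n_X"
  have div: "is_division ab_X k_X ?c D"
    and sol: "\<And>i j. i < n_X \<Longrightarrow> j < k_X \<Longrightarrow>
      beads_in (neck_of C d X) i (part ab_X D j) = bead_share (neck_of C d X) i"
    using D by (auto simp: is_neck_solution_def neck_of_def)
  have "\<bar>measure (value_measure Ps) (part ab_X D t) - measure (value_measure Ps) (part ab_X D j)\<bar> \<le> \<epsilon> n_X"
    if Ps: "Ps \<in> set (con_agents X)" and t: "t < k_X" "j < k_X" for Ps t j
  proof -
    obtain i where i: "i < n_X" "Ps = con_agents X ! i"
      using Ps unfolding in_set_conv_nth num_agents_def by blast
    let ?E = "real k_X * real (2 * length Ps + 1)" and ?\<mu> = "\<lambda>t. measure (value_measure Ps) (part ab_X D t)"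
    let ?b = "real (bead_share (neck_of C d X) i)" and ?K = "real k_X * real N_X"
    have disc: "\<bar>?b - ?K * ?\<mu> t\<bar> \<le> real (Suc ?c) * (2 * ?E)" if "t < k_X" for t
    proof -
      have "\<bar>real (card {s \<in> beads_X i. pos_X s \<in> part ab_X D t}) - ?K * ?\<mu> t\<bar> \<le> real (Suc ?c) * (2 * ?E)"
      proof (rule discrepancy[OF instance_basics(5) div])
        show "\<bar>real (card {s \<in> beads_X i. pos_X s \<le> x}) - ?K * agent_mass Ps x\<bar> \<le> ?E"
          if "x \<in> interval_of ab_X" for x
        proof -
          have "a_X \<le> x" using that by (simp add: interval_of_def)
          from bead_count[OF i(1) this] show ?thesis
            unfolding i(2) by (simp only: of_nat_add of_nat_mult of_nat_numeral of_nat_1)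
        qed
        show "finite (beads_X i)" by simp
        show "a_X < pos_X s" if "s \<in> beads_X i" for s using that bead_facts(5) by blast
        show "list_all (proper_piece ab_X) Ps" by (rule pieces_ok(1)[OF Ps])
      qed
      then show ?thesis unfolding sol[OF i(1) that, unfolded beads_in_neck] .
    qed
    have K: "0 < ?K" using instance_basics(1,9) by (intro mult_pos_pos) auto
    have "?K * \<bar>?\<mu> t - ?\<mu> j\<bar> = \<bar>?K * ?\<mu> t - ?K * ?\<mu> j\<bar>"
      unfolding right_diff_distrib[symmetric] abs_mult abs_of_nat ..
    also have "\<dots> \<le> real (Suc ?c) * (2 * ?E) + real (Suc ?c) * (2 * ?E)"
      using disc[OF t(1)] disc[OF t(2)] by linarith
    also have "\<dots> = ?K * (4 * real (?c + 1) * real (2 * length Ps + 1) / real N_X)"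
    proof -
      have alg: "x * (2 * (k * m)) + x * (2 * (k * m)) = k * n * (4 * x * m / n)"
        if "n \<noteq> 0" for x k m n :: real
        using that by simp
      have "real N_X \<noteq> 0" using instance_basics(9) by (simp only: of_nat_eq_0_iff)
      from alg[OF this] show ?thesis by (simp only: Suc_eq_plus1)
    qed
    finally have "\<bar>?\<mu> t - ?\<mu> j\<bar> \<le> 4 * real (?c + 1) * real (2 * length Ps + 1) / real N_X"
      using K by (rule mult_left_le_imp_le)
    also have "\<dots> \<le> \<epsilon> n_X" by (rule eps) (rule enc_con_instance_bounds(4)[OF Ps])
    finally show ?thesis .
  qed
  then show ?thesis using div unfolding is_con_solution_def by blast
qed

end

theorem theorem4:
  fixes pM pV :: "real poly" and ell :: "nat \<Rightarrow> nat" and \<epsilon> :: "nat \<Rightarrow> real"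
  assumes "poly_bounded (\<lambda>n. real (ell n))"
    and "inverse_poly \<epsilon>"
  shows "\<exists>f g. poly_time_reduction (con_division pM pV ell \<epsilon>) (neck_split ell) f g \<and>
           (\<forall>X\<in>instances (con_division pM pV ell \<epsilon>).
              neck_colours (f X) = num_agents X \<and> neck_parts (f X) = con_parts X)"
proof -
  obtain C d where C: "0 < C"
    and bd: "\<forall>n m. 1 \<le> n \<longrightarrow> n \<le> m \<longrightarrow> poly pV (real n) \<le> real (C * m ^ d) \<and>
      (\<forall>c M. c \<le> m * ell n \<longrightarrow> M \<le> m \<longrightarrow>
        4 * real (c + 1) * real (2 * M + 1) / real (C * m ^ d) \<le> \<epsilon> n)"
    using bead_number_exists[OF assms, of pV] by (elim exE conjE) (rule that)
  let ?P = "con_division pM pV ell \<epsilon>" and ?Q = "neck_split ell"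
  have inst: "is_neck_instance (neck_of C d X)"
    and sol: "is_neck_solution ell (neck_of C d X) D \<Longrightarrow> is_con_solution ell \<epsilon> X D"
    if X: "is_con_instance pM pV X" for X D
  proof -
    let ?m = "length (enc_con_instance X)" and ?n = "num_agents X"
    have k: "con_parts X \<le> ?n" and n: "1 \<le> ?n" "?n \<le> ?m"
      using X enc_con_instance_bounds(1)[of X] by (auto simp: is_con_instance_def)
    note bd_n = bd[rule_format, OF n]
    note ctx = X C conjunct1[OF bd_n]
    show "is_neck_instance (neck_of C d X)" by (rule neck_of_instance[OF ctx])
    \<comment> \<open>The number of cuts involves \<open>k\<close>, which is at most the input
      length; this is the form in which \<open>bd\<close> allows for it.\<close>
    have c: "(con_parts X - 1) * ell ?n \<le> ?m * ell ?n" using k n by (intro mult_le_mono1) simp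
    show "is_con_solution ell \<epsilon> X D" if "is_neck_solution ell (neck_of C d X) D"
      by (rule neck_solution[OF ctx that]) (rule conjunct2[OF bd_n, rule_format, OF c])
  qed
  have "poly_time_reduction ?P ?Q (neck_of C d) snd"
    unfolding poly_time_reduction_def
  proof (intro conjI)
    show "neck_of C d ` instances ?P \<subseteq> instances ?Q"
      using inst by (auto simp: con_division_def neck_split_def)
    show "\<forall>x\<in>instances ?P. \<forall>y\<in>solutions ?Q (neck_of C d x). snd (x, y) \<in> solutions ?P x"
      using sol by (auto simp: con_division_def neck_split_def)
    show "poly_time_computable_on (instances ?P) (enc_instance ?P) (enc_instance ?Q) (neck_of C d)"
      by (rule pt_poly_time_computable_on[OF pt_neck_string[of C d]])
        (simp add: con_division_def neck_split_def neck_string_enc)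
    show "poly_time_computable_on {(x, y). x \<in> instances ?P \<and> y \<in> solutions ?Q (neck_of C d x)}
       (enc_prod (enc_instance ?P) (enc_solution ?Q)) (enc_solution ?P) snd"
      by (rule pt_poly_time_computable_on[OF pt_skip_instance])
        (auto simp: con_division_def neck_split_def enc_prod_def skip_enc_con_instance)
  qed
  then show ?thesis
    by (intro exI[of _ "neck_of C d"] exI[of _ snd]) (simp add: neck_of_def)
qed

end
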